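(* Let $P=\mathbb{Z}[x_1,\dots,x_n]$ and let $I\subsetneq P$ be an ideal (given by finitely many generators) such that $R=P/I$ is a reduced torsion-free finite $\mathbb{Z}$-algebra. The following sequence of instructions is an algorithm which computes a finite set of polynomials whose residue classes generate the unit group $R^\times$. 1. Compute the minimal prime ideals $\mathfrak{p}_1,\dots,\mathfrak{p}_m$ of $I$. 2. For $i=1,\dots,m$: compute $q_i\in\bigcap_{j\ne i}\mathfrak{p}_j\mathbb{Q}[x_1,\dots,x_n]$ and $p_i\in\mathfrak{p}_i\mathbb{Q}[x_1,\dots,x_n]$ such that $q_i+p_i=1$. 3. Compute a finite set of polynomials $U\subseteq P$ whose residue classes generate $(P/\mathfrak{p}_1)^\times$. 4. For $j=2,\dots,m$ do the following: (a) Form the ideal $J=\bigl(\bigcap_{1\le i\le j-1}\mathfrak{p}_i\bigr)+\mathfrak{p}_j$ of $P$. (b) Compute polynomials $h_1,\dots,h_\ell\in P$ whose residue classes generate $(P/\mathfrak{p}_j)^\times$. (c) Write $U=\{g_1,\dots,g_k\}$ and compute a finite set of generators $B\subseteq\mathbb{Z}^{k+\ell}$ of the exponent lattice of $(\bar g_1,\dots,\bar g_k,\bar h_1^{-1},\dots,\bar h_\ell^{-1})$ in $P/J$. (d) Let $f=q_1+\cdots+q_{j-1}$ and replace $U$ by $$\bigl\{f g_1^{b_1}\cdots g_k^{b_k}+q_j h_1^{b_{k+1}}\cdots h_\ell^{b_{k+\ell}}\;\big|\; b=(b_1,\dots,b_{k+\ell})\in B\bigr\},$$ where each listed expression stands for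 a polynomial in $P$ whose residue class in $\mathbb{Q}\otimes_{\mathbb{Z}}\bigl(P/(\mathfrak{p}_1\cap\cdots\cap\mathfrak{p}_j)\bigr)$ equals the element given by the expression. Here $g_1^{b_1}\cdots g_k^{b_k}$ denotes a polynomial in $P$ representing the corresponding product of powers of units in $P/(\mathfrak{p}_1\cap\cdots\cap\mathfrak{p}_{j-1})$, and $h_1^{b_{k+1}}\cdots h_\ell^{b_{k+\ell}}$ denotes a polynomial in $P$ representing the corresponding product in $P/\mathfrak{p}_j$. 5. Return $U$. That is, such polynomials exist in each step and, whatever valid choices are made, the residue classes in $R$ of the elements of the returned set $U$ are units which generate $R^\times$.
   Context: A finite $\mathbb{Z}$-algebra is a commutative ring (with 1) whose additive group is a finitely generated $\mathbb{Z}$-module; it is torsion-free if its additive group is. $R^\times$ denotes the group of units of $R$; a bar denotes residue class in the appropriate quotient ring. For units $u_1,\dots,u_N$ of a commutative ring $T$, the exponent lattice of $(u_1,\dots,u_N)$ in $T$ is $\{(a_1,\dots,a_N)\in\mathbb{Z}^N\mid u_1^{a_1}\cdots u_N^{a_N}=1\}$. An empty intersection of ideals is the whole ring. *)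

theory Defs
  imports "HOL-Algebra.Algebra" "HOL-Library.Poly_Mapping"
begin

text \<open>
  The polynomial ring in the variables \<open>x\<^sub>0, \<dots>, x\<^sub>n\<^sub>-\<^sub>1\<close>. A monomial is its exponent
  vector, a finitely supported function from variable indices to exponents, and a polynomial is a
  finitely supported function from monomials to coefficients; the product on \<open>poly_mapping\<close> is
  convolution. All indices below start at \<open>0\<close>.
\<close>

type_synonym 'a mpoly = "(nat \<Rightarrow>\<^sub>0 nat) \<Rightarrow>\<^sub>0 'a"

definition mpoly_ring :: "nat \<Rightarrow> 'a::comm_ring_1 mpoly ring" where
  "mpoly_ring n =
     \<lparr>carrier = {f. \<forall>m \<in> Poly_Mapping.keys f. Poly_Mapping.keys m \<subseteq> {..<n}},
      monoid.mult = (*), one = 1, ring.zero = 0, ring.add = (+)\<rparr>"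

abbreviation ZX :: "nat \<Rightarrow> int mpoly ring" where "ZX \<equiv> mpoly_ring"

abbreviation QX :: "nat \<Rightarrow> rat mpoly ring" where "QX \<equiv> mpoly_ring"

definition rat_mpoly :: "int mpoly \<Rightarrow> rat mpoly" where
  "rat_mpoly = Poly_Mapping.map rat_of_int"

definition rat_extension :: "nat \<Rightarrow> int mpoly set \<Rightarrow> rat mpoly set" where
  "rat_extension n \<aa> = Idl\<^bsub>QX n\<^esub> (rat_mpoly ` \<aa>)"

text \<open>Intersection of a family of ideals; the empty intersection is the whole ring.\<close>

definition ideal_Inter :: "('a, 'b) ring_scheme \<Rightarrow> 'a set set \<Rightarrow> 'a set" where
  "ideal_Inter R F = carrier R \<inter> \<Inter>F"

definition finite_int_algebra :: "('a, 'b) ring_scheme \<Rightarrow> bool" where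
  "finite_int_algebra R \<longleftrightarrow>
     cring R \<and> (\<exists>S. finite S \<and> S \<subseteq> carrier R \<and> generate (add_monoid R) S = carrier R)"

definition torsion_free_ring :: "('a, 'b) ring_scheme \<Rightarrow> bool" where
  "torsion_free_ring R \<longleftrightarrow>
     (\<forall>x \<in> carrier R. \<forall>k::int. k \<noteq> 0 \<longrightarrow> [k] \<cdot>\<^bsub>R\<^esub> x = \<zero>\<^bsub>R\<^esub> \<longrightarrow> x = \<zero>\<^bsub>R\<^esub>)"

definition reduced_ring :: "('a, 'b) ring_scheme \<Rightarrow> bool" where
  "reduced_ring R \<longleftrightarrow>
     (\<forall>x \<in> carrier R. \<forall>k::nat. x [^]\<^bsub>R\<^esub> k = \<zero>\<^bsub>R\<^esub> \<longrightarrow> x = \<zero>\<^bsub>R\<^esub>)"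

definition minimal_primes :: "('a, 'b) ring_scheme \<Rightarrow> 'a set \<Rightarrow> 'a set set" where
  "minimal_primes R I =
     {\<pp>. primeideal \<pp> R \<and> I \<subseteq> \<pp> \<and>
          (\<forall>\<qq>. primeideal \<qq> R \<and> I \<subseteq> \<qq> \<and> \<qq> \<subseteq> \<pp> \<longrightarrow> \<qq> = \<pp>)}"

definition unit_generators :: "('a, 'b) ring_scheme \<Rightarrow> 'a set \<Rightarrow> 'a set \<Rightarrow> bool" where
  "unit_generators R \<aa> U \<longleftrightarrow>
     finite U \<and> U \<subseteq> carrier R \<and>
     (\<lambda>u. \<aa> +>\<^bsub>R\<^esub> u) ` U \<subseteq> Units (R Quot \<aa>) \<and>
     generate (units_of (R Quot \<aa>)) ((\<lambda>u. \<aa> +>\<^bsub>R\<^esub> u) ` U) = Units (R Quot \<aa>)"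

definition int_vectors :: "nat \<Rightarrow> (nat \<Rightarrow> int) monoid" where
  "int_vectors N = product_group {..<N} (\<lambda>_. integer_group)"

definition power_product ::
    "('a, 'b) ring_scheme \<Rightarrow> 'a list \<Rightarrow> (nat \<Rightarrow> int) \<Rightarrow> 'a" where
  "power_product T us a = (\<Otimes>\<^bsub>T\<^esub>i\<in>{..<length us}. (us ! i) [^]\<^bsub>T\<^esub> a i)"

definition exponent_lattice :: "('a, 'b) ring_scheme \<Rightarrow> 'a list \<Rightarrow> (nat \<Rightarrow> int) set" where
  "exponent_lattice T us =
     {a \<in> carrier (int_vectors (length us)). power_product T us a = \<one>\<^bsub>T\<^esub>}"

text \<open>
  The list \<open>ps\<close> enumerates the minimal primes. The index \<open>j\<close> is the
  \<open>0\<close>-based position in \<open>ps\<close> of the prime being processed, so exactly the \<open>j\<close> primes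
  \<open>ps ! 0, \<dots>, ps ! (j - 1)\<close> precede it.
\<close>

definition minimal_prime_list :: "nat \<Rightarrow> int mpoly set \<Rightarrow> int mpoly set list \<Rightarrow> bool" where
  "minimal_prime_list n I ps \<longleftrightarrow> distinct ps \<and> set ps = minimal_primes (ZX n) I"

definition splitting ::
    "nat \<Rightarrow> int mpoly set list \<Rightarrow> (nat \<Rightarrow> rat mpoly) \<Rightarrow> (nat \<Rightarrow> rat mpoly) \<Rightarrow> bool" where
  "splitting n ps q p \<longleftrightarrow>
     (\<forall>i < length ps.
        q i \<in> ideal_Inter (QX n) {rat_extension n (ps ! j) | j. j < length ps \<and> j \<noteq> i} \<and>
        p i \<in> rat_extension n (ps ! i) \<and>
        q i \<oplus>\<^bsub>QX n\<^esub> p i = \<one>\<^bsub>QX n\<^esub>)"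

definition prefix_Inter :: "nat \<Rightarrow> int mpoly set list \<Rightarrow> nat \<Rightarrow> int mpoly set" where
  "prefix_Inter n ps j = ideal_Inter (ZX n) (set (take j ps))"

definition glue_ideal :: "nat \<Rightarrow> int mpoly set list \<Rightarrow> nat \<Rightarrow> int mpoly set" where
  "glue_ideal n ps j = prefix_Inter n ps j <+>\<^bsub>ZX n\<^esub> ps ! j"

definition lattice_generators ::
    "nat \<Rightarrow> int mpoly set \<Rightarrow> int mpoly list \<Rightarrow> int mpoly list \<Rightarrow> (nat \<Rightarrow> int) set \<Rightarrow> bool" where
  "lattice_generators n J gs hs B \<longleftrightarrow>
     finite B \<and> B \<subseteq> carrier (int_vectors (length gs + length hs)) \<and>
     generate (int_vectors (length gs + length hs)) B =
       exponent_lattice (ZX n Quot J)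
         (map (\<lambda>g. J +>\<^bsub>ZX n\<^esub> g) gs @
          map (\<lambda>h. inv\<^bsub>ZX n Quot J\<^esub> (J +>\<^bsub>ZX n\<^esub> h)) hs)"

definition represents_product ::
    "nat \<Rightarrow> int mpoly set \<Rightarrow> int mpoly list \<Rightarrow> (nat \<Rightarrow> int) \<Rightarrow> int mpoly \<Rightarrow> bool" where
  "represents_product n \<aa> us a x \<longleftrightarrow>
     x \<in> carrier (ZX n) \<and>
     \<aa> +>\<^bsub>ZX n\<^esub> x = power_product (ZX n Quot \<aa>) (map (\<lambda>u. \<aa> +>\<^bsub>ZX n\<^esub> u) us) a"

text \<open>
  With \<open>\<aa> = \<pp>\<^sub>0 \<inter> \<dots> \<inter> \<pp>\<^sub>j\<close>, the ring \<open>\<rat> \<otimes>\<^sub>\<int> (\<int>[x]/\<aa>)\<close> is identified with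
  \<open>\<rat>[x]/\<aa>\<rat>[x]\<close> in the canonical way; this is what gives the rational polynomial
  \<open>f G + q\<^sub>j H\<close> a residue class in it.
\<close>

definition glues ::
    "nat \<Rightarrow> int mpoly set list \<Rightarrow> (nat \<Rightarrow> rat mpoly) \<Rightarrow> nat \<Rightarrow>
     int mpoly \<Rightarrow> int mpoly \<Rightarrow> int mpoly \<Rightarrow> bool" where
  "glues n ps q j G H w \<longleftrightarrow>
     w \<in> carrier (ZX n) \<and>
     (let \<aa> = rat_extension n (prefix_Inter n ps (Suc j));
          f = (\<Oplus>\<^bsub>QX n\<^esub>i\<in>{..<j}. q i)
      in \<aa> +>\<^bsub>QX n\<^esub> rat_mpoly w =
         \<aa> +>\<^bsub>QX n\<^esub>
           (f \<otimes>\<^bsub>QX n\<^esub> rat_mpoly G \<oplus>\<^bsub>QX n\<^esub> q j \<otimes>\<^bsub>QX n\<^esub> rat_mpoly H))"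

text \<open>
  \<open>reachable n ps q j U\<close>: for some valid choices, \<open>U\<close> is the current set of polynomials once the
  first \<open>j\<close> primes have been processed. An enumeration \<open>gs\<close> or \<open>hs\<close> may contain repetitions.
  The exponents of the \<open>h\<close>'s are the entries of \<open>b\<close> from position \<open>length gs\<close> on.
\<close>

inductive reachable ::
    "nat \<Rightarrow> int mpoly set list \<Rightarrow> (nat \<Rightarrow> rat mpoly) \<Rightarrow> nat \<Rightarrow> int mpoly set \<Rightarrow> bool"
  for n :: nat and ps :: "int mpoly set list" and q :: "nat \<Rightarrow> rat mpoly" where
  start: "unit_generators (ZX n) (ps ! 0) U \<Longrightarrow> reachable n ps q 1 U"
| step: "\<lbrakk>reachable n ps q j U; j < length ps;
          unit_generators (ZX n) (ps ! j) (set hs);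
          set gs = U;
          lattice_generators n (glue_ideal n ps j) gs hs B;
          \<And>b. b \<in> B \<Longrightarrow> represents_product n (prefix_Inter n ps j) gs b (G b);
          \<And>b. b \<in> B \<Longrightarrow> represents_product n (ps ! j) hs (\<lambda>i. b (length gs + i)) (H b);
          \<And>b. b \<in> B \<Longrightarrow> glues n ps q j (G b) (H b) (w b)\<rbrakk>
         \<Longrightarrow> reachable n ps q (Suc j) (w ` B)"

text \<open>
  From the state \<open>U\<close> the iteration for \<open>ps ! j\<close> can be carried out, whatever choices are made
  inside it: each object to be computed exists, and the residue classes whose (possibly negative)
  powers are formed are units.
\<close>

definition iteration_possible ::
    "nat \<Rightarrow> int mpoly set list \<Rightarrow> (nat \<Rightarrow> rat mpoly) \<Rightarrow> nat \<Rightarrow> int mpoly set \<Rightarrow> bool" where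
  "iteration_possible n ps q j U \<longleftrightarrow>
     (let A = prefix_Inter n ps j; J = glue_ideal n ps j in
      finite U \<and> U \<subseteq> carrier (ZX n) \<and>
      (\<forall>g \<in> U. A +>\<^bsub>ZX n\<^esub> g \<in> Units (ZX n Quot A) \<and> J +>\<^bsub>ZX n\<^esub> g \<in> Units (ZX n Quot J)) \<and>
      (\<exists>hs. unit_generators (ZX n) (ps ! j) (set hs)) \<and>
      (\<forall>gs hs. set gs = U \<and> unit_generators (ZX n) (ps ! j) (set hs) \<longrightarrow>
         (\<forall>h \<in> set hs. J +>\<^bsub>ZX n\<^esub> h \<in> Units (ZX n Quot J)) \<and>
         (\<exists>B. lattice_generators n J gs hs B) \<and>
         (\<forall>B b. lattice_generators n J gs hs B \<and> b \<in> B \<longrightarrow>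
            (\<exists>G. represents_product n A gs b G) \<and>
            (\<exists>H. represents_product n (ps ! j) hs (\<lambda>i. b (length gs + i)) H) \<and>
            (\<forall>G H. represents_product n A gs b G \<and>
                   represents_product n (ps ! j) hs (\<lambda>i. b (length gs + i)) H \<longrightarrow>
               (\<exists>w. glues n ps q j G H w)))))"

end

theory Submission
  imports Defs "HOL-Computational_Algebra.Polynomial_Factorial"
    "HOL-Computational_Algebra.Fundamental_Theorem_Algebra"
begin

text \<open>
  Write \<open>P = \<int>[x]\<close>. The algebra \<open>P/I\<close> is studied through its complex points, the ring homomorphisms
  \<open>P \<rightarrow> \<complex>\<close> that vanish on \<open>I\<close>. Since \<open>P/I\<close> is finite over \<open>\<int>\<close>, the value of a point at an element
  is a root of a monic integer polynomial (\<open>finite_int_algebra_integral\<close>), so there are only finitely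
  many points. They are produced by a Nullstellensatz without maximal ideals: the product of the
  \<open>x\<^sub>k - \<alpha>\<close> over the roots \<open>\<alpha>\<close> lies in the extension of \<open>I\<close> to \<open>\<complex>[x]\<close>, and a multiplicative set that
  avoids an ideal still avoids the ideal obtained by adjoining a suitable factor of an element of it
  (\<open>adjoin_factor_disjoint\<close>). Doing this for every variable gives a point that vanishes nowhere on the
  multiplicative set (\<open>complex_point_exists\<close>). As \<open>P/I\<close> is torsion-free and reduced, it follows that the
  minimal primes are the kernels of the points (\<open>minimal_primes_conv\<close>) and that they intersect in \<open>I\<close>.

  The arithmetic core is that \<open>(P/\<pp>)\<^sup>\<times>\<close> is finitely generated for a minimal prime \<open>\<pp>\<close>. The minimal
  polynomial of \<open>f \<notin> \<pp>\<close> is monic up to sign with integer coefficients, each of its complex roots is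
  the value of \<open>f\<close> at some point, and its constant term is a nonzero integer; so \<open>f\<close> has absolute
  value at least \<open>1\<close> at some point (\<open>nonzero_has_large_value\<close>). So only finitely many residue classes
  have all their values below a given bound. The logarithms of the absolute values therefore map the
  units to a real vector space so that bounded sets have finite preimages, and a group with such a
  homomorphism is finitely generated (\<open>fin_gen_by_bounded_sets\<close>).

  In the iteration let \<open>A = \<pp>\<^sub>0 \<inter> \<dots> \<inter> \<pp>\<^sub>j\<^sub>-\<^sub>1\<close> and \<open>\<pp> = \<pp>\<^sub>j\<close>. Over \<open>\<rat>\<close> the \<open>q\<^sub>i\<close> are the idempotents of a
  product of fields, so \<open>w\<close> represents \<open>f G + q\<^sub>j H\<close> iff \<open>w \<equiv> G\<close> modulo \<open>A\<close> and \<open>w \<equiv> H\<close> modulo \<open>\<pp>\<close>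
  (\<open>glues_iff\<close>). The ring \<open>P/(A \<inter> \<pp>)\<close> is the fibre product of \<open>P/A\<close> and \<open>P/\<pp>\<close> over \<open>P/(A + \<pp>)\<close>, and a class
  is a unit in it iff both components are (\<open>coset_unit_Int\<close>). Hence its units are the pairs of a power
  product of the \<open>g\<close> and one of the \<open>h\<close> whose images in \<open>P/(A + \<pp>)\<close> agree, which says that the exponents
  lie in the exponent lattice (\<open>glue_units\<close>). Generators of the lattice, which exist because it is
  a subgroup of \<open>\<int>\<^sup>N\<close> (\<open>subgroup_fin_gen\<close>), thus give generators of the units
  (\<open>glued_unit_generators\<close>), and induction leads from \<open>A = \<pp>\<^sub>0\<close> to \<open>A = I\<close>.
\<close>

section \<open>Finitely generated abelian groups\<close>

definition fin_gen :: "('a, 'b) monoid_scheme \<Rightarrow> 'a set \<Rightarrow> bool" where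
  "fin_gen G H \<longleftrightarrow> (\<exists>T. finite T \<and> T \<subseteq> H \<and> generate G T = H)"

lemma int_subgroup_cyclic:
  fixes D :: "int set"
  assumes zero: "0 \<in> D" and diff: "\<And>a b. a \<in> D \<Longrightarrow> b \<in> D \<Longrightarrow> a - b \<in> D"
  shows "\<exists>d\<in>D. \<forall>a\<in>D. d dvd a"
proof (cases "D = {0}")
  case True
  then show ?thesis by auto
next
  case False
  have neg: "- a \<in> D" if "a \<in> D" for a using diff[OF zero that] by simp
  have add: "a + b \<in> D" if "a \<in> D" "b \<in> D" for a b using diff[OF that(1) neg[OF that(2)]] by simp
  have mulnat: "int k * a \<in> D" if "a \<in> D" for k a
    by (induction k) (auto simp: zero algebra_simps intro: add that)
  have mul: "k * a \<in> D" if "a \<in> D" for k a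
    using mulnat[OF that, of "nat k"] neg[OF mulnat[OF that, of "nat (-k)"]] by (cases "k \<ge> 0") auto
  obtain x where "x \<in> D" "x \<noteq> 0" using False zero by auto
  then have ex: "\<exists>k. k > 0 \<and> int k \<in> D"
    by (intro exI[of _ "nat \<bar>x\<bar>"]) (use neg in \<open>auto simp: abs_if\<close>)
  define d where "d = (LEAST k. k > 0 \<and> int k \<in> D)"
  have d: "d > 0" "int d \<in> D" using LeastI_ex[OF ex] by (auto simp: d_def)
  have "int d dvd a" if "a \<in> D" for a
  proof -
    have "a mod int d = a - (a div int d) * int d" by (simp add: minus_div_mult_eq_mod)
    then have "a mod int d \<in> D" using diff[OF that mul[OF d(2)]] by simp
    moreover have "0 \<le> a mod int d" "a mod int d < int d" using d by auto
    ultimately have "a mod int d = 0"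
      using not_less_Least[of "nat (a mod int d)" "\<lambda>k. k > 0 \<and> int k \<in> D"]
      unfolding d_def[symmetric] by force
    then show ?thesis by auto
  qed
  then show ?thesis using d by auto
qed

lemma (in comm_group) generate_insert:
  assumes "a \<in> carrier G" "S \<subseteq> carrier G" "x \<in> generate G (insert a S)"
  shows "\<exists>(k::int) g. g \<in> generate G S \<and> x = a [^] k \<otimes> g"
  using assms(3)
proof (induction rule: generate.induct)
  case one
  show ?case by (rule exI[of _ 0], rule exI[of _ \<one>]) (auto intro: generate.one)
next
  case (incl h)
  show ?case
  proof (cases "h = a")
    case True
    then show ?thesis using assms by (intro exI[of _ 1] exI[of _ \<one>]) (auto intro: generate.one simp: int_pow_1)
  next
    case False
    then have "h \<in> S" using incl by auto
    then show ?thesis using assms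
      by (intro exI[of _ 0] exI[of _ h]) (auto intro: generate.incl)
  qed
next
  case (inv h)
  show ?case
  proof (cases "h = a")
    case True
    then show ?thesis using assms
      by (intro exI[of _ "-1"] exI[of _ \<one>]) (auto intro: generate.one simp: int_pow_neg int_pow_1)
  next
    case False
    then have "h \<in> S" using inv by auto
    then show ?thesis using assms
      by (intro exI[of _ 0] exI[of _ "inv h"]) (auto intro: generate.inv)
  qed
next
  case (eng h1 h2)
  then obtain k1 g1 k2 g2 where e: "g1 \<in> generate G S" "h1 = a [^] (k1::int) \<otimes> g1"
    "g2 \<in> generate G S" "h2 = a [^] (k2::int) \<otimes> g2" by blast
  have "g1 \<in> carrier G" "g2 \<in> carrier G" using e assms generate_in_carrier by auto
  then have "h1 \<otimes> h2 = a [^] (k1 + k2) \<otimes> (g1 \<otimes> g2)"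
    using assms(1) by (simp add: e int_pow_mult m_ac)
  then show ?case using e by (blast intro: generate.eng)
qed

lemma (in comm_group) mult_inv_cancel_left:
  assumes "a \<in> carrier G" "b \<in> carrier G" "c \<in> carrier G"
  shows "a \<otimes> b \<otimes> inv (a \<otimes> c) = b \<otimes> inv c"
proof -
  have "a \<otimes> b \<otimes> inv (a \<otimes> c) = b \<otimes> a \<otimes> (inv a \<otimes> inv c)"
    using assms by (simp add: inv_mult m_comm[of a b])
  also have "\<dots> = b \<otimes> (a \<otimes> inv a \<otimes> inv c)"
    using assms by (metis inv_closed m_assoc m_closed)
  finally show ?thesis using assms by simp
qed

text \<open>
  Induction on the number of generators: a subgroup \<open>H\<close> of \<open>\<langle>a, S\<rangle>\<close> is generated by \<open>H \<inter> \<langle>S\<rangle>\<close> and one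
  element whose exponent of \<open>a\<close> generates the group \<open>D \<subseteq> \<int>\<close> of all such exponents.
\<close>

lemma (in comm_group) subgroup_fin_gen:
  assumes "finite S" "S \<subseteq> carrier G" "subgroup H G" "H \<subseteq> generate G S"
  shows "fin_gen G H"
  using assms
proof (induction S arbitrary: H rule: finite_induct)
  case empty
  then have "H = {\<one>}" using subgroup.one_closed by (auto simp: generate_empty)
  then show ?case unfolding fin_gen_def by (intro exI[of _ "{}"]) (auto simp: generate_empty)
next
  case (insert a S)
  interpret H: subgroup H G by fact
  have aG: "a \<in> carrier G" and SG: "S \<subseteq> carrier G" using insert by auto
  have gS: "subgroup (generate G S) G" by (rule generate_is_subgroup[OF SG])
  interpret S: subgroup "generate G S" G by fact
  have "fin_gen G (H \<inter> generate G S)"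
    by (rule insert.IH[OF SG subgroups_Inter_pair[OF insert.prems(2) gS]]) auto
  then obtain T where T: "finite T" "T \<subseteq> H \<inter> generate G S" "generate G T = H \<inter> generate G S"
    by (auto simp: fin_gen_def)
  define D where "D = {k::int. \<exists>g\<in>generate G S. a [^] k \<otimes> g \<in> H}"
  have "\<exists>d\<in>D. \<forall>k\<in>D. d dvd k"
  proof (rule int_subgroup_cyclic)
    show "0 \<in> D" unfolding D_def by (auto intro!: bexI[of _ \<one>])
    fix k l assume "k \<in> D" "l \<in> D"
    then obtain g h where gh: "g \<in> generate G S" "h \<in> generate G S" "a [^] k \<otimes> g \<in> H" "a [^] l \<otimes> h \<in> H"
      by (auto simp: D_def)
    then have c: "g \<in> carrier G" "h \<in> carrier G" by auto
    have "a [^] k \<otimes> g \<otimes> inv (a [^] l \<otimes> h) = a [^] (k - l) \<otimes> (g \<otimes> inv h)"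
      using aG c by (simp add: int_pow_diff inv_mult m_ac)
    then show "k - l \<in> D" unfolding D_def using gh by (metis (mono_tags, lifting) H.m_closed H.m_inv_closed S.m_closed S.m_inv_closed mem_Collect_eq)
  qed
  then obtain d g where d: "g \<in> generate G S" "a [^] d \<otimes> g \<in> H" "\<And>k. k \<in> D \<Longrightarrow> d dvd k"
    by (auto simp: D_def)
  define h0 where "h0 = a [^] d \<otimes> g"
  have h0: "h0 \<in> H" "h0 \<in> carrier G" using d H.mem_carrier by (auto simp: h0_def)
  have gG: "g \<in> carrier G" using d by auto
  have ins: "insert h0 T \<subseteq> H" using T h0 by auto
  then have insG: "insert h0 T \<subseteq> carrier G" using H.mem_carrier by auto
  interpret I: subgroup "generate G (insert h0 T)" G by (rule generate_is_subgroup[OF insG])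
  have "generate G (insert h0 T) = H"
  proof
    show "generate G (insert h0 T) \<subseteq> H" by (rule generate_subgroup_incl[OF ins H.subgroup_axioms])
    show "H \<subseteq> generate G (insert h0 T)"
    proof
      fix x assume x: "x \<in> H"
      then have "x \<in> generate G (insert a S)" using insert.prems by auto
      from generate_insert[OF aG SG this] obtain k :: int and y where
        y: "y \<in> generate G S" "x = a [^] k \<otimes> y" by auto
      then have "k \<in> D" using x by (auto simp: D_def)
      then obtain e where e: "k = d * e" using d(3) by auto
      have yG: "y \<in> carrier G" using y by auto
      have "x \<otimes> inv (h0 [^] e) = y \<otimes> inv (g [^] e)"
        using aG gG yG mult_inv_cancel_left[of "a [^] (d * e)" y "g [^] e"]
        by (simp add: y(2) h0_def int_pow_distrib int_pow_pow e)
      moreover have "g [^] e \<in> generate G S" using d(1) gS by (metis subgroup_int_pow_closed)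
      moreover have "h0 [^] e \<in> H" using h0(1) H.subgroup_axioms by (metis subgroup_int_pow_closed)
      moreover have "x \<otimes> inv (h0 [^] e) \<in> H" using x \<open>h0 [^] e \<in> H\<close> by auto
      ultimately have "x \<otimes> inv (h0 [^] e) \<in> H \<inter> generate G S"
        using y(1) by (metis IntI S.m_closed S.m_inv_closed)
      then have 1: "x \<otimes> inv (h0 [^] e) \<in> generate G T" using T by auto
      have "generate G T \<subseteq> generate G (insert h0 T)" by (rule mono_generate) auto
      then have 1: "x \<otimes> inv (h0 [^] e) \<in> generate G (insert h0 T)" using 1 by auto
      have "h0 \<in> generate G (insert h0 T)" by (auto intro: generate.incl)
      then have "h0 [^] e \<in> generate G (insert h0 T)" using I.subgroup_axioms by (metis subgroup_int_pow_closed)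
      from I.m_closed[OF 1 this] show "x \<in> generate G (insert h0 T)"
        using x h0 by (simp add: m_assoc)
    qed
  qed
  then show ?case unfolding fin_gen_def using T ins by (intro exI[of _ "insert h0 T"]) auto
qed

text \<open>
  An analogue of the fact that a discrete subgroup of a real vector space is finitely generated.
  The induction removes one coordinate \<open>v\<close> at a time: if \<open>L a v \<noteq> 0\<close>, project along the vector \<open>L a\<close>
  and move \<open>a\<close> into \<open>Z\<close>. The projection has an infinite kernel, which is why finiteness is only
  required modulo the subgroup generated by \<open>Z\<close>.
\<close>

lemma (in comm_group) fin_gen_by_bounded_sets:
  fixes L :: "'a \<Rightarrow> 'v \<Rightarrow> real"
  assumes "finite V" "finite Z" "Z \<subseteq> carrier G"
    and hom: "\<And>x y v. x \<in> carrier G \<Longrightarrow> y \<in> carrier G \<Longrightarrow> v \<in> V \<Longrightarrow> L (x \<otimes> y) v = L x v + L y v"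
    and bdd: "\<And>B. \<exists>E. finite E \<and> E \<subseteq> carrier G \<and>
      (\<forall>x\<in>carrier G. (\<forall>v\<in>V. \<bar>L x v\<bar> \<le> B) \<longrightarrow> (\<exists>e\<in>E. \<exists>z\<in>generate G Z. x = e \<otimes> z))"
  shows "fin_gen G (carrier G)"
  using assms
proof (induction V arbitrary: L Z rule: finite_induct)
  case empty
  from empty(4)[of 0] obtain E where E: "finite E" "E \<subseteq> carrier G"
     "\<And>x. x \<in> carrier G \<Longrightarrow> \<exists>e\<in>E. \<exists>z\<in>generate G Z. x = e \<otimes> z" by auto
  have c: "E \<union> Z \<subseteq> carrier G" using E empty by auto
  have "x \<in> generate G (E \<union> Z)" if "x \<in> carrier G" for x
  proof -
    from E(3)[OF that] obtain e z where "e \<in> E" "z \<in> generate G Z" "x = e \<otimes> z" by auto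
    moreover have "generate G Z \<subseteq> generate G (E \<union> Z)" by (rule mono_generate) auto
    ultimately show ?thesis by (auto intro: generate.eng generate.incl)
  qed
  then have "generate G (E \<union> Z) = carrier G" using generate_incl[OF c] by auto
  then show ?case unfolding fin_gen_def using E empty c by (intro exI[of _ "E \<union> Z"]) auto
next
  case (insert v V)
  show ?case
  proof (cases "\<forall>a\<in>carrier G. L a v = 0")
    case True
    show ?thesis
    proof (rule insert.IH[OF insert.prems(1,2), of L])
      fix B :: real
      from insert.prems(4)[of "max B 0"] obtain E where E: "finite E" "E \<subseteq> carrier G"
         "\<And>x. x \<in> carrier G \<Longrightarrow> (\<forall>w\<in>insert v V. \<bar>L x w\<bar> \<le> max B 0) \<Longrightarrow> \<exists>e\<in>E. \<exists>z\<in>generate G Z. x = e \<otimes> z"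
        by auto
      show "\<exists>E. finite E \<and> E \<subseteq> carrier G \<and>
         (\<forall>x\<in>carrier G. (\<forall>v\<in>V. \<bar>L x v\<bar> \<le> B) \<longrightarrow> (\<exists>e\<in>E. \<exists>z\<in>generate G Z. x = e \<otimes> z))"
        using E True by (intro exI[of _ E]) (auto simp: le_max_iff_disj)
    qed (use insert in auto)
  next
    case False
    then obtain a where a: "a \<in> carrier G" "L a v \<noteq> 0" by auto
    have one: "L \<one> w = 0" if "w \<in> insert v V" for w
      using insert.prems(3)[OF one_closed one_closed that] by simp
    have Lnat: "L (a [^] n) w = real n * L a w" if "w \<in> insert v V" for n :: nat and w
      by (induction n) (use a insert.prems(3) that one in \<open>auto simp: algebra_simps\<close>)
    have Linv: "L (inv x) w = - L x w" if "w \<in> insert v V" "x \<in> carrier G" for x w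
      using insert.prems(3)[of x "inv x" w] that one[OF that(1)] by auto
    have Lpow: "L (a [^] k) w = real_of_int k * L a w" if "w \<in> insert v V" for k :: int and w
      using a that by (cases k rule: int_cases2) (auto simp: int_pow_neg int_pow_int Lnat Linv)
    \<comment> \<open>the projection along \<open>L a\<close> that makes the coordinate \<open>v\<close> vanish\<close>
    define L' where "L' x w = L x w - L x v / L a v * L a w" for x w
    show ?thesis
    proof (rule insert.IH[of "insert a Z" L'])
      show "L' (x \<otimes> y) w = L' x w + L' y w" if "x \<in> carrier G" "y \<in> carrier G" "w \<in> V" for x y w
        using insert.prems(3) that by (simp add: L'_def add_divide_distrib distrib_right)
      fix B :: real
      define M where "M = B + (\<Sum>w\<in>insert v V. \<bar>L a w\<bar>)"
      have M: "\<bar>L a w\<bar> \<le> (\<Sum>w\<in>insert v V. \<bar>L a w\<bar>)" if "w \<in> insert v V" for w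
        using insert.hyps that by (intro member_le_sum) auto
      from insert.prems(4)[of "max M (M-B)"] obtain E where E: "finite E" "E \<subseteq> carrier G"
         "\<And>x. x \<in> carrier G \<Longrightarrow> (\<forall>w\<in>insert v V. \<bar>L x w\<bar> \<le> max M (M-B)) \<Longrightarrow> \<exists>e\<in>E. \<exists>z\<in>generate G Z. x = e \<otimes> z"
        by auto
      have "\<exists>e\<in>E. \<exists>z\<in>generate G (insert a Z). x = e \<otimes> z"
        if x: "x \<in> carrier G" and bd: "\<And>w. w \<in> V \<Longrightarrow> \<bar>L' x w\<bar> \<le> B" for x
      proof -
        define k where "k = \<lfloor>L x v / L a v\<rfloor>"
        define t where "t = L x v / L a v - real_of_int k"
        have t: "0 \<le> t" "t \<le> 1" unfolding t_def k_def by linarith+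
        \<comment> \<open>a power of \<open>a\<close> bounds coordinate \<open>v\<close> and keeps the projection\<close>
        define y where "y = x \<otimes> inv (a [^] k)"
        have yG: "y \<in> carrier G" using x a by (auto simp: y_def)
        have Ly: "L y w = L' x w + t * L a w" if "w \<in> insert v V" for w
          using insert.prems(3)[of x "inv (a [^] k)" w] x a that
          by (simp add: y_def Linv Lpow L'_def t_def algebra_simps)
        have L0: "L' x v = 0" using a by (simp add: L'_def)
        have tL: "\<bar>t * L a w\<bar> \<le> \<bar>L a w\<bar>" for w using t by (simp add: abs_mult mult_left_le_one_le)
        have "\<bar>L y w\<bar> \<le> max M (M-B)" if "w \<in> insert v V" for w
        proof (cases "w = v")
          case True
          then show ?thesis using Ly[OF that] L0 tL[of v] M[OF that] unfolding M_def by auto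
        next
          case False
          then have "\<bar>L' x w\<bar> \<le> B" using that bd by auto
          then show ?thesis using Ly[OF that] tL[of w] M[OF that] unfolding M_def by linarith
        qed
        then obtain e z where ez: "e \<in> E" "z \<in> generate G Z" "y = e \<otimes> z" using E(3)[OF yG] by auto
        have sub: "subgroup (generate G (insert a Z)) G" by (rule generate_is_subgroup) (use a insert in auto)
        have "z \<in> generate G (insert a Z)" using ez(2) mono_generate[of Z "insert a Z"] by auto
        moreover have "a [^] k \<in> generate G (insert a Z)"
          using sub by (metis subgroup_int_pow_closed generate.incl insertI1)
        ultimately have zz: "z \<otimes> a [^] k \<in> generate G (insert a Z)" by (rule generate.eng)
        have zG: "z \<in> carrier G" "e \<in> carrier G" using generate_in_carrier[OF insert.prems(2) ez(2)] ez(1) E(2) by auto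
        have "x = y \<otimes> a [^] k" using x a by (simp add: y_def m_assoc)
        also have "\<dots> = e \<otimes> (z \<otimes> a [^] k)" unfolding ez(3) by (rule m_assoc) (use zG a in auto)
        finally show ?thesis using ez(1) zz by auto
      qed
      then show "\<exists>E. finite E \<and> E \<subseteq> carrier G \<and>
         (\<forall>x\<in>carrier G. (\<forall>v\<in>V. \<bar>L' x v\<bar> \<le> B) \<longrightarrow> (\<exists>e\<in>E. \<exists>z\<in>generate G (insert a Z). x = e \<otimes> z))"
        using E by (intro exI[of _ E]) auto
    qed (use insert a in auto)
  qed
qed

section \<open>Polynomials and maps between coefficient rings\<close>

abbreviation degree :: "'a::zero poly \<Rightarrow> nat" where "degree \<equiv> Polynomial.degree"

abbreviation lookup :: "('a \<Rightarrow>\<^sub>0 'b::zero) \<Rightarrow> 'a \<Rightarrow> 'b" where "lookup \<equiv> Poly_Mapping.lookup"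

abbreviation keys :: "('a \<Rightarrow>\<^sub>0 'b::zero) \<Rightarrow> 'a set" where "keys \<equiv> Poly_Mapping.keys"

abbreviation single :: "'a \<Rightarrow> 'b \<Rightarrow> ('a \<Rightarrow>\<^sub>0 'b::zero)" where "single \<equiv> Poly_Mapping.single"

locale ring_map =
  fixes \<phi> :: "'a::comm_ring_1 \<Rightarrow> 'b::comm_ring_1"
  assumes add: "\<phi> (x + y) = \<phi> x + \<phi> y"
    and mult: "\<phi> (x * y) = \<phi> x * \<phi> y"
    and one: "\<phi> 1 = 1"
begin

lemma zero: "\<phi> 0 = 0"
  using add[of 0 0] by simp

lemma uminus: "\<phi> (- x) = - \<phi> x"
  using add[of x "- x"] by (simp add: zero eq_neg_iff_add_eq_0 add.commute)

lemma diff: "\<phi> (x - y) = \<phi> x - \<phi> y"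
  using add[of x "- y"] by (simp add: uminus)

lemma sum: "\<phi> (sum f A) = (\<Sum>x\<in>A. \<phi> (f x))"
  by (induction A rule: infinite_finite_induct) (simp_all add: zero add)

lemma power: "\<phi> (x ^ k) = \<phi> x ^ k"
  by (induction k) (simp_all add: one mult)

lemma of_nat: "\<phi> (of_nat k) = of_nat k"
  by (induction k) (simp_all add: zero one add)

lemma of_int: "\<phi> (of_int k) = of_int k"
  by (cases k rule: int_cases2) (simp_all add: uminus of_nat)

lemma map_poly_add: "map_poly \<phi> (p + q) = map_poly \<phi> p + map_poly \<phi> q"
  by (intro poly_eqI) (simp add: coeff_map_poly zero add)

lemma map_poly_mult: "map_poly \<phi> (p * q) = map_poly \<phi> p * map_poly \<phi> q"
  by (intro poly_eqI) (simp add: coeff_map_poly zero coeff_mult sum mult)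

lemma map_poly_linear: "map_poly \<phi> [:- a, 1:] = [:- \<phi> a, 1:]"
  by (simp add: map_poly_pCons zero one uminus)

lemma poly_map: "poly (map_poly \<phi> p) (\<phi> x) = \<phi> (poly p x)"
  by (induction p) (simp_all add: map_poly_pCons zero add mult)

end

lemma ring_map_of_int: "ring_map (of_int :: int \<Rightarrow> 'a::comm_ring_1)"
  by unfold_locales simp_all

interpretation of_int: ring_map "of_int :: int \<Rightarrow> 'a::comm_ring_1"
  by (rule ring_map_of_int)

abbreviation int_eval :: "int poly \<Rightarrow> 'a::comm_ring_1 \<Rightarrow> 'a" where
  "int_eval F x \<equiv> poly (map_poly of_int F) x"

lemma lookup_map: "f 0 = 0 \<Longrightarrow> lookup (Poly_Mapping.map f p) k = f (lookup p k)"
  by (simp add: Poly_Mapping.map.rep_eq when_def)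

lemma sum_singles: "(\<Sum>k\<in>keys p. single k (lookup p k)) = p"
  by (intro poly_mapping_eqI)
    (simp add: lookup_sum lookup_single when_def in_keys_iff)

lemma mpoly_induct [case_names single add]:
  fixes p :: "'a \<Rightarrow>\<^sub>0 'b::comm_monoid_add"
  assumes "\<And>m c. P (single m c)" and "\<And>p q. P p \<Longrightarrow> P q \<Longrightarrow> P (p + q)"
  shows "P p"
proof -
  have "P (\<Sum>k\<in>A. single k (lookup p k))" if "finite A" for A
    using that by induction (use assms(1)[of undefined 0] assms in auto)
  from this[of "keys p"] show ?thesis by (simp add: sum_singles)
qed

text \<open>
  Both sides of multiplicativity are biadditive, so it suffices to compare monomials.
\<close>

lemma (in ring_map) ring_map_coefficients:
  "ring_map (Poly_Mapping.map \<phi> :: ('c::comm_monoid_add \<Rightarrow>\<^sub>0 'a) \<Rightarrow> ('c \<Rightarrow>\<^sub>0 'b))"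
proof
  let ?M = "Poly_Mapping.map \<phi> :: ('c \<Rightarrow>\<^sub>0 'a) \<Rightarrow> ('c \<Rightarrow>\<^sub>0 'b)"
  show add': "?M (p + q) = ?M p + ?M q" for p q
    by (intro poly_mapping_eqI) (simp add: lookup_map zero add lookup_add)
  have single: "?M (single m c) = single m (\<phi> c)" for m c
    by (simp add: zero)
  show "?M (p * q) = ?M p * ?M q" for p q
  proof (induction p rule: mpoly_induct)
    case p: (single m c)
    show ?case
      by (induction q rule: mpoly_induct)
        (simp_all add: single mult_single mult distrib_left add' del: map_single)
  qed (simp_all add: add' distrib_right)
  show "?M 1 = 1" by (simp add: single one flip: single_one)
qed

abbreviation const :: "'a::comm_ring_1 \<Rightarrow> 'a mpoly" where
  "const \<equiv> single 0"

definition var :: "nat \<Rightarrow> 'a::comm_ring_1 mpoly" where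
  "var k = single (single k 1) 1"

definition complex_mpoly :: "int mpoly \<Rightarrow> complex mpoly" where
  "complex_mpoly = Poly_Mapping.map of_int"

interpretation const: ring_map "const :: 'a::comm_ring_1 \<Rightarrow> 'a mpoly"
  by unfold_locales (simp_all add: single_add mult_single)

interpretation complex_mpoly: ring_map complex_mpoly
  unfolding complex_mpoly_def by (rule ring_map.ring_map_coefficients[OF ring_map_of_int])

interpretation rat_mpoly: ring_map rat_mpoly
  unfolding rat_mpoly_def by (rule ring_map.ring_map_coefficients[OF ring_map_of_int])

lemma lookup_complex_mpoly: "lookup (complex_mpoly f) m = of_int (lookup f m)"
  by (simp add: complex_mpoly_def lookup_map)

lemma lookup_rat_mpoly: "lookup (rat_mpoly f) m = of_int (lookup f m)"
  by (simp add: rat_mpoly_def lookup_map)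

lemma complex_mpoly_var: "complex_mpoly (var k) = var k"
  by (simp add: complex_mpoly_def var_def)

lemma complex_mpoly_const: "complex_mpoly (const c) = const (of_int c)"
  by (simp add: complex_mpoly_def)

abbreviation (input) polys :: "nat \<Rightarrow> 'a::comm_ring_1 mpoly set" where "polys n \<equiv> carrier (mpoly_ring n)"

lemma polys_simps:
  "x \<otimes>\<^bsub>mpoly_ring n\<^esub> y = x * y" "x \<oplus>\<^bsub>mpoly_ring n\<^esub> y = x + y"
  "\<one>\<^bsub>mpoly_ring n\<^esub> = 1" "\<zero>\<^bsub>mpoly_ring n\<^esub> = 0"
  by (simp_all add: mpoly_ring_def)

lemma mem_mpoly_ring:
  "f \<in> polys n \<longleftrightarrow> (\<forall>m\<in>keys f. keys m \<subseteq> {..<n})"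
  by (simp add: mpoly_ring_def)

lemma polys_add:
  "f \<in> polys n \<Longrightarrow> g \<in> polys n \<Longrightarrow> f + g \<in> polys n"
  using keys_add[of f g] unfolding mem_mpoly_ring by blast

lemma polys_uminus: "f \<in> polys n \<Longrightarrow> - f \<in> polys n"
  by (simp add: mem_mpoly_ring in_keys_iff)

lemma polys_mult:
  "f \<in> polys n \<Longrightarrow> g \<in> polys n \<Longrightarrow> f * g \<in> polys n"
  using keys_mult[of f g] keys_add unfolding mem_mpoly_ring by (fastforce dest!: subsetD)

lemma polys_const: "const c \<in> polys n"
  by (simp add: mem_mpoly_ring)

lemma polys_zero: "0 \<in> polys n" and polys_one: "1 \<in> polys n"
  by (simp_all add: mem_mpoly_ring)

lemma polys_diff:
  "f \<in> polys n \<Longrightarrow> g \<in> polys n \<Longrightarrow> f - g \<in> polys n"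
  using polys_add[of f n "- g"] polys_uminus[of g n] by simp

lemma polys_var: "k < n \<Longrightarrow> var k \<in> polys n"
  by (simp add: mem_mpoly_ring var_def)

lemma polys_of_int: "of_int c \<in> polys n"
  using polys_const[of "of_int c" n] by simp

lemma polys_power: "f \<in> polys n \<Longrightarrow> f ^ k \<in> polys n"
  by (induction k) (simp_all add: polys_one polys_mult)

lemma polys_sum:
  "(\<And>i. i \<in> A \<Longrightarrow> f i \<in> polys n) \<Longrightarrow> sum f A \<in> polys n"
  by (induction A rule: infinite_finite_induct) (simp_all add: polys_zero polys_add)

lemma polys_prod:
  "(\<And>i. i \<in> A \<Longrightarrow> f i \<in> polys n) \<Longrightarrow> prod f A \<in> polys n"
  by (induction A rule: infinite_finite_induct) (simp_all add: polys_one polys_mult)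

lemmas polys_closed = polys_add polys_uminus polys_mult polys_const
  polys_zero polys_one polys_diff polys_var polys_of_int polys_power

lemma polys_poly:
  "f \<in> polys n \<Longrightarrow> int_eval F f \<in> polys n"
  by (induction F) (simp_all add: map_poly_pCons polys_closed)

lemma polys_cring: "cring (mpoly_ring n)"
proof (rule cringI)
  show "abelian_group (mpoly_ring n :: 'a mpoly ring)"
    by (rule abelian_groupI)
      (auto simp: polys_simps polys_closed add_ac intro: bexI[OF _ polys_uminus])
  show "comm_monoid (mpoly_ring n :: 'a mpoly ring)"
    by (rule comm_monoidI) (simp_all add: polys_simps polys_closed mult_ac)
qed (simp_all add: polys_simps distrib_right)

lemmas polys_ring = cring.axioms(1)[OF polys_cring]

lemma polys_a_inv: "f \<in> polys n \<Longrightarrow> \<ominus>\<^bsub>mpoly_ring n\<^esub> f = - f"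
proof -
  interpret cring "mpoly_ring n" by (rule polys_cring)
  assume "f \<in> polys n"
  then show ?thesis by (intro minus_equality) (simp_all add: polys_simps polys_closed)
qed

lemma polys_minus:
  "f \<in> polys n \<Longrightarrow> g \<in> polys n \<Longrightarrow> f \<ominus>\<^bsub>mpoly_ring n\<^esub> g = f - g"
  by (simp add: a_minus_def polys_a_inv polys_simps)

text \<open>
  Used to see that a point is determined by its values at the variables, that it exists as soon as it
  does on the variables, and that denominators can be cleared.
\<close>

lemma polys_induct [consumes 1, case_names const var add mult]:
  assumes "f \<in> polys n"
    and const: "\<And>c. P (const c)" and var: "\<And>k. k < n \<Longrightarrow> P (var k)"
    and add: "\<And>f g. f \<in> polys n \<Longrightarrow> g \<in> polys n \<Longrightarrow> P f \<Longrightarrow> P g \<Longrightarrow> P (f + g)"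
    and mult: "\<And>f g. f \<in> polys n \<Longrightarrow> g \<in> polys n \<Longrightarrow> P f \<Longrightarrow> P g \<Longrightarrow> P (f * g)"
  shows "P f"
proof -
  define Q where "Q f \<longleftrightarrow> f \<in> polys n \<and> P f" for f
  have one: "Q 1" using const[of 1] by (simp add: Q_def polys_closed)
  have Qm: "Q (f * g)" if "Q f" "Q g" for f g using that mult by (simp add: Q_def polys_closed)
  have pw: "Q (single (single k e) 1)" if "k < n" for k e
  proof (induction e)
    case (Suc e)
    have "single (single k (Suc e)) (1::'a)
       = var k * single (single k e) 1"
      by (simp add: var_def mult_single flip: single_add)
    moreover have "Q (var k)" using var that by (simp add: Q_def polys_closed)
    ultimately show ?case using Qm[OF _ Suc.IH] by simp
  qed (use one in simp)
  have mon: "Q (single (\<Sum>k\<in>A. single k (e k)) 1)"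
    if "finite A" "A \<subseteq> {..<n}" for A and e :: "nat \<Rightarrow> nat"
    using that
  proof (induction A)
    case (insert k A)
    then have "Q (single (single k (e k)) 1 *
       single (\<Sum>k\<in>A. single k (e k)) 1)" by (intro Qm pw) auto
    then show ?case using insert by (simp add: mult_single)
  qed (use one in simp)
  have trm: "Q (single m c)" if "keys m \<subseteq> {..<n}" for m c
  proof -
    have "Q (const c * single m 1)"
      using mon[OF finite_keys that, of "lookup m"] const
      by (intro Qm) (simp_all add: sum_singles, simp add: Q_def polys_closed)
    then show ?thesis by (simp add: mult_single)
  qed
  have "Q (\<Sum>k\<in>A. single k (lookup f k))"
    if "finite A" "\<forall>m\<in>A. keys m \<subseteq> {..<n}" for A
    using that
  proof (induction A)
    case empty
    then show ?case using const[of 0] by (simp add: Q_def polys_closed)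
  next
    case (insert x F)
    then show ?case using trm[of x] by (auto simp: Q_def polys_closed intro!: add)
  qed
  from this[of "keys f"] show ?thesis
    using assms(1) by (simp add: sum_singles mem_mpoly_ring Q_def)
qed

lemma mpoly_ideal:
  assumes "ideal I (mpoly_ring n)"
  shows mpoly_ideal_carrier: "f \<in> I \<Longrightarrow> f \<in> polys n"
    and mpoly_ideal_zero: "0 \<in> I"
    and mpoly_ideal_add: "f \<in> I \<Longrightarrow> g \<in> I \<Longrightarrow> f + g \<in> I"
    and mpoly_ideal_uminus: "f \<in> I \<Longrightarrow> - f \<in> I"
    and mpoly_ideal_diff: "f \<in> I \<Longrightarrow> g \<in> I \<Longrightarrow> f - g \<in> I"
    and mpoly_ideal_mult: "f \<in> I \<Longrightarrow> g \<in> polys n \<Longrightarrow> g * f \<in> I"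
proof -
  interpret ideal I "mpoly_ring n" by fact
  show c: "f \<in> I \<Longrightarrow> f \<in> polys n" for f by (rule a_Hcarr)
  show "0 \<in> I" using additive_subgroup.zero_closed[OF is_additive_subgroup] by (simp add: polys_simps)
  show a: "f \<in> I \<Longrightarrow> g \<in> I \<Longrightarrow> f + g \<in> I" for f g using additive_subgroup.a_closed[OF is_additive_subgroup] by (simp add: polys_simps)
  show u: "f \<in> I \<Longrightarrow> - f \<in> I" for f 
    using I_l_closed[of f "- 1"] polys_uminus[OF polys_one, of n] by (simp add: polys_simps)
  show "f \<in> I \<Longrightarrow> g \<in> I \<Longrightarrow> f - g \<in> I" for f g using a[OF _ u, of f g] by simp
  show "f \<in> I \<Longrightarrow> g \<in> polys n \<Longrightarrow> g * f \<in> I" for f g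
    using I_l_closed[of f g] by (simp add: polys_simps)
qed

lemma mpoly_idealI:
  assumes "I \<subseteq> polys n" "0 \<in> I"
    and "\<And>f g. f \<in> I \<Longrightarrow> g \<in> I \<Longrightarrow> f + g \<in> I"
    and "\<And>f g. f \<in> I \<Longrightarrow> g \<in> polys n \<Longrightarrow> g * f \<in> I"
  shows "ideal I (mpoly_ring n)"
proof (rule idealI)
  interpret cring "mpoly_ring n" by (rule polys_cring)
  show "ring (mpoly_ring n :: 'a mpoly ring)" by (rule ring_axioms)
  have minus: "- f \<in> I" if "f \<in> I" for f
    using assms(4)[OF that polys_uminus[OF polys_one]] by simp
  show "subgroup I (add_monoid (mpoly_ring n))"
  proof (rule add.subgroupI)
    show "\<ominus>\<^bsub>mpoly_ring n\<^esub> f \<in> I" if "f \<in> I" for f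
      using that minus assms(1) by (simp add: polys_a_inv subset_iff)
  qed (use assms in \<open>auto simp: polys_simps\<close>)
qed (use assms(4) in \<open>auto simp: polys_simps mult.commute\<close>)

lemma lookup_single_mult:
  fixes g :: "('c::cancel_comm_monoid_add) \<Rightarrow>\<^sub>0 'b::comm_ring_1"
  shows "lookup (single m z * g) (m + l) = z * lookup g l"
    and "\<nexists>l. k = m + l \<Longrightarrow> lookup (single m z * g) k = 0"
proof -
  have "lookup (single m z * g) k =
      z * Sum_any (\<lambda>q. (lookup g q when k = m + q))" for k
    by (simp add: lookup_mult lookup_single when_mult)
  then show "lookup (single m z * g) (m + l) = z * lookup g l"
    and "\<nexists>l. k = m + l \<Longrightarrow> lookup (single m z * g) k = 0"
    by (simp_all)
qed

lemma lookup_const_mult: "lookup (const c * f) m = c * lookup f m"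
  using lookup_single_mult(1)[of 0 c f m] by simp

section \<open>Extension of scalars to the complex numbers\<close>

text \<open>
  A \<open>\<rat>\<close>-linear functional on \<open>\<complex>\<close>, applied to coefficients, carries a relation with complex coefficients
  to one with rational coefficients. This replaces tensor products and flatness.
\<close>

definition rat_linear :: "(complex \<Rightarrow> rat) \<Rightarrow> bool" where
  "rat_linear \<tau> \<longleftrightarrow> (\<forall>x y. \<tau> (x + y) = \<tau> x + \<tau> y) \<and> (\<forall>c x. \<tau> (of_rat c * x) = c * \<tau> x)"

lemma rat_linear_exists: "\<exists>\<tau>. rat_linear \<tau> \<and> \<tau> 1 = 1"
proof -
  interpret V: vector_space "\<lambda>(c::rat) (z::complex). of_rat c * z"
    by unfold_locales (simp_all add: algebra_simps of_rat_add of_rat_mult)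
  have ind: "V.independent {1}" by simp
  define B where "B = V.extend_basis {1::complex}"
  have B: "V.independent B" "V.span B = UNIV" "1 \<in> B"
    using V.independent_extend_basis[OF ind] V.span_extend_basis[OF ind]
      V.extend_basis_superset[OF ind] by (auto simp: B_def)
  have "rat_linear (\<lambda>z. V.representation B z 1)"
    unfolding rat_linear_def using B by (simp add: V.representation_add V.representation_scale)
  moreover have "V.representation B 1 1 = 1"
    using B by (simp add: V.representation_basis)
  ultimately show ?thesis by blast
qed

lemma rat_linear_scaled: "rat_linear \<tau> \<Longrightarrow> rat_linear (\<lambda>x. \<tau> (z * x))"
  by (simp add: rat_linear_def distrib_left mult.left_commute[of z])

lemma rat_linear_zero: "rat_linear \<tau> \<Longrightarrow> \<tau> 0 = 0"
  unfolding rat_linear_def by (metis add_cancel_left_left)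

lemma rat_linear_sum: "rat_linear \<tau> \<Longrightarrow> \<tau> (sum f A) = (\<Sum>x\<in>A. \<tau> (f x))"
  by (induction A rule: infinite_finite_induct) (simp_all add: rat_linear_zero, simp add: rat_linear_def)

lemma rat_linear_of_int: "rat_linear \<tau> \<Longrightarrow> \<tau> (x * of_int k) = \<tau> x * of_int k"
  unfolding rat_linear_def by (metis mult.commute of_rat_of_int_eq)

text \<open>
  The functional \<open>\<tau>\<close> maps the coefficients of \<open>g\<close> to those of an element of \<open>I\<close> divided by a nonzero integer.
  Elements of \<open>\<complex>[x]\<close> may involve all variables; monomials outside the first \<open>n\<close> variables are ignored.
\<close>

definition rational_shadow :: "nat \<Rightarrow> int mpoly set \<Rightarrow> (complex \<Rightarrow> rat) \<Rightarrow> complex mpoly \<Rightarrow> bool" where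
  "rational_shadow n I \<tau> g \<longleftrightarrow> (\<exists>N::int. N \<noteq> 0 \<and> (\<exists>f\<in>I. \<forall>m. keys m \<subseteq> {..<n} \<longrightarrow>
     of_int N * \<tau> (lookup g m) = of_int (lookup f m)))"

text \<open>
  An ideal of \<open>\<complex>[x]\<close> that contains \<open>I\<close> and from which relations descend to \<open>I\<close> up to an integer factor.
\<close>

definition complex_extension :: "nat \<Rightarrow> int mpoly set \<Rightarrow> complex mpoly set" where
  "complex_extension n I = {g. \<forall>\<tau>. rat_linear \<tau> \<longrightarrow> rational_shadow n I \<tau> g}"

text \<open>
  Ideals of a whole type, used for \<open>\<complex>[x]\<close> in infinitely many variables, where no carrier is needed.
\<close>

definition ring_ideal :: "'a::comm_ring_1 set \<Rightarrow> bool" where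
  "ring_ideal J \<longleftrightarrow> 0 \<in> J \<and> (\<forall>x\<in>J. \<forall>y\<in>J. x + y \<in> J) \<and> (\<forall>x\<in>J. \<forall>r. r * x \<in> J)"

lemma ring_idealD:
  assumes "ring_ideal J"
  shows "0 \<in> J" "x \<in> J \<Longrightarrow> y \<in> J \<Longrightarrow> x + y \<in> J" "x \<in> J \<Longrightarrow> r * x \<in> J"
    "x \<in> J \<Longrightarrow> - x \<in> J" "x \<in> J \<Longrightarrow> y \<in> J \<Longrightarrow> x - y \<in> J" "x \<in> J \<Longrightarrow> x * r \<in> J"
proof -
  show *: "0 \<in> J" "\<And>x y. x \<in> J \<Longrightarrow> y \<in> J \<Longrightarrow> x + y \<in> J" "\<And>x r. x \<in> J \<Longrightarrow> r * x \<in> J"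
    using assms by (auto simp: ring_ideal_def)
  show n: "x \<in> J \<Longrightarrow> - x \<in> J" for x using *(3)[of x "-1"] by simp
  show "x \<in> J \<Longrightarrow> y \<in> J \<Longrightarrow> x - y \<in> J" using *(2)[OF _ n, of x y] by simp
  show "x \<in> J \<Longrightarrow> x * r \<in> J" using *(3)[of x r] by (simp add: mult.commute)
qed

text \<open>
  Multiplication by \<open>z x\<^sup>m\<close> shifts the monomials and replaces the functional \<open>\<tau>\<close> by \<open>\<tau> \<circ> (z \<cdot>)\<close>, which is
  again \<open>\<rat>\<close>-linear. If \<open>x\<^sup>m\<close> involves a further variable, then no monomial that counts is left.
\<close>

lemma complex_extension_ideal:
  assumes "ideal I (ZX n)"
  shows "ring_ideal (complex_extension n I)"
  unfolding ring_ideal_def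
proof (intro conjI ballI allI)
  note I = mpoly_ideal[OF assms]
  show "0 \<in> complex_extension n I"
    unfolding complex_extension_def rational_shadow_def using I(2) by (auto intro!: exI[of _ 1] bexI[of _ 0] simp: rat_linear_zero)
  show add: "g + h \<in> complex_extension n I" if "g \<in> complex_extension n I" "h \<in> complex_extension n I" for g h
    unfolding complex_extension_def
  proof (intro CollectI allI impI)
    fix \<tau> assume l: "rat_linear \<tau>"
    obtain N f where 1: "N \<noteq> 0" "f \<in> I" "\<And>m. keys m \<subseteq> {..<n} \<Longrightarrow>
        of_int N * \<tau> (lookup g m) = of_int (lookup f m)"
      using \<open>g \<in> complex_extension n I\<close> l unfolding complex_extension_def rational_shadow_def by blast
    obtain M e where 2: "M \<noteq> 0" "e \<in> I" "\<And>m. keys m \<subseteq> {..<n} \<Longrightarrow>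
        of_int M * \<tau> (lookup h m) = of_int (lookup e m)"
      using \<open>h \<in> complex_extension n I\<close> l unfolding complex_extension_def rational_shadow_def by blast
    have "of_int (N * M) * \<tau> (lookup (g + h) m)
      = of_int (lookup (const M * f + const N * e) m)"
      if m: "keys m \<subseteq> {..<n}" for m
    proof -
      have "of_int (N * M) * \<tau> (lookup (g + h) m) =
        of_int M * (of_int N * \<tau> (lookup g m)) + of_int N * (of_int M * \<tau> (lookup h m))"
        using l by (simp add: lookup_add rat_linear_def algebra_simps)
      then show ?thesis using 1(3)[OF m] 2(3)[OF m] by (simp add: lookup_add lookup_const_mult)
    qed
    then show "rational_shadow n I \<tau> (g + h)"
      unfolding rational_shadow_def
      using 1 2 by (intro exI[of _ "N * M"] conjI bexI[of _ "const M * f + const N * e"])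
        (auto intro!: I polys_const)
  qed
  show "r * g \<in> complex_extension n I" if g: "g \<in> complex_extension n I" for g r
  proof (induction r rule: mpoly_induct)
    case (single m z)
    show ?case unfolding complex_extension_def
    proof (intro CollectI allI impI)
      fix \<tau> assume l: "rat_linear \<tau>"
      obtain N f where 1: "N \<noteq> 0" "f \<in> I" "\<And>m. keys m \<subseteq> {..<n} \<Longrightarrow>
          of_int N * \<tau> (z * lookup g m) = of_int (lookup f m)"
        using g rat_linear_scaled[OF l, of z] unfolding complex_extension_def rational_shadow_def by blast
      show "rational_shadow n I \<tau> (single m z * g)"
      proof (cases "keys m \<subseteq> {..<n}")
        case True
        have "single m 1 * f \<in> I"
          by (rule I(6)[OF 1(2)]) (use True in \<open>simp add: mem_mpoly_ring\<close>)
        moreover have "of_int N * \<tau> (lookup (single m z * g) k) =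
           of_int (lookup (single m 1 * f) k)" if k: "keys k \<subseteq> {..<n}" for k
        proof (cases "\<exists>l. k = m + l")
          case True
          then obtain q where q: "k = m + q" by auto
          have "keys q \<subseteq> keys k" by (auto simp: q in_keys_iff lookup_add)
          then have "keys q \<subseteq> {..<n}" using k by auto
          then show ?thesis using 1(3) by (simp add: q lookup_single_mult(1))
        next
          case False
          then show ?thesis by (simp add: lookup_single_mult(2) rat_linear_zero[OF l])
        qed
        ultimately show ?thesis unfolding rational_shadow_def using 1(1) by blast
      next
        case False
        have "\<nexists>l. k = m + l" if "keys k \<subseteq> {..<n}" for k
          using False that by (auto simp: in_keys_iff lookup_add subset_iff)
        then have "lookup (single m z * g) k = 0"
          if "keys k \<subseteq> {..<n}" for k using that lookup_single_mult(2) by blast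
        then show ?thesis unfolding rational_shadow_def using I(2)
          by (intro exI[of _ 1] conjI bexI[of _ 0]) (auto simp: rat_linear_zero[OF l])
      qed
    qed
  qed (simp add: distrib_right add)
qed

lemma complex_mpoly_in_extension:
  assumes "ideal I (ZX n)" "f \<in> I"
  shows "complex_mpoly f \<in> complex_extension n I"
  unfolding complex_extension_def
proof (intro CollectI allI impI)
  fix \<tau> assume l: "rat_linear \<tau>"
  obtain u v where uv: "quotient_of (\<tau> 1) = (u, v)" by fastforce
  then have v: "v > 0" "\<tau> 1 = of_int u / of_int v" using quotient_of_denom_pos quotient_of_div by auto
  have "of_int v * \<tau> (lookup (complex_mpoly f) m) = of_int (lookup (const u * f) m)" for m
    using rat_linear_of_int[OF l, of 1 "lookup f m"] v
    by (simp add: lookup_complex_mpoly lookup_const_mult)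
  then show "rational_shadow n I \<tau> (complex_mpoly f)"
    unfolding rational_shadow_def using v assms mpoly_ideal(6)[OF assms polys_const[of u]]
    by (intro exI[of _ v] conjI bexI[of _ "const u * f"]) auto
qed

lemma common_denominator:
  fixes g :: "'i \<Rightarrow> rat"
  assumes "finite A"
  shows "\<exists>(D::int) r. D > 0 \<and> (\<forall>i\<in>A. of_int D * g i = of_int (r i))"
  using assms
proof (induction A)
  case empty
  show ?case by (intro exI[of _ 1]) auto
next
  case (insert a A)
  then obtain D r where D: "D > 0" "\<forall>i\<in>A. of_int D * g i = of_int (r i)" by auto
  obtain u v where uv: "quotient_of (g a) = (u, v)" by fastforce
  then have v: "v > 0" "g a = of_int u / of_int v" using quotient_of_denom_pos quotient_of_div by auto
  have "of_int (v * D) * g i = of_int (v * r i)" if "i \<in> A" for i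
    using D(2) that by (simp add: mult.assoc)
  moreover have "of_int (v * D) * g a = of_int (D * u)" using v by simp
  ultimately show ?case using D v insert
    by (intro exI[of _ "v * D"] exI[of _ "\<lambda>i. if i = a then D * u else v * r i"]) auto
qed

lemma poly_sum_upto:
  fixes p :: "'a::comm_ring_1 poly"
  assumes "degree p \<le> d"
  shows "poly p x = (\<Sum>i\<le>d. coeff p i * x ^ i)"
  unfolding poly_altdef using assms
  by (intro sum.mono_neutral_left) (auto simp: coeff_eq_0)

lemma complex_extension_descends:
  assumes I: "ideal I (ZX n)" and u: "u \<in> polys n" and g: "g \<in> complex_extension n I"
    and \<tau>: "rat_linear \<tau>" and eq: "\<And>m. of_int D * \<tau> (lookup g m) = of_int (lookup u m)"
  shows "\<exists>N::int. N \<noteq> 0 \<and> of_int N * u \<in> I"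
proof -
  obtain N f where N: "N \<noteq> 0" "f \<in> I"
    "\<And>m. keys m \<subseteq> {..<n} \<Longrightarrow> of_int N * \<tau> (lookup g m) = of_int (lookup f m)"
    using g \<tau> unfolding complex_extension_def rational_shadow_def by blast
  have Df: "const D * f \<in> I" by (rule mpoly_ideal_mult[OF I N(2) polys_const])
  have "const N * u = const D * f"
  proof (rule poly_mapping_eqI)
    fix m
    show "lookup (const N * u) m = lookup (const D * f) m"
    proof (cases "keys m \<subseteq> {..<n}")
      case True
      have "of_int (N * lookup u m) = of_int D * (of_int N * \<tau> (lookup g m))"
        unfolding of_int_mult eq[symmetric] by simp
      also have "\<dots> = of_int (D * lookup f m)" by (simp add: N(3)[OF True])
      finally show ?thesis unfolding of_int_eq_iff lookup_const_mult .
    next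
      case False
      have "const N * u \<in> polys n" "const D * f \<in> polys n"
        using u mpoly_ideal_carrier[OF I Df] by (auto intro: polys_closed)
      then show ?thesis using False by (metis in_keys_iff mem_mpoly_ring)
    qed
  qed
  then show ?thesis using N(1) Df by (intro exI[of _ N]) (simp flip: single_of_int)
qed

text \<open>
  Apply a functional with value \<open>1\<close> at the leading coefficient: the polynomial keeps its degree but
  becomes rational. Clearing denominators makes it integral.
\<close>

lemma complex_relation_descends:
  fixes h :: "complex poly"
  assumes I: "ideal I (ZX n)" and f: "f \<in> polys n"
    and h: "h \<noteq> 0" "poly (map_poly const h) (complex_mpoly f) \<in> complex_extension n I"
  shows "\<exists>r::int poly. r \<noteq> 0 \<and> degree r \<le> degree h \<and> int_eval r f \<in> I"
proof -
  define d where "d = degree h"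
  obtain \<sigma> where \<sigma>: "rat_linear \<sigma>" "\<sigma> 1 = 1" using rat_linear_exists by blast
  define \<tau> where "\<tau> x = \<sigma> (inverse (lead_coeff h) * x)" for x
  have l: "rat_linear \<tau>" "\<tau> (lead_coeff h) = 1"
    using rat_linear_scaled[OF \<sigma>(1)] \<sigma>(2) h(1) by (simp_all add: \<tau>_def[abs_def])
  obtain D and s :: "nat \<Rightarrow> int" where D: "D > 0" "\<And>i. i \<le> d \<Longrightarrow> of_int D * \<tau> (coeff h i) = of_int (s i)"
    using common_denominator[of "{..d}" "\<lambda>i. \<tau> (coeff h i)"] by auto
  define r where "r = (\<Sum>i\<le>d. monom (s i) i)"
  have cr: "coeff r i = (if i \<le> d then s i else 0)" for i
    by (simp add: r_def coeff_sum)
  have dm: "degree (map_poly const h) \<le> d" unfolding d_def by (rule map_poly_degree_leq)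
  have ph: "poly (map_poly const h) (complex_mpoly f) = (\<Sum>i\<le>d. const (coeff h i) * complex_mpoly (f ^ i))"
    using poly_sum_upto[OF dm, of "complex_mpoly f"] by (simp add: coeff_map_poly complex_mpoly.power)
  have dr: "degree (map_poly of_int r :: int mpoly poly) \<le> d"
    by (rule degree_le) (simp add: coeff_map_poly cr)
  have pr: "int_eval r f = (\<Sum>i\<le>d. const (s i) * f ^ i)"
    using poly_sum_upto[OF dr, of f] by (simp add: coeff_map_poly cr flip: single_of_int)
  have "of_int D * \<tau> (lookup (poly (map_poly const h) (complex_mpoly f)) m) =
     of_int (lookup (int_eval r f) m)" for m
  proof -
    have "of_int D * \<tau> (lookup (poly (map_poly const h) (complex_mpoly f)) m) =
       (\<Sum>i\<le>d. (of_int D * \<tau> (coeff h i)) * of_int (lookup (f ^ i) m))"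
      by (simp add: ph lookup_sum lookup_const_mult lookup_complex_mpoly rat_linear_sum[OF l(1)]
          rat_linear_of_int[OF l(1)] sum_distrib_left mult.assoc)
    also have "\<dots> = (\<Sum>i\<le>d. of_int (s i * lookup (f ^ i) m))"
      by (intro sum.cong) (simp_all add: D)
    finally show ?thesis by (simp add: pr lookup_sum lookup_const_mult)
  qed
  from complex_extension_descends[OF I polys_poly[OF f] h(2) l(1) this]
  obtain N :: int where N: "N \<noteq> 0" "of_int N * int_eval r f \<in> I" by blast
  have "int_eval (Polynomial.smult N r) f \<in> I"
    using N(2) by (simp add: map_poly_smult)
  moreover have "coeff r d \<noteq> 0" using D(1) D(2)[of d] l(2) by (auto simp: cr d_def)
  then have "Polynomial.smult N r \<noteq> 0" using N(1) by auto
  moreover have "degree (Polynomial.smult N r) \<le> d" by (rule degree_le) (simp add: cr)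
  ultimately show ?thesis unfolding d_def by metis
qed

section \<open>Complex points\<close>

definition adjoin :: "'a::comm_ring_1 set \<Rightarrow> 'a \<Rightarrow> 'a set" where
  "adjoin J y = {x. \<exists>r. x - r * y \<in> J}"

lemma adjoin_ideal:
  assumes "ring_ideal J"
  shows "ring_ideal (adjoin J y)" "J \<subseteq> adjoin J y" "y \<in> adjoin J y"
proof -
  note J = ring_idealD[OF assms]
  show "ring_ideal (adjoin J y)"
    unfolding ring_ideal_def
  proof (intro conjI ballI allI)
    show "0 \<in> adjoin J y" unfolding adjoin_def using J(1) by (auto intro: exI[of _ 0])
    show "a + b \<in> adjoin J y" if "a \<in> adjoin J y" "b \<in> adjoin J y" for a b
    proof -
      from that obtain r s where "a - r * y \<in> J" "b - s * y \<in> J" by (auto simp: adjoin_def)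
      from J(2)[OF this] show ?thesis unfolding adjoin_def
        by (intro CollectI exI[of _ "r + s"]) (simp add: algebra_simps)
    qed
    show "c * a \<in> adjoin J y" if "a \<in> adjoin J y" for a c
    proof -
      from that obtain r where "a - r * y \<in> J" by (auto simp: adjoin_def)
      from J(3)[OF this, of c] show ?thesis unfolding adjoin_def
        by (intro CollectI exI[of _ "c * r"]) (simp add: algebra_simps)
    qed
  qed
  show "J \<subseteq> adjoin J y" unfolding adjoin_def by (auto intro: exI[of _ 0])
  show "y \<in> adjoin J y" unfolding adjoin_def using J(1) by (auto intro: exI[of _ 1])
qed

text \<open>
  Otherwise each \<open>J + (y\<^sub>i)\<close> contains some \<open>s\<^sub>i \<in> S\<close>, and the product of the \<open>s\<^sub>i\<close> lies in \<open>J + (\<Prod>y\<^sub>i) = J\<close>.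
\<close>

lemma adjoin_factor_disjoint:
  assumes J: "ring_ideal J" and S: "1 \<in> S" "\<And>s t. s \<in> S \<Longrightarrow> t \<in> S \<Longrightarrow> s * t \<in> S" "J \<inter> S = {}"
    and "prod_list ys \<in> J"
  shows "\<exists>y\<in>set ys. adjoin J y \<inter> S = {}"
proof (rule ccontr)
  note J' = ring_idealD[OF J]
  assume "\<not> ?thesis"
  then have "\<exists>s\<in>S. s \<in> adjoin J (prod_list ys)"
  proof (induction ys)
    case Nil
    then show ?case using S(1) J'(1) by (auto intro!: bexI[of _ 1] exI[of _ 1] simp: adjoin_def)
  next
    case (Cons y ys)
    then obtain s t a b where st: "s \<in> S" "t \<in> S" "s - a * y \<in> J" "t - b * prod_list ys \<in> J"
      by (auto simp: adjoin_def disjoint_iff)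
    have "s * t - (a * b) * prod_list (y # ys) =
      t * (s - a * y) + (a * y) * (t - b * prod_list ys)" by (simp add: algebra_simps)
    also have "\<dots> \<in> J" by (intro J'(2,3) st)
    finally show ?case using S(2)[OF st(1,2)] by (auto simp: adjoin_def)
  qed
  then obtain s r where "s \<in> S" "s - r * prod_list ys \<in> J" by (auto simp: adjoin_def)
  then have "s \<in> J" using J'(2)[OF _ J'(3)[OF assms(5), of r], of "s - r * prod_list ys"] by simp
  then show False using S(3) \<open>s \<in> S\<close> by auto
qed

text \<open>
  Points have the value \<open>0\<close> outside the polynomial ring, so that two points with the same values at
  the variables are equal.
\<close>

definition points :: "nat \<Rightarrow> int mpoly set \<Rightarrow> (int mpoly \<Rightarrow> complex) set" where
  "points n I = {\<chi>.
     (\<forall>f\<in>polys n. \<forall>g\<in>polys n. \<chi> (f + g) = \<chi> f + \<chi> g \<and> \<chi> (f * g) = \<chi> f * \<chi> g) \<and>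
     \<chi> 1 = 1 \<and> (\<forall>f. f \<notin> polys n \<longrightarrow> \<chi> f = 0) \<and> (\<forall>f\<in>I. \<chi> f = 0)}"

definition integral_mod :: "int mpoly set \<Rightarrow> int mpoly \<Rightarrow> bool" where
  "integral_mod I f \<longleftrightarrow> (\<exists>F::int poly. lead_coeff F = 1 \<and> int_eval F f \<in> I)"

lemma split_complex_poly:
  fixes p :: "complex poly"
  assumes "p \<noteq> 0"
  shows "\<exists>xs. p = smult (lead_coeff p) (\<Prod>x\<leftarrow>xs. [:- x, 1:])"
proof -
  obtain A where "p = smult (lead_coeff p) (\<Prod>x\<in>#A. [:-x, 1:])"
    using alg_closed_imp_factorization[OF assms] by auto
  moreover obtain xs where "mset xs = A" using ex_mset by blast
  ultimately show ?thesis by (intro exI[of _ xs]) (auto simp: mset_map[symmetric] prod_mset_prod_list simp del: mset_map)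
qed

lemma poly_complex_mpoly:
  "complex_mpoly (int_eval F f) = poly (map_poly const (map_poly of_int F)) (complex_mpoly f)"
proof -
  have "map_poly complex_mpoly (map_poly of_int F) = map_poly const (map_poly of_int F)"
    by (intro poly_eqI) (simp add: coeff_map_poly complex_mpoly.zero complex_mpoly.of_int)
  then show ?thesis by (simp flip: complex_mpoly.poly_map)
qed

lemma poly_const_linear_factors:
  "poly (map_poly const (\<Prod>x\<leftarrow>xs. [:- x, 1:])) g = (\<Prod>x\<leftarrow>xs. g - const x)"
  by (induction xs)
    (simp_all add: const.map_poly_mult const.map_poly_linear const.one del: mult_pCons_left)

lemma integral_mod_factors:
  assumes "integral_mod I f" "complex_mpoly ` I \<subseteq> J"
  shows "\<exists>xs. (\<Prod>x\<leftarrow>xs. complex_mpoly f - const x) \<in> J"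
proof -
  obtain F :: "int poly" where F: "lead_coeff F = 1" "int_eval F f \<in> I"
    using assms by (auto simp: integral_mod_def)
  let ?F = "map_poly of_int F :: complex poly"
  have "lead_coeff ?F = 1" using F(1) by (simp add: map_poly_degree_eq coeff_map_poly)
  moreover from this have "?F \<noteq> 0" by auto
  ultimately obtain xs where "?F = (\<Prod>x\<leftarrow>xs. [:- x, 1:])" using split_complex_poly[of ?F] by auto
  then have "(\<Prod>x\<leftarrow>xs. complex_mpoly f - const x) = complex_mpoly (int_eval F f)"
    by (simp add: poly_complex_mpoly flip: poly_const_linear_factors)
  then show ?thesis using F assms by auto
qed

text \<open>
  Modulo \<open>J\<close> each variable, and hence each polynomial, is congruent to a constant, which is unique since
  \<open>J\<close> is proper.
\<close>

lemma point_of_congruences: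
  assumes J: "ring_ideal J" "1 \<notin> J" "complex_mpoly ` I \<subseteq> J" "I \<subseteq> polys n"
    and var: "\<And>k. k < n \<Longrightarrow> \<exists>\<alpha>. var k - const \<alpha> \<in> J"
  shows "\<exists>\<chi>\<in>points n I. \<forall>f\<in>polys n. complex_mpoly f - const (\<chi> f) \<in> J"
proof -
  note J' = ring_idealD[OF J(1)]
  have ex: "\<exists>z. complex_mpoly f - const z \<in> J" if "f \<in> polys n" for f
    using that
  proof (induction rule: polys_induct)
    case (const c)
    then show ?case using J'(1) by (intro exI[of _ "of_int c"]) (simp add: complex_mpoly_const)
  next
    case (var k)
    then show ?case using assms(5) by (simp add: complex_mpoly_var)
  next
    case (add f g)
    then obtain y z where "complex_mpoly f - const y \<in> J" "complex_mpoly g - const z \<in> J" by auto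
    from J'(2)[OF this] show ?case
      by (intro exI[of _ "y + z"]) (simp add: complex_mpoly.add single_add algebra_simps)
  next
    case (mult f g)
    then obtain y z where "complex_mpoly f - const y \<in> J" "complex_mpoly g - const z \<in> J" by auto
    then have "complex_mpoly g * (complex_mpoly f - const y) + const y * (complex_mpoly g - const z) \<in> J"
      by (intro J'(2)[OF J'(3) J'(3)])
    then show ?case
      by (intro exI[of _ "y * z"]) (simp add: complex_mpoly.mult const.mult algebra_simps)
  qed
  have const0: "z = 0" if "const z \<in> J" for z
  proof (rule ccontr)
    assume "z \<noteq> 0"
    then have "const (inverse z) * const z = 1" by (simp add: mult_single)
    then show False using J'(3)[OF that, of "const (inverse z)"] J(2) by simp
  qed
  define \<chi> where "\<chi> f = (if f \<in> polys n then (SOME z. complex_mpoly f - const z \<in> J) else 0)" for f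
  have \<chi>: "complex_mpoly f - const (\<chi> f) \<in> J" if "f \<in> polys n" for f
    unfolding \<chi>_def using someI_ex[OF ex[OF that]] that by simp
  have uniq: "\<chi> f = z" if "f \<in> polys n" "complex_mpoly f - const z \<in> J" for f z
    using const0[of "\<chi> f - z"] J'(5)[OF that(2) \<chi>[OF that(1)]] by (simp add: single_diff)
  have "\<chi> \<in> points n I"
    unfolding points_def
  proof (intro CollectI conjI ballI allI impI)
    fix f g :: "int mpoly" assume fg: "f \<in> polys n" "g \<in> polys n"
    show "\<chi> (f + g) = \<chi> f + \<chi> g"
      by (rule uniq) (use fg J'(2)[OF \<chi> \<chi>, of f g] in
        \<open>simp_all add: polys_closed complex_mpoly.add single_add algebra_simps\<close>)
    have "complex_mpoly g * (complex_mpoly f - const (\<chi> f)) + const (\<chi> f) * (complex_mpoly g - const (\<chi> g)) \<in> J"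
      by (intro J'(2)[OF J'(3) J'(3)] \<chi> fg)
    then show "\<chi> (f * g) = \<chi> f * \<chi> g"
      by (intro uniq) (use fg in \<open>simp_all add: polys_closed complex_mpoly.mult const.mult algebra_simps\<close>)
  next
    show "\<chi> 1 = 1" by (rule uniq) (simp_all add: polys_closed complex_mpoly.one J')
    show "\<chi> f = 0" if "f \<notin> polys n" for f using that by (simp add: \<chi>_def)
    show "\<chi> f = 0" if "f \<in> I" for f by (rule uniq) (use J(3,4) that in auto)
  qed
  then show ?thesis using \<chi> by blast
qed

text \<open>
  A form of the Nullstellensatz: adjoin to \<open>J\<close> a factor \<open>x\<^sub>k - \<alpha>\<close> for each variable while avoiding \<open>S\<close>.
  The final ideal is part of the conclusion because it also determines the value of the point at every
  \<open>f\<close> for which some \<open>f - \<alpha>\<close> lies in \<open>J\<close>.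
\<close>

lemma complex_point_exists:
  assumes I: "I \<subseteq> polys n" "\<And>k. k < n \<Longrightarrow> integral_mod I (var k)"
    and J: "ring_ideal J" "complex_mpoly ` I \<subseteq> J"
    and S: "1 \<in> S" "\<And>s t. s \<in> S \<Longrightarrow> t \<in> S \<Longrightarrow> s * t \<in> S" "J \<inter> S = {}"
  shows "\<exists>J' \<chi>. ring_ideal J' \<and> J \<subseteq> J' \<and> J' \<inter> S = {} \<and> \<chi> \<in> points n I \<and>
     (\<forall>f\<in>polys n. complex_mpoly f - const (\<chi> f) \<in> J')"
proof -
  have "\<exists>J'. ring_ideal J' \<and> J \<subseteq> J' \<and> J' \<inter> S = {} \<and> (\<forall>k<m. \<exists>\<alpha>. var k - const \<alpha> \<in> J')" if "m \<le> n" for m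
    using that
  proof (induction m)
    case 0
    then show ?case using J S(3) by (intro exI[of _ J]) auto
  next
    case (Suc m)
    then obtain J' where J': "ring_ideal J'" "J \<subseteq> J'" "J' \<inter> S = {}" "\<forall>k<m. \<exists>\<alpha>. var k - const \<alpha> \<in> J'" by auto
    obtain xs where "(\<Prod>x\<leftarrow>xs. var m - const x) \<in> J'"
      using integral_mod_factors[OF I(2) subset_trans[OF J(2) J'(2)], of m] Suc.prems
      by (auto simp: complex_mpoly_var)
    from adjoin_factor_disjoint[OF J'(1) S(1,2) J'(3) this]
    obtain x where x: "adjoin J' (var m - const x) \<inter> S = {}" by auto
    have "\<exists>\<alpha>. var k - const \<alpha> \<in> adjoin J' (var m - const x)" if "k < Suc m" for k
      using that J'(4) adjoin_ideal(2,3)[OF J'(1), of "var m - const x"] by (metis less_Suc_eq subsetD)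
    then show ?case
      using adjoin_ideal[OF J'(1), of "var m - const x"] x J'(2)
      by (intro exI[of _ "adjoin J' (var m - const x)"]) (auto simp: less_Suc_eq)
  qed
  from this[OF order_refl] obtain J' where J': "ring_ideal J'" "J \<subseteq> J'" "J' \<inter> S = {}"
    "\<And>k. k < n \<Longrightarrow> \<exists>\<alpha>. var k - const \<alpha> \<in> J'" by auto
  have "1 \<notin> J'" using J'(3) S(1) by auto
  from point_of_congruences[OF J'(1) this _ I(1) J'(4)] J' J(2) show ?thesis by blast
qed

section \<open>Residue classes and integrality\<close>

abbreviation coset :: "nat \<Rightarrow> 'a::comm_ring_1 mpoly set \<Rightarrow> 'a mpoly \<Rightarrow> 'a mpoly set" where
  "coset n I f \<equiv> I +>\<^bsub>mpoly_ring n\<^esub> f"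

lemma coset_eq_iff:
  assumes "ideal I (mpoly_ring n)" "f \<in> polys n" "g \<in> polys n"
  shows "coset n I f = coset n I g \<longleftrightarrow> f - g \<in> I"
  using ring.quotient_eq_iff_same_a_r_cos[OF polys_ring assms]
    polys_minus[OF assms(2,3)] by simp

lemma coset_simps:
  assumes "ideal I (mpoly_ring n)" "f \<in> polys n" "g \<in> polys n"
  shows coset_add: "(coset n I f) \<oplus>\<^bsub>mpoly_ring n Quot I\<^esub> (coset n I g) = coset n I (f + g)"
    and coset_mult: "(coset n I f) \<otimes>\<^bsub>mpoly_ring n Quot I\<^esub> (coset n I g) = coset n I (f * g)"
    and coset_carrier: "coset n I f \<in> carrier (mpoly_ring n Quot I)"
  using ring_hom_add[OF ideal.rcos_ring_hom[OF assms(1)] assms(2,3)]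
    ring_hom_mult[OF ideal.rcos_ring_hom[OF assms(1)] assms(2,3)]
    ring_hom_closed[OF ideal.rcos_ring_hom[OF assms(1)] assms(2)]
  by (simp_all add: polys_simps)

lemma coset_one: "\<one>\<^bsub>mpoly_ring n Quot I\<^esub> = coset n I 1"
  by (simp add: FactRing_def polys_simps)

lemma coset_zero:
  assumes "ideal I (mpoly_ring n)"
  shows "\<zero>\<^bsub>mpoly_ring n Quot I\<^esub> = coset n I 0"
  using ring_hom_zero[OF ideal.rcos_ring_hom[OF assms] polys_ring
    ideal.quotient_is_ring[OF assms]] by (simp add: polys_simps)

lemma quotient_cring: "ideal I (mpoly_ring n) \<Longrightarrow> cring (mpoly_ring n Quot I)"
  by (rule ideal.quotient_is_cring[OF _ polys_cring])

lemma coset_cases: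
  assumes "C \<in> carrier (mpoly_ring n Quot I)"
  shows "\<exists>f\<in>polys n. C = coset n I f"
  using assms by (auto simp: FactRing_def A_RCOSETS_def')

text \<open>
  The subgroup \<open>\<int>[f]\<close> of the finitely generated group \<open>P/I\<close> is finitely generated, hence spanned by the
  powers of \<open>f\<close> below some exponent \<open>K\<close>; expressing \<open>f\<^sup>K\<close> by them is the monic equation.
\<close>

lemma finite_int_algebra_integral:
  assumes I: "ideal I (ZX n)" and fin: "finite_int_algebra (ZX n Quot I)" and f: "f \<in> polys n"
  shows "integral_mod I f"
proof -
  define R where "R = ZX n Quot I"
  interpret R: cring R unfolding R_def by (rule quotient_cring[OF I])
  define c where "c g = coset n I g" for g
  define E where "E F = int_eval F f" for F :: "int poly"
  have E: "E F \<in> polys n" for F unfolding E_def by (rule polys_poly[OF f])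
  have cE: "c (E F) \<oplus>\<^bsub>R\<^esub> c (E G) = c (E (F + G))" for F G
    using coset_add[OF I E E, of F G] by (simp add: R_def c_def E_def of_int.map_poly_add)
  have ccar: "c (E F) \<in> carrier R" for F
    using coset_carrier[OF I E E] by (simp add: R_def c_def)
  have c0: "c (E 0) = \<zero>\<^bsub>R\<^esub>" by (simp add: R_def c_def E_def coset_zero[OF I])
  have sub: "subgroup {c (E F) | F. Q F} (add_monoid R)"
    if Q: "Q 0" "\<And>F G. Q F \<Longrightarrow> Q G \<Longrightarrow> Q (F + G)" "\<And>F. Q F \<Longrightarrow> Q (- F)" for Q
  proof (rule R.add.subgroupI)
    show "{c (E F) | F. Q F} \<subseteq> carrier R" using ccar by auto
    show "{c (E F) | F. Q F} \<noteq> {}" using Q(1) by auto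
    fix a assume "a \<in> {c (E F) | F. Q F}"
    then obtain F where F: "a = c (E F)" "Q F" by auto
    have "c (E (- F)) \<oplus>\<^bsub>R\<^esub> a = \<zero>\<^bsub>R\<^esub>" using cE[of "- F" F] F c0 by simp
    then have "\<ominus>\<^bsub>R\<^esub> a = c (E (- F))"
      using R.minus_equality[of "c (E (- F))" a] ccar F by simp
    then show "\<ominus>\<^bsub>R\<^esub> a \<in> {c (E F) | F. Q F}" using Q(3) F by auto
  next
    fix a b assume "a \<in> {c (E F) | F. Q F}" "b \<in> {c (E F) | F. Q F}"
    then show "a \<oplus>\<^bsub>R\<^esub> b \<in> {c (E F) | F. Q F}" using cE Q(2) by fastforce
  qed
  obtain S where S: "finite S" "S \<subseteq> carrier R" "generate (add_monoid R) S = carrier R"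
    using fin by (auto simp: finite_int_algebra_def R_def)
  define H where "H = {c (E F) | F. True}"
  have "fin_gen (add_monoid R) H"
    by (rule comm_group.subgroup_fin_gen[OF R.a_comm_group S(1)]) (use S ccar sub[of "\<lambda>_. True"] in \<open>auto simp: H_def\<close>)
  then obtain T where T: "finite T" "T \<subseteq> H" "generate (add_monoid R) T = H" by (auto simp: fin_gen_def)
  define deg where "deg t = (LEAST d. \<exists>F. t = c (E F) \<and> degree F = d)" for t
  have deg: "\<exists>F. t = c (E F) \<and> degree F = deg t" if "t \<in> T" for t
  proof -
    have "\<exists>d F. t = c (E F) \<and> degree F = d" using T(2) that by (auto simp: H_def)
    from LeastI_ex[OF this] show ?thesis unfolding deg_def .
  qed
  \<comment> \<open>larger than all degrees needed to write the generators of \<open>\<int>[f]\<close>\<close>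
  define K where "K = Suc (sum deg T)"
  have "T \<subseteq> {c (E F) | F. degree F < K}"
  proof
    fix t assume t: "t \<in> T"
    have "deg t \<le> sum deg T" using T(1) t by (intro member_le_sum) auto
    then show "t \<in> {c (E F) | F. degree F < K}" using deg[OF t] by (auto simp: K_def)
  qed
  moreover have "subgroup {c (E F) | F. degree F < K} (add_monoid R)"
    by (rule sub) (auto simp: K_def degree_add_less)
  ultimately have "H \<subseteq> {c (E F) | F. degree F < K}"
    using R.add.generate_subgroup_incl T(3) by blast
  moreover have "c (E (monom 1 K)) \<in> H" by (auto simp: H_def)
  ultimately obtain F where F: "c (E (monom 1 K)) = c (E F)" "degree F < K" by auto
  then have "E (monom 1 K) - E F \<in> I" using coset_eq_iff[OF I E E] by (simp add: c_def)
  moreover have "E (monom 1 K) = E (monom 1 K - F) + E F"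
    unfolding E_def poly_add[symmetric] of_int.map_poly_add[symmetric] by simp
  ultimately have "E (monom 1 K - F) \<in> I" by simp
  moreover have "degree (monom 1 K - F) = K"
    using F(2) degree_add_eq_left[of "- F" "monom 1 K"] by (simp add: degree_monom_eq)
  moreover have "coeff (monom 1 K - F) K = 1" using F(2) by (simp add: coeff_eq_0)
  ultimately show ?thesis unfolding integral_mod_def E_def by (intro exI[of _ "monom 1 K - F"]) simp
qed

section \<open>Points of an integral ideal\<close>

definition integral_ideal :: "nat \<Rightarrow> int mpoly set \<Rightarrow> bool" where
  "integral_ideal n I \<longleftrightarrow> ideal I (ZX n) \<and> (\<forall>f\<in>polys n. integral_mod I f)"

lemma integral_ideal_superset:
  "integral_ideal n I \<Longrightarrow> I \<subseteq> J \<Longrightarrow> ideal J (ZX n) \<Longrightarrow> integral_ideal n J"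
  unfolding integral_ideal_def integral_mod_def by blast

lemma complex_pointD:
  assumes "\<chi> \<in> points n I"
  shows "f \<in> polys n \<Longrightarrow> g \<in> polys n \<Longrightarrow> \<chi> (f + g) = \<chi> f + \<chi> g"
    and "f \<in> polys n \<Longrightarrow> g \<in> polys n \<Longrightarrow> \<chi> (f * g) = \<chi> f * \<chi> g"
    and "\<chi> 1 = 1" and "\<chi> 0 = 0" and "f \<in> I \<Longrightarrow> \<chi> f = 0" and "f \<notin> polys n \<Longrightarrow> \<chi> f = 0"
    and "f \<in> polys n \<Longrightarrow> \<chi> (- f) = - \<chi> f"
    and "f \<in> polys n \<Longrightarrow> g \<in> polys n \<Longrightarrow> \<chi> (f - g) = \<chi> f - \<chi> g"
    and "\<chi> (of_int k) = of_int k"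
    and "f \<in> polys n \<Longrightarrow> \<chi> (f ^ e) = \<chi> f ^ e"
    and "f \<in> polys n \<Longrightarrow> \<chi> (int_eval F f) = int_eval F (\<chi> f)"
proof -
  show a: "f \<in> polys n \<Longrightarrow> g \<in> polys n \<Longrightarrow> \<chi> (f + g) = \<chi> f + \<chi> g"
    and m: "f \<in> polys n \<Longrightarrow> g \<in> polys n \<Longrightarrow> \<chi> (f * g) = \<chi> f * \<chi> g"
    and o: "\<chi> 1 = 1" and "f \<in> I \<Longrightarrow> \<chi> f = 0" and "f \<notin> polys n \<Longrightarrow> \<chi> f = 0" for f g
    using assms by (auto simp: points_def)
  show z: "\<chi> 0 = 0" using a[of 0 0] by (simp add: polys_closed)
  show u: "f \<in> polys n \<Longrightarrow> \<chi> (- f) = - \<chi> f" for f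
    using a[of f "- f"] z by (simp add: polys_closed eq_neg_iff_add_eq_0 add.commute)
  show "f \<in> polys n \<Longrightarrow> g \<in> polys n \<Longrightarrow> \<chi> (f - g) = \<chi> f - \<chi> g"
    using a[of f "- g"] u[of g] by (simp add: polys_closed)
  have n: "\<chi> (of_nat k) = of_nat k" for k
  proof (induction k)
    case (Suc k)
    then show ?case using a[of 1 "of_nat k"] polys_of_int[of "int k" n] o by (simp add: polys_closed)
  qed (simp add: z)
  show i: "\<chi> (of_int k) = of_int k" for k
  proof (cases k rule: int_cases2)
    case (nonpos m)
    then show ?thesis using n u[of "of_nat m"] polys_of_int[of "int m" n] by simp
  qed (simp add: n)
  show "f \<in> polys n \<Longrightarrow> \<chi> (f ^ e) = \<chi> f ^ e"
    by (induction e) (simp_all add: o m polys_closed)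
  show "f \<in> polys n \<Longrightarrow> \<chi> (int_eval F f) = int_eval F (\<chi> f)"
    by (induction F) (simp_all add: map_poly_pCons z a m i polys_closed polys_poly)
qed

lemma finite_points:
  assumes "integral_ideal n I"
  shows "finite (points n I)"
proof -
  have "\<forall>k\<in>{..<n}. \<exists>F::int poly. lead_coeff F = 1 \<and> int_eval F (var k) \<in> I"
    using assms polys_var by (auto simp: integral_ideal_def integral_mod_def)
  then obtain F :: "nat \<Rightarrow> int poly" where F: "\<And>k. k < n \<Longrightarrow> lead_coeff (F k) = 1"
    "\<And>k. k < n \<Longrightarrow> int_eval (F k) (var k) \<in> I"
    by (auto simp: bchoice_iff)
  define Z where "Z k = {z::complex. int_eval (F k) z = 0}" for k
  define T where "T \<chi> = restrict (\<lambda>k. \<chi> (var k)) {..<n}" for \<chi> :: "int mpoly \<Rightarrow> complex"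
  have "finite (Z k)" if "k < n" for k
  proof -
    have "coeff (map_poly of_int (F k) :: complex poly) (degree (F k)) \<noteq> 0"
      using F(1)[OF that] by (simp add: coeff_map_poly)
    then have "(map_poly of_int (F k) :: complex poly) \<noteq> 0" by auto
    then show ?thesis unfolding Z_def by (rule poly_roots_finite)
  qed
  then have "finite (Pi\<^sub>E {..<n} Z)" by (intro finite_PiE) auto
  moreover have "T ` points n I \<subseteq> Pi\<^sub>E {..<n} Z"
  proof (rule image_subsetI)
    fix \<chi> assume \<chi>: "\<chi> \<in> points n I"
    have "\<chi> (var k) \<in> Z k" if "k < n" for k
      using complex_pointD(11)[OF \<chi> polys_var[OF that], of "F k"] complex_pointD(5)[OF \<chi> F(2)[OF that]]
      by (simp add: Z_def)
    then show "T \<chi> \<in> Pi\<^sub>E {..<n} Z" by (auto simp: T_def)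
  qed
  moreover have "inj_on T (points n I)"
  proof (rule inj_onI)
    fix \<chi> \<psi> assume p: "\<chi> \<in> points n I" "\<psi> \<in> points n I" and eq: "T \<chi> = T \<psi>"
    have v: "\<chi> (var k) = \<psi> (var k)" if "k < n" for k
      using fun_cong[OF eq, of k] that by (simp add: T_def)
    have "\<chi> f = \<psi> f" if "f \<in> polys n" for f
      using that
    proof (induction rule: polys_induct)
      case (const c)
      then show ?case using complex_pointD(9)[OF p(1), of c] complex_pointD(9)[OF p(2), of c]
        by (simp flip: single_of_int)
    qed (simp_all add: v complex_pointD(1,2)[OF p(1)] complex_pointD(1,2)[OF p(2)])
    then show "\<chi> = \<psi>" using complex_pointD(6)[OF p(1)] complex_pointD(6)[OF p(2)] by (metis ext)
  qed
  ultimately show ?thesis by (meson finite_imageD finite_subset)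
qed

text \<open>
  The condition on \<open>S\<close> says that \<open>S\<close> stays disjoint from \<open>I\<close> after extending scalars to \<open>\<rat>\<close>; a rational
  functional with \<open>\<tau> 1 = 1\<close> shows that it then does so over \<open>\<complex>\<close> as well.
\<close>

lemma integral_ideal_point:
  assumes I: "integral_ideal n I" and S: "S \<subseteq> polys n" "1 \<in> S" "\<And>s t. s \<in> S \<Longrightarrow> t \<in> S \<Longrightarrow> s * t \<in> S"
    and disj: "\<And>(N::int) s. N \<noteq> 0 \<Longrightarrow> s \<in> S \<Longrightarrow> of_int N * s \<notin> I"
  shows "\<exists>\<chi>\<in>points n I. \<forall>s\<in>S. \<chi> s \<noteq> 0"
proof -
  have I': "ideal I (ZX n)" "\<And>f. f \<in> polys n \<Longrightarrow> integral_mod I f" using I by (auto simp: integral_ideal_def)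
  have "complex_mpoly s \<notin> complex_extension n I" if s: "s \<in> S" for s
  proof
    assume "complex_mpoly s \<in> complex_extension n I"
    moreover obtain \<tau> where t: "rat_linear \<tau>" "\<tau> 1 = 1" using rat_linear_exists by blast
    moreover have "of_int 1 * \<tau> (lookup (complex_mpoly s) m) = of_int (lookup s m)" for m
      using rat_linear_of_int[OF t(1), of 1] t(2) by (simp add: lookup_complex_mpoly)
    ultimately obtain N :: int where "N \<noteq> 0" "of_int N * s \<in> I"
      using complex_extension_descends[OF I'(1)] S(1) s by blast
    then show False using disj s by blast
  qed
  then have d: "complex_extension n I \<inter> complex_mpoly ` S = {}" by auto
  have "\<exists>J \<chi>. ring_ideal J \<and> complex_extension n I \<subseteq> J \<and> J \<inter> complex_mpoly ` S = {} \<and> \<chi> \<in> points n I \<and>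
     (\<forall>f\<in>polys n. complex_mpoly f - const (\<chi> f) \<in> J)"
  proof (rule complex_point_exists)
    show "I \<subseteq> polys n" using mpoly_ideal(1)[OF I'(1)] by auto
    show "1 \<in> complex_mpoly ` S" using S(2) complex_mpoly.one by (metis imageI)
    show "s * t \<in> complex_mpoly ` S" if "s \<in> complex_mpoly ` S" "t \<in> complex_mpoly ` S" for s t
      using that S(3) by (auto simp flip: complex_mpoly.mult)
  qed (use d I'(1) in \<open>auto intro: complex_extension_ideal complex_mpoly_in_extension I'(2) polys_var\<close>)
  then obtain J \<chi> where J: "J \<inter> complex_mpoly ` S = {}" "\<chi> \<in> points n I"
     "\<And>f. f \<in> polys n \<Longrightarrow> complex_mpoly f - const (\<chi> f) \<in> J" by blast
  have "\<chi> s \<noteq> 0" if "s \<in> S" for s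
  proof
    assume "\<chi> s = 0"
    then have "complex_mpoly s \<in> J" using J(3)[of s] S(1) that by (auto simp: const.zero)
    then show False using J(1) that by blast
  qed
  then show ?thesis using J(2) by blast
qed

definition point_kernel :: "nat \<Rightarrow> (int mpoly \<Rightarrow> complex) \<Rightarrow> int mpoly set" where
  "point_kernel n \<chi> = {f \<in> polys n. \<chi> f = 0}"

lemma primeideal_mpolyI:
  assumes "ideal p (ZX n)" "1 \<notin> p"
    "\<And>f g. f \<in> polys n \<Longrightarrow> g \<in> polys n \<Longrightarrow> f * g \<in> p \<Longrightarrow> f \<in> p \<or> g \<in> p"
  shows "primeideal p (ZX n)"
  by (rule primeidealI[OF assms(1) polys_cring])
    (use assms polys_one in \<open>auto simp: polys_simps\<close>)

lemma primeideal_mpolyD: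
  assumes "primeideal p (ZX n)"
  shows "ideal p (ZX n)" "1 \<notin> p"
    "f \<in> polys n \<Longrightarrow> g \<in> polys n \<Longrightarrow> f * g \<in> p \<Longrightarrow> f \<in> p \<or> g \<in> p"
proof -
  interpret primeideal p "ZX n" by fact
  show "ideal p (ZX n)" by (rule is_ideal)
  show "1 \<notin> p" using I_notcarr one_imp_carrier by (auto simp: polys_simps)
  show "f \<in> polys n \<Longrightarrow> g \<in> polys n \<Longrightarrow> f * g \<in> p \<Longrightarrow> f \<in> p \<or> g \<in> p"
    using I_prime[of f g] by (simp add: polys_simps)
qed

text \<open>
  The minimal primes of a torsion-free finite \<open>\<int>\<close>-algebra are of this kind: the quotient is an order in
  a number field.
\<close>

definition integral_prime :: "nat \<Rightarrow> int mpoly set \<Rightarrow> bool" where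
  "integral_prime n p \<longleftrightarrow> primeideal p (ZX n) \<and> integral_ideal n p \<and> (\<forall>N::int. of_int N \<in> p \<longrightarrow> N = 0)"

lemma integral_primeD:
  assumes "integral_prime n p"
  shows "ideal p (ZX n)" "integral_ideal n p" "1 \<notin> p"
    "f \<in> polys n \<Longrightarrow> g \<in> polys n \<Longrightarrow> f * g \<in> p \<Longrightarrow> f \<in> p \<or> g \<in> p"
    "of_int N \<in> p \<Longrightarrow> N = 0"
    "f \<in> polys n \<Longrightarrow> of_int N * f \<in> p \<Longrightarrow> N \<noteq> 0 \<Longrightarrow> f \<in> p"
    "primeideal p (ZX n)"
proof -
  have p: "primeideal p (ZX n)" "integral_ideal n p" "\<And>N. of_int N \<in> p \<Longrightarrow> N = 0"
    using assms by (auto simp: integral_prime_def)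
  show "primeideal p (ZX n)" by (rule p)
  show "ideal p (ZX n)" "integral_ideal n p" "1 \<notin> p" "of_int N \<in> p \<Longrightarrow> N = 0"
    using p primeideal_mpolyD by auto
  show pr: "f * g \<in> p \<Longrightarrow> f \<in> p \<or> g \<in> p" if "f \<in> polys n" "g \<in> polys n" for f g
    using primeideal_mpolyD(3)[OF p(1)] that by auto
  show "f \<in> p" if "f \<in> polys n" "of_int N * f \<in> p" "N \<noteq> 0"
    using pr[OF polys_of_int that(1,2)] p(3) that(3) by auto
qed

lemma point_kernel_integral_prime:
  assumes "integral_ideal n I" "\<chi> \<in> points n I"
  shows "integral_prime n (point_kernel n \<chi>)" "I \<subseteq> point_kernel n \<chi>"
proof -
  note \<chi> = complex_pointD[OF assms(2)]
  have I: "ideal I (ZX n)" using assms(1) by (simp add: integral_ideal_def)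
  have id: "ideal (point_kernel n \<chi>) (ZX n)"
    by (rule mpoly_idealI) (auto simp: point_kernel_def \<chi> polys_closed)
  show sub: "I \<subseteq> point_kernel n \<chi>" using \<chi>(5) mpoly_ideal(1)[OF I] by (auto simp: point_kernel_def)
  have "primeideal (point_kernel n \<chi>) (ZX n)"
    by (rule primeideal_mpolyI[OF id]) (auto simp: point_kernel_def \<chi> polys_closed)
  moreover have "integral_ideal n (point_kernel n \<chi>)" by (rule integral_ideal_superset[OF assms(1) sub id])
  ultimately show "integral_prime n (point_kernel n \<chi>)"
    by (auto simp: integral_prime_def point_kernel_def \<chi>)
qed

text \<open>
  In an integer equation of least degree for \<open>f\<close> modulo \<open>p\<close> the constant term \<open>c\<close> is nonzero, since
  otherwise \<open>f\<close> could be cancelled; and \<open>-c\<close> is a multiple of \<open>f\<close> modulo \<open>p\<close>.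
\<close>

lemma integral_prime_inverse:
  assumes p: "integral_prime n p" and f: "f \<in> polys n" "f \<notin> p"
  shows "\<exists>g\<in>polys n. \<exists>N::int. N \<noteq> 0 \<and> f * g - of_int N \<in> p"
proof -
  note p' = integral_primeD[OF p]
  define Q where "Q d \<longleftrightarrow> (\<exists>F::int poly. F \<noteq> 0 \<and> degree F = d \<and> int_eval F f \<in> p)" for d
  have "integral_mod p f" using p'(2) f by (simp add: integral_ideal_def)
  then have "\<exists>d. Q d" unfolding integral_mod_def Q_def by (metis leading_coeff_0_iff zero_neq_one)
  then have d: "Q (LEAST d. Q d)" and least: "\<And>e. Q e \<Longrightarrow> (LEAST d. Q d) \<le> e"
    by (auto intro: LeastI_ex Least_le)
  then obtain F :: "int poly" where F: "F \<noteq> 0" "degree F = (LEAST d. Q d)" "int_eval F f \<in> p"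
    by (auto simp: Q_def)
  obtain c k where ck: "F = pCons c k" by (cases F)
  define g where "g = int_eval k f"
  have g: "g \<in> polys n" unfolding g_def by (rule polys_poly[OF f(1)])
  have e: "of_int c + f * g \<in> p" using F(3) by (simp add: ck map_poly_pCons g_def)
  have "c \<noteq> 0"
  proof
    assume c: "c = 0"
    then have "f * g \<in> p" using e by simp
    then have "g \<in> p" using p'(4)[OF f(1) g] f(2) by auto
    moreover have "k \<noteq> 0" using F(1) ck c by auto
    ultimately have "(LEAST d. Q d) \<le> degree k" by (intro least) (auto simp: Q_def g_def)
    then show False using F(2) ck \<open>k \<noteq> 0\<close> by simp
  qed
  then show ?thesis using e g by (intro bexI[of _ g] exI[of _ "- c"]) (auto simp: add.commute)
qed

section \<open>Minimal primes\<close>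

text \<open>
  The quotient by \<open>I\<close> is torsion-free.
\<close>

definition saturated :: "nat \<Rightarrow> int mpoly set \<Rightarrow> bool" where
  "saturated n I \<longleftrightarrow> (\<forall>N::int. \<forall>f\<in>polys n. N \<noteq> 0 \<longrightarrow> of_int N * f \<in> I \<longrightarrow> f \<in> I)"

text \<open>
  A point that does not vanish outside \<open>p\<close> has its kernel inside \<open>p\<close>, and the kernel is prime.
\<close>

lemma minimal_prime_is_kernel:
  assumes I: "integral_ideal n I" and tf: "saturated n I"
    and p: "p \<in> minimal_primes (ZX n) I"
  shows "\<exists>\<chi>\<in>points n I. p = point_kernel n \<chi>"
proof -
  have p': "primeideal p (ZX n)" "I \<subseteq> p" "\<And>q. primeideal q (ZX n) \<Longrightarrow> I \<subseteq> q \<Longrightarrow> q \<subseteq> p \<Longrightarrow> q = p"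
    using p by (auto simp: minimal_primes_def)
  note pr = primeideal_mpolyD[OF p'(1)]
  have "\<exists>\<chi>\<in>points n I. \<forall>s\<in>polys n - p. \<chi> s \<noteq> 0"
  proof (rule integral_ideal_point[OF I])
    show "1 \<in> polys n - p" using pr(2) polys_one by auto
    show "s * t \<in> polys n - p" if "s \<in> polys n - p" "t \<in> polys n - p" for s t
      using that pr(3)[of s t] polys_mult by auto
    show "of_int N * s \<notin> I" if "N \<noteq> 0" "s \<in> polys n - p" for N s
      using that tf p'(2) by (auto simp: saturated_def)
  qed auto
  then obtain \<chi> where \<chi>: "\<chi> \<in> points n I" "\<And>s. s \<in> polys n \<Longrightarrow> s \<notin> p \<Longrightarrow> \<chi> s \<noteq> 0" by auto
  have "point_kernel n \<chi> = p"
    by (rule p'(3)) (use point_kernel_integral_prime[OF I \<chi>(1)] \<chi>(2) in \<open>auto simp: integral_prime_def point_kernel_def\<close>)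
  then show ?thesis using \<chi>(1) by auto
qed

text \<open>
  A larger ideal would contain some \<open>f \<notin> p\<close> and with it the nonzero integer that \<open>f\<close> divides modulo \<open>p\<close>.
\<close>

lemma integral_primes_incomparable:
  assumes "integral_prime n p" "ideal q (ZX n)" "p \<subseteq> q" "\<And>N::int. of_int N \<in> q \<Longrightarrow> N = 0"
  shows "q = p"
proof (rule ccontr)
  assume "q \<noteq> p"
  then obtain f where f: "f \<in> q" "f \<notin> p" using assms(3) by auto
  note q = mpoly_ideal[OF assms(2)]
  obtain g and N :: int where g: "g \<in> polys n" "N \<noteq> 0" "f * g - of_int N \<in> p"
    using integral_prime_inverse[OF assms(1) q(1)[OF f(1)] f(2)] by auto
  have "g * f - (f * g - of_int N) \<in> q" using assms(3) g by (intro q(5)[OF q(6)[OF f(1)]]) auto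
  then show False using assms(4)[of N] g(2) by (simp add: mult.commute)
qed

lemma point_kernel_minimal_prime:
  assumes I: "integral_ideal n I" and tf: "saturated n I"
    and \<chi>: "\<chi> \<in> points n I"
  shows "point_kernel n \<chi> \<in> minimal_primes (ZX n) I"
proof -
  note K = point_kernel_integral_prime[OF I \<chi>]
  have "q = point_kernel n \<chi>" if q: "primeideal q (ZX n)" "I \<subseteq> q" "q \<subseteq> point_kernel n \<chi>" for q
  proof -
    have "of_int N \<in> q \<Longrightarrow> N = 0" for N using q(3) integral_primeD(5)[OF K(1)] by auto
    then have "integral_prime n q" using q integral_ideal_superset[OF I q(2)] primeideal_mpolyD(1)[OF q(1)]
      by (auto simp: integral_prime_def)
    from integral_primes_incomparable[OF this integral_primeD(1)[OF K(1)] q(3) integral_primeD(5)[OF K(1)]]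
    show ?thesis by simp
  qed
  then show ?thesis using K integral_primeD(7)[OF K(1)] by (auto simp: minimal_primes_def)
qed

lemma minimal_primes_conv:
  assumes I: "integral_ideal n I" and tf: "saturated n I"
  shows "minimal_primes (ZX n) I = point_kernel n ` points n I"
proof
  show "minimal_primes (ZX n) I \<subseteq> point_kernel n ` points n I"
  proof
    fix p assume "p \<in> minimal_primes (ZX n) I"
    from minimal_prime_is_kernel[OF I tf this] show "p \<in> point_kernel n ` points n I" by auto
  qed
  show "point_kernel n ` points n I \<subseteq> minimal_primes (ZX n) I"
    by (rule image_subsetI) (rule point_kernel_minimal_prime[OF I tf])
qed

text \<open>
  For \<open>f \<notin> I\<close> no nonzero integer multiple of a power of \<open>f\<close> lies in \<open>I\<close>, so some point does not vanish at \<open>f\<close>.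
\<close>

lemma Inter_minimal_primes:
  assumes I: "integral_ideal n I" and tf: "saturated n I"
    and red: "\<And>k f. f \<in> polys n \<Longrightarrow> f ^ k \<in> I \<Longrightarrow> f \<in> I"
  shows "polys n \<inter> \<Inter>(minimal_primes (ZX n) I) = I"
proof
  show "I \<subseteq> polys n \<inter> \<Inter>(minimal_primes (ZX n) I)"
    using I mpoly_ideal(1) by (auto simp: minimal_primes_def integral_ideal_def)
  show "polys n \<inter> \<Inter>(minimal_primes (ZX n) I) \<subseteq> I"
  proof (rule ccontr)
    assume "\<not> ?thesis"
    then obtain f where f: "f \<in> polys n" "f \<in> \<Inter>(minimal_primes (ZX n) I)" "f \<notin> I" by auto
    have "\<exists>\<chi>\<in>points n I. \<forall>s\<in>range ((^) f). \<chi> s \<noteq> 0"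
    proof (rule integral_ideal_point[OF I])
      show "range ((^) f) \<subseteq> polys n" using f by (auto intro: polys_closed)
      show "1 \<in> range ((^) f)" by (rule range_eqI[of _ _ 0]) simp
      show "s * t \<in> range ((^) f)" if st: "s \<in> range ((^) f)" "t \<in> range ((^) f)" for s t
      proof -
        obtain a b where "s = f ^ a" "t = f ^ b" using st by blast
        then show ?thesis by (metis power_add rangeI)
      qed
      show "of_int N * s \<notin> I" if N: "N \<noteq> 0" and s: "s \<in> range ((^) f)" for N s
      proof
        assume NI: "of_int N * s \<in> I"
        obtain k where k: "s = f ^ k" using s by blast
        have "f ^ k \<in> polys n" by (rule polys_power[OF f(1)])
        then have "f ^ k \<in> I" using tf N NI k unfolding saturated_def by blast
        then show False using red f by blast
      qed
    qed
    then obtain \<chi> where \<chi>: "\<chi> \<in> points n I" "\<And>k. \<chi> (f ^ k) \<noteq> 0" by auto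
    have "f \<in> point_kernel n \<chi>" using f(2) point_kernel_minimal_prime[OF I tf \<chi>(1)] by auto
    then show False using \<chi>(2)[of 1] by (simp add: point_kernel_def)
  qed
qed

section \<open>Finite generation of the unit group of an order\<close>

text \<open>
  Take a polynomial \<open>m\<close> of least degree among those with leading coefficient \<open>\<plusminus>1\<close>. It is irreducible because
  \<open>p\<close> is prime, hence a prime element of the factorial ring \<open>\<int>[X]\<close>. If \<open>s\<close> is a nonzero polynomial of even
  smaller degree with \<open>s(f) \<in> p\<close>, minimal among these, then pseudo-division gives \<open>c m = s q\<close> with an integer \<open>c \<noteq> 0\<close>, so \<open>m\<close>
  divides \<open>q\<close> and \<open>s\<close> is a constant. This plays the role of the Gauss lemma.
\<close>

lemma minimal_polynomial:
  assumes p: "integral_prime n p" and f: "f \<in> polys n"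
  shows "\<exists>m::int poly. \<bar>lead_coeff m\<bar> = 1 \<and> int_eval m f \<in> p \<and>
    (\<forall>r::int poly. r \<noteq> 0 \<longrightarrow> int_eval r f \<in> p \<longrightarrow> degree m \<le> degree r)"
proof -
  note p' = integral_primeD[OF p]
  note pI = mpoly_ideal[OF p'(1)]
  define E where "E F = int_eval F f" for F :: "int poly"
  have E: "E F \<in> polys n" for F unfolding E_def by (rule polys_poly[OF f])
  have Em: "E (F * G) = E F * E G" for F G by (simp add: E_def of_int.map_poly_mult)
  have Ea: "E (F + G) = E F + E G" for F G by (simp add: E_def of_int.map_poly_add)
  have Ec: "E [:c:] = of_int c" for c by (simp add: E_def map_poly_pCons)
  define Q where "Q d \<longleftrightarrow> (\<exists>F. \<bar>lead_coeff F\<bar> = 1 \<and> degree F = d \<and> E F \<in> p)" for d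
  have "integral_mod p f" using p'(2) f by (simp add: integral_ideal_def)
  then have "\<exists>d. Q d" unfolding integral_mod_def Q_def E_def by (metis abs_one)
  then have "Q (LEAST d. Q d)" by (rule LeastI_ex)
  have least: "(LEAST d. Q d) \<le> e" if "Q e" for e using that by (rule Least_le)
  from \<open>Q (LEAST d. Q d)\<close> obtain m where m: "\<bar>lead_coeff m\<bar> = 1" "degree m = (LEAST d. Q d)" "E m \<in> p"
    by (auto simp: Q_def)
  have m0: "m \<noteq> 0" using m(1) by auto
  have unit: "a dvd 1" if a: "degree a = 0" "\<bar>lead_coeff a\<bar> = 1" for a :: "int poly"
  proof -
    obtain c where "a = [:c:]" using a(1) by (rule degree_eq_zeroE)
    then have "a * a = 1" using a(2) by (auto simp: abs_if one_pCons split: if_splits)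
    then show ?thesis by (metis dvd_triv_left)
  qed
  have "Factorial_Ring.irreducible m"
  proof (rule Factorial_Ring.irreducibleI[OF m0])
    show "\<not> m dvd 1"
    proof
      assume "m dvd 1"
      then obtain k where "1 = m * k" by (auto elim: dvdE)
      then have "1 = E m * E k" using Em[of m k] Ec[of 1] by (simp add: one_pCons[symmetric] flip: one_pCons)
      then have "1 \<in> p" using pI(6)[OF m(3) E, of k] by (simp add: mult.commute)
      then show False using p'(3) by simp
    qed
    fix a b assume ab: "m = a * b"
    then have "\<bar>lead_coeff a * lead_coeff b\<bar> = 1" using m(1) by (simp add: lead_coeff_mult)
    then have l: "\<bar>lead_coeff a\<bar> = 1" "\<bar>lead_coeff b\<bar> = 1"
      using abs_zmult_eq_1[of "lead_coeff a" "lead_coeff b"] abs_zmult_eq_1[of "lead_coeff b" "lead_coeff a"]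
      by (simp_all add: mult.commute)
    then have nz: "a \<noteq> 0" "b \<noteq> 0" by auto
    have deg: "degree m = degree a + degree b"
      unfolding ab by (rule degree_mult_eq[OF nz])
    have "E a \<in> p \<or> E b \<in> p" using p'(4)[OF E E] m(3) Em ab by metis
    then have "degree m \<le> degree a \<or> degree m \<le> degree b"
      using least l unfolding m(2) Q_def by blast
    then have "degree b = 0 \<or> degree a = 0" using deg by auto
    then show "a dvd 1 \<or> b dvd 1" using unit l by auto
  qed
  then have prime: "prime_elem m" by (rule irreducible_imp_prime_elem)
  have "degree m \<le> degree r" if r: "r \<noteq> 0" "E r \<in> p" for r
  proof (rule ccontr)
    assume less: "\<not> ?thesis"
    define P where "P s \<longleftrightarrow> s \<noteq> 0 \<and> E s \<in> p" for s
    obtain s where s: "P s" "\<And>t. P t \<Longrightarrow> degree s \<le> degree t"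
      using ex_has_least_nat[of P r degree] r by (auto simp: P_def)
    have s': "s \<noteq> 0" "E s \<in> p" using s(1) by (auto simp: P_def)
    have sm: "degree s < degree m" using s(2)[of r] r less by (simp add: P_def)
    obtain q t where qt: "pseudo_divmod m s = (q, t)" by fastforce
    define c where "c = lead_coeff s ^ (Suc (degree m) - degree s)"
    have c: "c \<noteq> 0" using s'(1) by (simp add: c_def)
    have eq: "Polynomial.smult c m = s * q + t" and dt: "t = 0 \<or> degree t < degree s"
      using pseudo_divmod[OF s'(1) qt] by (simp_all add: c_def)
    have "E t = E ([:c:] * m) - E (s * q)" using eq Ea[of "s * q" t] by (simp add: E_def)
    also have "\<dots> = of_int c * E m - E q * E s" unfolding Em Ec by (simp add: mult.commute)
    also have "\<dots> \<in> p" by (intro pI(5) pI(6) m s' E polys_of_int)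
    finally have "t = 0" using s(2)[of t] dt unfolding P_def by (metis linorder_not_less)
    then have eq: "[:c:] * m = s * q" using eq by simp
    then have "m dvd s * q" by (metis dvd_triv_right)
    then consider "m dvd s" | "m dvd q" using prime prime_elem_dvd_mult_iff by blast
    then show False
    proof cases
      case 1
      then show False using dvd_imp_degree_le[OF _ s'(1)] sm by fastforce
    next
      case 2
      then obtain k where "q = m * k" by (auto elim: dvdE)
      then have "m * [:c:] = m * (s * k)" using eq by (simp only: mult_ac)
      then have sk: "[:c:] = s * k" using m0 unfolding mult_cancel_left by blast
      then have "k \<noteq> 0" using c by auto
      then have "degree s = 0" using degree_mult_eq[OF s'(1)] sk[symmetric] by (metis add_is_0 degree_pCons_0)
      then obtain e where e: "s = [:e:]" using degree_0_id by metis
      then show False using s' p'(5) Ec by fastforce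
    qed
  qed
  then show ?thesis using m unfolding E_def by blast
qed

text \<open>
  Here \<open>1 \<in> adjoin J (y x)\<close> says that \<open>y x\<close> is invertible modulo \<open>J\<close>, so it can be cancelled.
\<close>

lemma prod_filter_in_ideal:
  assumes J: "ring_ideal J" and units: "\<And>x. x \<in> set xs \<Longrightarrow> \<not> P x \<Longrightarrow> 1 \<in> adjoin J (y x)"
    and "a * (\<Prod>x\<leftarrow>xs. y x) \<in> J"
  shows "a * (\<Prod>x\<leftarrow>filter P xs. y x) \<in> J"
  using units assms(3)
proof (induction xs arbitrary: a)
  case (Cons x xs)
  note J' = ring_idealD[OF J]
  show ?case
  proof (cases "P x")
    case True
    then show ?thesis using Cons.IH[of "a * y x"] Cons.prems by (simp add: mult.assoc)
  next
    case False
    then obtain r where r: "1 - r * y x \<in> J" using Cons.prems(1)[of x] by (auto simp: adjoin_def)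
    define b where "b = a * (\<Prod>x\<leftarrow>xs. y x)"
    have "b = b * (1 - r * y x) + r * (a * (\<Prod>x\<leftarrow>x # xs. y x))" by (simp add: b_def algebra_simps)
    also have "\<dots> \<in> J" by (intro J'(2) J'(3) r Cons.prems(2))
    finally show ?thesis using Cons.IH[of a] Cons.prems(1) False by (simp add: b_def)
  qed
qed simp

lemma prod_list_less_1:
  assumes "xs \<noteq> []" "\<And>x. x \<in> set xs \<Longrightarrow> cmod x < 1"
  shows "cmod (prod_list xs) < 1"
  using assms
proof (induction xs rule: list_nonempty_induct)
  case (cons x xs)
  then have "cmod x < 1" "cmod (prod_list xs) < 1" by auto
  then have "cmod x * cmod (prod_list xs) < 1 * 1" by (intro mult_strict_mono') auto
  then show ?case by (simp add: norm_mult)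
qed simp

text \<open>
  If \<open>x\<close> is not a value of \<open>f\<close> at a point, then by the Nullstellensatz \<open>f - x\<close> is invertible modulo the extension of
  \<open>p\<close> to \<open>\<complex>[x]\<close>. Cancelling these factors from \<open>m(f)\<close>, where \<open>m\<close> is the minimal polynomial, leaves a complex
  relation for \<open>f\<close> whose degree is the number of remaining roots. By descent this is at least the degree
  of \<open>m\<close>, so every root of \<open>m\<close> is a value. The product of the roots is up to sign a nonzero integer.
\<close>

lemma nonzero_has_large_value:
  assumes p: "integral_prime n p" and f: "f \<in> polys n" "f \<notin> p"
  shows "\<exists>\<chi>\<in>points n p. cmod (\<chi> f) \<ge> 1"
proof -
  note p' = integral_primeD[OF p]
  obtain m :: "int poly" where m: "\<bar>lead_coeff m\<bar> = 1" "int_eval m f \<in> p"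
    and min: "\<And>r::int poly. r \<noteq> 0 \<Longrightarrow> int_eval r f \<in> p \<Longrightarrow> degree m \<le> degree r"
    using minimal_polynomial[OF p f(1)] by blast
  have m0: "m \<noteq> 0" using m(1) by auto
  define M where "M = (map_poly of_int m :: complex poly)"
  have lc: "lead_coeff m \<noteq> 0" using m0 by simp
  then have dM: "degree M = degree m" unfolding M_def by (intro map_poly_degree_eq) simp
  have lM: "lead_coeff M = of_int (lead_coeff m)" unfolding dM by (simp add: M_def coeff_map_poly)
  have M0: "M \<noteq> 0" using lM lc by auto
  obtain xs where xs: "M = Polynomial.smult (lead_coeff M) (\<Prod>x\<leftarrow>xs. [:- x, 1:])"
    using split_complex_poly[OF M0] by auto
  have deg_prod: "degree (\<Prod>x\<leftarrow>ys. [:- x, 1:]) = length ys \<and> lead_coeff (\<Prod>x\<leftarrow>ys. [:- x, 1:]) = 1"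
    for ys :: "complex list"
  proof (induction ys)
    case (Cons y ys)
    then have "(\<Prod>x\<leftarrow>ys. [:- x, 1:]) \<noteq> 0" by auto
    then show ?case using conjunct1[OF Cons.IH] conjunct2[OF Cons.IH] degree_mult_eq[of "[:-y,1:]" "\<Prod>x\<leftarrow>ys. [:- x, 1:]"]
        lead_coeff_mult[of "[:-y,1:]" "\<Prod>x\<leftarrow>ys. [:- x, 1:]"] by (simp del: mult_pCons_left)
  qed simp
  have len: "length xs = degree m"
    using deg_prod[of xs] dM lM lc by (subst (asm) xs) simp
  define J where "J = complex_extension n p"
  have J: "ring_ideal J" unfolding J_def by (rule complex_extension_ideal[OF p'(1)])
  note J' = ring_idealD[OF J]
  have pJ: "complex_mpoly ` p \<subseteq> J" unfolding J_def using complex_mpoly_in_extension[OF p'(1)] by auto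
  define P where "P x \<longleftrightarrow> (\<exists>\<chi>\<in>points n p. \<chi> f = x)" for x
  define h where "h = Polynomial.smult (lead_coeff M) (\<Prod>x\<leftarrow>filter P xs. [:- x, 1:])"
  have h: "h \<noteq> 0" "degree h = length (filter P xs)"
    using deg_prod[of "filter P xs"] M0 by (auto simp: h_def)
  have split: "const (lead_coeff M) * (\<Prod>x\<leftarrow>xs. complex_mpoly f - const x) \<in> J"
  proof -
    have "complex_mpoly (int_eval m f) = poly (map_poly const M) (complex_mpoly f)"
      unfolding M_def by (rule poly_complex_mpoly)
    also have "\<dots> = const (lead_coeff M) * (\<Prod>x\<leftarrow>xs. complex_mpoly f - const x)"
      by (subst xs) (simp add: map_poly_smult const.zero const.mult poly_const_linear_factors del: mult_single)
    finally show ?thesis using pJ m(2) by auto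
  qed
  have nonvalue: "1 \<in> adjoin J (complex_mpoly f - const x)" if "\<not> P x" for x
  proof (rule ccontr)
    assume n1: "1 \<notin> adjoin J (complex_mpoly f - const x)"
    define A where "A = adjoin J (complex_mpoly f - const x)"
    note A = adjoin_ideal[OF J, of "complex_mpoly f - const x", folded A_def]
    have "\<exists>J' \<chi>. ring_ideal J' \<and> A \<subseteq> J' \<and> J' \<inter> {1} = {} \<and> \<chi> \<in> points n p \<and>
       (\<forall>f\<in>polys n. complex_mpoly f - const (\<chi> f) \<in> J')"
    proof (rule complex_point_exists)
      show "p \<subseteq> polys n" using mpoly_ideal(1)[OF p'(1)] by auto
      show "integral_mod p (var k)" if "k < n" for k
        using p'(2) polys_var[OF that] by (auto simp: integral_ideal_def)
      show "complex_mpoly ` p \<subseteq> A" using pJ A(2) by auto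
      show "A \<inter> {1} = {}" using n1 by (simp add: A_def)
    qed (use A(1) in auto)
    then obtain J2 \<chi> where J2: "ring_ideal J2" "A \<subseteq> J2" "1 \<notin> J2" "\<chi> \<in> points n p"
      "complex_mpoly f - const (\<chi> f) \<in> J2" using f(1) by auto
    have "complex_mpoly f - const x \<in> J2" using A(3) J2(2) by auto
    from ring_idealD(5)[OF J2(1) this J2(5)] have "const (\<chi> f - x) \<in> J2" by (simp add: const.diff)
    then have "const (inverse (\<chi> f - x)) * const (\<chi> f - x) \<in> J2" by (rule ring_idealD(3)[OF J2(1)])
    then have "\<chi> f = x" using J2(3) by (cases "\<chi> f = x") (simp_all add: mult_single)
    then show False using that J2(4) by (auto simp: P_def)
  qed
  have "const (lead_coeff M) * (\<Prod>x\<leftarrow>filter P xs. complex_mpoly f - const x) \<in> J"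
    by (rule prod_filter_in_ideal[OF J nonvalue split])
  then have "poly (map_poly const h) (complex_mpoly f) \<in> complex_extension n p"
    by (simp add: h_def map_poly_smult const.zero const.mult poly_const_linear_factors J_def del: mult_single)
  from complex_relation_descends[OF p'(1) f(1) h(1) this]
  have "degree m \<le> length (filter P xs)"
    using min h(2) by (metis order_trans)
  then have all: "\<forall>x\<in>set xs. P x"
    using len by (metis filter_id_conv length_filter_le order_antisym filter_True length_filter_less linorder_not_less)
  have c0: "coeff m 0 \<noteq> 0"
  proof
    assume c: "coeff m 0 = 0"
    obtain k where k: "m = pCons 0 k" using c by (cases m) auto
    then have k0: "k \<noteq> 0" using m0 by auto
    have "f * int_eval k f \<in> p" using m(2) k by (simp add: map_poly_pCons)
    then have "int_eval k f \<in> p" using p'(4)[OF f(1) polys_poly[OF f(1)]] f(2) by blast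
    then show False using min[OF k0] k k0 by simp
  qed
  have xs0: "xs \<noteq> []"
  proof
    assume "xs = []"
    then obtain c where "m = [:c:]" using len degree_0_id[of m] by (metis list.size(3))
    then show False using m(2) m0 p'(5) by (auto simp: map_poly_pCons)
  qed
  have "poly (\<Prod>x\<leftarrow>ys. [:- x, 1:]) 0 = (\<Prod>x\<leftarrow>ys. - x)" for ys :: "complex list"
    by (induction ys) (simp_all del: mult_pCons_left)
  then have prod0: "coeff (\<Prod>x\<leftarrow>xs. [:- x, 1:]) 0 = (\<Prod>x\<leftarrow>xs. - x)" by (simp flip: poly_0_coeff_0)
  have "of_int (coeff m 0) = coeff M 0" by (simp add: M_def coeff_map_poly)
  also have "\<dots> = lead_coeff M * (\<Prod>x\<leftarrow>xs. - x)"
    by (subst xs) (simp add: prod0)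
  finally have "cmod (of_int (coeff m 0)) = cmod (prod_list (map uminus xs))"
    using m(1) lM by (simp add: norm_mult flip: of_int_abs)
  then have "1 \<le> cmod (prod_list (map uminus xs))" using c0 by simp
  then obtain x where "x \<in> set (map uminus xs)" "cmod x \<ge> 1"
    using prod_list_less_1[of "map uminus xs"] xs0 by (metis linorder_not_less map_is_Nil_conv)
  then have "- x \<in> set xs" "cmod (- x) \<ge> 1" by auto
  moreover obtain \<chi> where "\<chi> \<in> points n p" "\<chi> f = - x"
    using all \<open>- x \<in> set xs\<close> by (auto simp: P_def)
  ultimately show ?thesis by metis
qed

text \<open>
  Round the real and imaginary parts of all values to the grid of width \<open>1/2\<close>. If two elements fall
  into the same cell, then all values of their difference are below \<open>1\<close>, so the difference is in \<open>p\<close>.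
\<close>

lemma finite_bounded_cosets:
  assumes p: "integral_prime n p"
  shows "finite {coset n p f | f. f \<in> polys n \<and> (\<forall>\<chi>\<in>points n p. cmod (\<chi> f) \<le> B)}"
proof -
  note p' = integral_primeD[OF p]
  define V where "V = points n p"
  have V: "finite V" unfolding V_def by (rule finite_points[OF p'(2)])
  define D where "D = {f \<in> polys n. \<forall>\<chi>\<in>V. cmod (\<chi> f) \<le> B}"
  define T where "T f = restrict (\<lambda>\<chi>. (\<lfloor>2 * Re (\<chi> f)\<rfloor>, \<lfloor>2 * Im (\<chi> f)\<rfloor>)) V" for f :: "int mpoly"
  define K where "K = \<lceil>2 * B\<rceil> + 1"
  have bd: "\<lfloor>2 * x\<rfloor> \<in> {-K..K}" if "\<bar>x\<bar> \<le> B" for x :: real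
    using that unfolding K_def atLeastAtMost_iff by linarith
  have "T ` D \<subseteq> Pi\<^sub>E V (\<lambda>_. {-K..K} \<times> {-K..K})"
  proof (rule image_subsetI)
    fix f assume f: "f \<in> D"
    have "\<bar>Re (\<chi> f)\<bar> \<le> B \<and> \<bar>Im (\<chi> f)\<bar> \<le> B" if "\<chi> \<in> V" for \<chi>
      using f that abs_Re_le_cmod[of "\<chi> f"] abs_Im_le_cmod[of "\<chi> f"] by (force simp: D_def)
    then show "T f \<in> Pi\<^sub>E V (\<lambda>_. {-K..K} \<times> {-K..K})" using bd by (auto simp: T_def)
  qed
  moreover have "finite (Pi\<^sub>E V (\<lambda>_. {-K..K} \<times> {-K..K}))" using V by (intro finite_PiE) auto
  ultimately have fin: "finite (T ` D)" by (rule finite_subset)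
  have same: "coset n p f = coset n p g" if fg: "f \<in> D" "g \<in> D" "T f = T g" for f g
  proof (rule ccontr)
    have c: "f \<in> polys n" "g \<in> polys n" using fg by (auto simp: D_def)
    assume "coset n p f \<noteq> coset n p g"
    then have "f - g \<notin> p" using coset_eq_iff[OF p'(1) c] by simp
    then obtain \<chi> where \<chi>: "\<chi> \<in> V" "cmod (\<chi> (f - g)) \<ge> 1"
      using nonzero_has_large_value[OF p polys_diff[OF c]] by (auto simp: V_def)
    have d: "\<chi> (f - g) = \<chi> f - \<chi> g" using complex_pointD(8)[of \<chi> n p f g] \<chi>(1) c by (simp add: V_def)
    have "\<lfloor>2 * Re (\<chi> f)\<rfloor> = \<lfloor>2 * Re (\<chi> g)\<rfloor>" "\<lfloor>2 * Im (\<chi> f)\<rfloor> = \<lfloor>2 * Im (\<chi> g)\<rfloor>"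
      using fun_cong[OF fg(3), of \<chi>] \<chi>(1) by (auto simp: T_def)
    then have "\<bar>Re (\<chi> (f - g))\<bar> < 1/2" "\<bar>Im (\<chi> (f - g))\<bar> < 1/2" unfolding d minus_complex.sel by linarith+
    then have "cmod (\<chi> (f - g)) < 1" using cmod_le[of "\<chi> (f - g)"] by linarith
    then show False using \<chi>(2) by simp
  qed
  have "{coset n p f | f. f \<in> polys n \<and> (\<forall>\<chi>\<in>points n p. cmod (\<chi> f) \<le> B)} \<subseteq>
      (\<lambda>y. coset n p (inv_into D T y)) ` T ` D"
  proof clarify
    fix f assume "f \<in> polys n" "\<forall>\<chi>\<in>points n p. cmod (\<chi> f) \<le> B"
    then have f: "f \<in> D" by (simp add: D_def V_def)
    then have "coset n p f = coset n p (inv_into D T (T f))"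
      by (intro same inv_into_into) (simp_all add: f_inv_into_f)
    then show "coset n p f \<in> (\<lambda>y. coset n p (inv_into D T y)) ` T ` D" using f by blast
  qed
  then show ?thesis using fin finite_subset by blast
qed

text \<open>
  The part of the unit theorem of Dirichlet that is needed. The logarithmic map uses all points, so
  conjugate points contribute equal coordinates.
\<close>

lemma order_units_fin_gen:
  assumes p: "integral_prime n p"
  shows "fin_gen (units_of (ZX n Quot p)) (Units (ZX n Quot p))"
proof -
  note p' = integral_primeD[OF p]
  define R where "R = ZX n Quot p"
  interpret R: cring R unfolding R_def by (rule quotient_cring[OF p'(1)])
  interpret G: comm_group "units_of R" by (rule R.units_comm_group)
  define V where "V = points n p"
  have V: "finite V" unfolding V_def by (rule finite_points[OF p'(2)])
  define rep where "rep u = (SOME f. f \<in> polys n \<and> u = coset n p f)" for u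
  have rep: "rep u \<in> polys n" "coset n p (rep u) = u" if "u \<in> Units R" for u
  proof -
    have "\<exists>f. f \<in> polys n \<and> u = coset n p f"
      using coset_cases[of u n p] R.Units_closed[OF that] by (auto simp: R_def)
    from someI_ex[OF this] show "rep u \<in> polys n" "coset n p (rep u) = u" unfolding rep_def by auto
  qed
  have val: "\<chi> f = \<chi> g" if "\<chi> \<in> V" "f \<in> polys n" "g \<in> polys n" "coset n p f = coset n p g" for \<chi> f g
    using complex_pointD(5)[of \<chi> n p "f - g"] complex_pointD(8)[of \<chi> n p f g] coset_eq_iff[OF p'(1) that(2,3)] that
    by (auto simp: V_def)
  have rep_mult: "\<chi> (rep (u \<otimes>\<^bsub>R\<^esub> v)) = \<chi> (rep u) * \<chi> (rep v)" if "u \<in> Units R" "v \<in> Units R" "\<chi> \<in> V" for u v \<chi>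
  proof -
    have uv: "u \<otimes>\<^bsub>R\<^esub> v \<in> Units R" using that by (intro R.Units_m_closed)
    have "\<chi> (rep (u \<otimes>\<^bsub>R\<^esub> v)) = \<chi> (rep u * rep v)"
    proof (rule val[OF that(3) rep(1)[OF uv] polys_mult[OF rep(1)[OF that(1)] rep(1)[OF that(2)]]])
      show "coset n p (rep (u \<otimes>\<^bsub>R\<^esub> v)) = coset n p (rep u * rep v)"
        using coset_mult[OF p'(1) rep(1)[OF that(1)] rep(1)[OF that(2)]]
        unfolding rep(2)[OF that(1)] rep(2)[OF that(2)] rep(2)[OF uv] R_def[symmetric] by simp
    qed
    then show ?thesis using complex_pointD(2)[of \<chi> n p] that rep by (simp add: V_def)
  qed
  have rep_one: "\<chi> (rep \<one>\<^bsub>R\<^esub>) = 1" if "\<chi> \<in> V" for \<chi>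
    using val[OF that rep(1)[OF R.Units_one_closed] polys_one] rep(2)[OF R.Units_one_closed]
      complex_pointD(3)[of \<chi> n p] that coset_one[of n p] by (simp add: V_def R_def)
  have nz: "\<chi> (rep u) \<noteq> 0" if "u \<in> Units R" "\<chi> \<in> V" for u \<chi>
    using rep_mult[OF that(1) R.Units_inv_Units[OF that(1)] that(2)] rep_one[OF that(2)] that by auto
  have "fin_gen (units_of R) (carrier (units_of R))"
  proof (rule G.fin_gen_by_bounded_sets[OF V, of "{}" "\<lambda>u \<chi>. ln (cmod (\<chi> (rep u)))"])
    show "ln (cmod (\<chi> (rep (u \<otimes>\<^bsub>units_of R\<^esub> v)))) = ln (cmod (\<chi> (rep u))) + ln (cmod (\<chi> (rep v)))"
      if "u \<in> carrier (units_of R)" "v \<in> carrier (units_of R)" "\<chi> \<in> V" for u v \<chi>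
      using that nz by (simp add: units_of_carrier units_of_mult units_of_one rep_mult norm_mult ln_mult)
    fix B :: real
    define E where "E = {u \<in> Units R. \<forall>\<chi>\<in>V. \<bar>ln (cmod (\<chi> (rep u)))\<bar> \<le> B}"
    have "E \<subseteq> {coset n p f | f. f \<in> polys n \<and> (\<forall>\<chi>\<in>points n p. cmod (\<chi> f) \<le> exp B)}"
    proof
      fix u assume u: "u \<in> E"
      then have uU: "u \<in> Units R" by (simp add: E_def)
      have "cmod (\<chi> (rep u)) \<le> exp B" if "\<chi> \<in> V" for \<chi>
      proof -
        have "ln (cmod (\<chi> (rep u))) \<le> B" using u that by (force simp: E_def)
        then have "exp (ln (cmod (\<chi> (rep u)))) \<le> exp B" by simp
        then show ?thesis using nz[OF uU that] by simp
      qed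
      then show "u \<in> {coset n p f | f. f \<in> polys n \<and> (\<forall>\<chi>\<in>points n p. cmod (\<chi> f) \<le> exp B)}"
        using rep[OF uU] unfolding V_def by force
    qed
    then have "finite E" using finite_bounded_cosets[OF p] finite_subset by blast
    moreover have "\<exists>e\<in>E. \<exists>z\<in>generate (units_of R) {}. u = e \<otimes>\<^bsub>units_of R\<^esub> z"
      if "u \<in> Units R" "\<forall>\<chi>\<in>V. \<bar>ln (cmod (\<chi> (rep u)))\<bar> \<le> B" for u
      using that R.Units_closed[OF that(1)]
      by (intro bexI[of _ u] bexI[of _ "\<one>\<^bsub>R\<^esub>"]) (auto simp: E_def units_of_carrier units_of_mult units_of_one G.generate_empty)
    ultimately show "\<exists>E. finite E \<and> E \<subseteq> carrier (units_of R) \<and> (\<forall>u\<in>carrier (units_of R).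
       (\<forall>\<chi>\<in>V. \<bar>ln (cmod (\<chi> (rep u)))\<bar> \<le> B) \<longrightarrow> (\<exists>e\<in>E. \<exists>z\<in>generate (units_of R) {}. u = e \<otimes>\<^bsub>units_of R\<^esub> z))"
      by (intro exI[of _ E]) (auto simp: E_def units_of_carrier units_of_mult units_of_one)
  qed auto
  then show ?thesis by (simp add: R_def units_of_carrier units_of_mult units_of_one)
qed

lemma unit_generators_exist:
  assumes p: "integral_prime n p"
  shows "\<exists>U. unit_generators (ZX n) p U"
proof -
  note p' = integral_primeD[OF p]
  define R where "R = ZX n Quot p"
  interpret R: cring R unfolding R_def by (rule quotient_cring[OF p'(1)])
  obtain T where T: "finite T" "T \<subseteq> Units R" "generate (units_of R) T = Units R"
    using order_units_fin_gen[OF p] by (auto simp: fin_gen_def R_def)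
  have "\<forall>t\<in>T. \<exists>f\<in>polys n. t = coset n p f"
    using T(2) R.Units_closed coset_cases[of _ n p] unfolding R_def by blast
  then obtain r where r: "\<And>t. t \<in> T \<Longrightarrow> r t \<in> polys n \<and> t = coset n p (r t)" by metis
  have "(\<lambda>u. coset n p u) ` r ` T = T" using r by (force simp: image_image)
  then have "unit_generators (ZX n) p (r ` T)" unfolding unit_generators_def
    using T r by (auto simp: R_def)
  then show ?thesis by blast
qed

section \<open>Extension of scalars to the rational numbers\<close>

lemma keys_rat_mpoly: "keys (rat_mpoly f) = keys f"
  by (auto simp: in_keys_iff lookup_rat_mpoly)

lemma rat_mpoly_carrier: "rat_mpoly f \<in> carrier (QX n) \<longleftrightarrow> f \<in> polys n"
  by (simp add: mem_mpoly_ring keys_rat_mpoly)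

lemma rat_mpoly_inject: "rat_mpoly f = rat_mpoly g \<longleftrightarrow> f = g"
proof
  assume "rat_mpoly f = rat_mpoly g"
  then have "lookup f m = lookup g m" for m
    using lookup_rat_mpoly[of f m] lookup_rat_mpoly[of g m] by simp
  then show "f = g" by (rule poly_mapping_eqI)
qed simp

definition has_multiple_in :: "int mpoly set \<Rightarrow> rat mpoly \<Rightarrow> bool" where
  "has_multiple_in I x \<longleftrightarrow> (\<exists>N::int. N \<noteq> 0 \<and> (\<exists>f\<in>I. of_int N * x = rat_mpoly f))"

lemma has_multiple_in_add:
  assumes I: "ideal I (ZX n)" and "has_multiple_in I x" "has_multiple_in I y"
  shows "has_multiple_in I (x + y)"
proof -
  obtain N M f g where *: "N \<noteq> 0" "M \<noteq> 0" "f \<in> I" "g \<in> I"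
    "of_int N * x = rat_mpoly f" "of_int M * y = rat_mpoly g"
    using assms(2,3) unfolding has_multiple_in_def by metis
  have "of_int (N * M) * (x + y) = of_int M * (of_int N * x) + of_int N * (of_int M * y)"
    by (simp add: algebra_simps)
  also have "\<dots> = rat_mpoly (of_int M * f + of_int N * g)"
    by (simp add: * rat_mpoly.add rat_mpoly.mult rat_mpoly.of_int)
  finally have "of_int (N * M) * (x + y) = rat_mpoly (of_int M * f + of_int N * g)" .
  moreover have "of_int M * f + of_int N * g \<in> I"
    by (intro mpoly_ideal_add[OF I] mpoly_ideal_mult[OF I] * polys_of_int)
  moreover have "N * M \<noteq> 0" using * by simp
  ultimately show ?thesis unfolding has_multiple_in_def by blast
qed

lemma has_multiple_in_mult:
  assumes I: "ideal I (ZX n)" and "has_multiple_in I x" "has_multiple_in (polys n) y"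
  shows "has_multiple_in I (y * x)"
proof -
  obtain N M f g where *: "N \<noteq> 0" "M \<noteq> 0" "f \<in> I" "g \<in> polys n"
    "of_int N * x = rat_mpoly f" "of_int M * y = rat_mpoly g"
    using assms(2,3) unfolding has_multiple_in_def by metis
  have "of_int (N * M) * (y * x) = (of_int M * y) * (of_int N * x)" by (simp add: algebra_simps)
  then have "of_int (N * M) * (y * x) = rat_mpoly (g * f)" by (simp add: * rat_mpoly.mult)
  moreover have "g * f \<in> I" by (intro mpoly_ideal_mult[OF I] *)
  moreover have "N * M \<noteq> 0" using * by simp
  ultimately show ?thesis unfolding has_multiple_in_def by blast
qed

lemma clear_denominators:
  assumes "x \<in> carrier (QX n)"
  shows "has_multiple_in (polys n) x"
proof -
  note carrier = ring.oneideal[OF polys_ring, of n]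
  show ?thesis using assms
  proof (induction rule: polys_induct)
    case (const c)
    obtain u v where "quotient_of c = (u, v)" by fastforce
    then have v: "v > 0" "c = of_int u / of_int v" using quotient_of_denom_pos quotient_of_div by auto
    then have "of_int v * const c = rat_mpoly (const u)"
      by (simp add: rat_mpoly_def mult_single flip: single_of_int)
    then show ?case unfolding has_multiple_in_def using v polys_const[of u n]
      by (intro exI[of _ v]) auto
  next
    case (var k)
    have "of_int 1 * var k = rat_mpoly (var k)" by (simp add: rat_mpoly_def var_def)
    then show ?case unfolding has_multiple_in_def using polys_var[OF var] by (intro exI[of _ 1]) auto
  qed (auto intro: has_multiple_in_add[OF carrier] has_multiple_in_mult[OF carrier])
qed

lemma rat_extension_ideal:
  assumes "ideal I (ZX n)"
  shows "ideal (rat_extension n I) (QX n)"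
  unfolding rat_extension_def using mpoly_ideal(1)[OF assms]
  by (intro ring.genideal_ideal polys_ring) (auto simp: rat_mpoly_carrier)

lemma mem_rat_extension:
  assumes I: "ideal I (ZX n)"
  shows "x \<in> rat_extension n I \<longleftrightarrow> x \<in> carrier (QX n) \<and> has_multiple_in I x"
proof -
  note I' = mpoly_ideal[OF I]
  define D where "D = {x \<in> carrier (QX n). has_multiple_in I x}"
  have "ideal D (QX n)"
  proof (rule mpoly_idealI)
    show "0 \<in> D" unfolding D_def has_multiple_in_def using I'(2)
      by (auto intro!: polys_closed exI[of _ 1] bexI[of _ 0] simp: rat_mpoly.zero)
    show "x + y \<in> D" if "x \<in> D" "y \<in> D" for x y
      using that has_multiple_in_add[OF I] polys_add by (auto simp: D_def)
    show "y * x \<in> D" if "x \<in> D" "y \<in> carrier (QX n)" for x y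
      using that has_multiple_in_mult[OF I] clear_denominators polys_mult by (auto simp: D_def)
  qed (auto simp: D_def)
  moreover have sub: "rat_mpoly ` I \<subseteq> D"
    unfolding D_def has_multiple_in_def using I'(1) by (auto simp: rat_mpoly_carrier intro!: exI[of _ 1])
  ultimately have "rat_extension n I \<subseteq> D"
    unfolding rat_extension_def by (intro ring.genideal_minimal polys_ring)
  moreover have "D \<subseteq> rat_extension n I"
  proof
    fix x assume "x \<in> D"
    then obtain N f where 1: "N \<noteq> 0" "f \<in> I" "of_int N * x = rat_mpoly f"
      unfolding D_def has_multiple_in_def by blast
    have "rat_mpoly ` I \<subseteq> carrier (QX n)" using I'(1) by (auto simp: rat_mpoly_carrier)
    then have "rat_mpoly f \<in> rat_extension n I" unfolding rat_extension_def
      using ring.genideal_self[OF polys_ring] 1(2) by blast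
    then have "const (inverse (of_int N)) * rat_mpoly f \<in> rat_extension n I"
      by (rule mpoly_ideal(6)[OF rat_extension_ideal[OF I]]) (rule polys_const)
    moreover have "const (inverse (of_int N)) * rat_mpoly f = (const (inverse (of_int N)) * const (of_int N)) * x"
      using 1(3)[symmetric] by (simp add: mult.assoc)
    moreover have "const (inverse (of_int N)) * const (of_int N :: rat) = 1" using 1(1) by (simp add: mult_single del: single_of_int)
    ultimately show "x \<in> rat_extension n I" by simp
  qed
  ultimately show ?thesis unfolding D_def by blast
qed

lemma rat_mpoly_in_extension: "ideal I (ZX n) \<Longrightarrow> f \<in> I \<Longrightarrow> rat_mpoly f \<in> rat_extension n I"
  using mpoly_ideal(1)[of I n f] 
  by (auto simp: mem_rat_extension has_multiple_in_def rat_mpoly_carrier intro!: exI[of _ 1])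

text \<open>
  Extension to the rationals followed by contraction is saturation, and \<open>p\<close> is saturated because it
  is prime and contains no nonzero integer.
\<close>

lemma integral_prime_contraction:
  assumes p: "integral_prime n p" and f: "f \<in> polys n"
  shows "rat_mpoly f \<in> rat_extension n p \<longleftrightarrow> f \<in> p"
proof
  note p' = integral_primeD[OF p]
  assume "rat_mpoly f \<in> rat_extension n p"
  then obtain N g where g: "N \<noteq> 0" "g \<in> p" "of_int N * rat_mpoly f = rat_mpoly g"
    unfolding mem_rat_extension[OF p'(1)] has_multiple_in_def by blast
  then have "of_int N * f = g" by (simp add: rat_mpoly_inject flip: rat_mpoly.of_int rat_mpoly.mult)
  then show "f \<in> p" using p'(6)[OF f] g by blast
qed (rule rat_mpoly_in_extension[OF integral_primeD(1)[OF p]])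

text \<open>
  Extension of scalars commutes with the intersection: after clearing denominators in \<open>x\<close> it only
  remains to contract.
\<close>

lemma rat_extension_Inter:
  assumes ps: "\<And>p. p \<in> P \<Longrightarrow> integral_prime n p" and I: "ideal I (ZX n)" "I = polys n \<inter> \<Inter>P"
  shows "x \<in> rat_extension n I \<longleftrightarrow> x \<in> carrier (QX n) \<and> (\<forall>p\<in>P. x \<in> rat_extension n p)"
proof
  assume "x \<in> rat_extension n I"
  then show "x \<in> carrier (QX n) \<and> (\<forall>p\<in>P. x \<in> rat_extension n p)"
    using mem_rat_extension[OF integral_primeD(1)[OF ps]] mem_rat_extension[OF I(1), of x] I(2)
    unfolding has_multiple_in_def by blast
next
  assume x: "x \<in> carrier (QX n) \<and> (\<forall>p\<in>P. x \<in> rat_extension n p)"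
  then obtain D g where D: "D \<noteq> 0" "g \<in> polys n" "of_int D * x = rat_mpoly g"
    using clear_denominators unfolding has_multiple_in_def by blast
  have "g \<in> p" if "p \<in> P" for p
  proof -
    have "of_int D * x \<in> rat_extension n p"
      using mpoly_ideal(6)[OF rat_extension_ideal[OF integral_primeD(1)[OF ps[OF that]]]] x that polys_of_int
      by blast
    then show ?thesis using D integral_prime_contraction[OF ps[OF that] D(2)] by simp
  qed
  then have "g \<in> I" using I(2) D(2) by auto
  then show "x \<in> rat_extension n I" unfolding mem_rat_extension[OF I(1)] has_multiple_in_def using x D by blast
qed

section \<open>Power products of units\<close>

text \<open>
  Computing power products in the group of units makes the laws of abelian groups available.
\<close>

lemma (in cring) Units_int_pow:
  assumes u: "u \<in> Units R"
  shows "u [^]\<^bsub>R\<^esub> (k::int) = u [^]\<^bsub>units_of R\<^esub> k"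
proof -
  have pow: "u [^]\<^bsub>R\<^esub> (m::nat) \<in> Units R" for m
  proof (induction m)
    case (Suc m)
    show ?case unfolding nat_pow_Suc by (rule Units_m_closed[OF Suc u])
  qed (simp add: nat_pow_0)
  show ?thesis unfolding int_pow_def2 units_of_pow[OF u] units_of_inv[OF pow] ..
qed

context cring
begin

interpretation U: comm_group "units_of R"
  by (rule units_comm_group)

lemma Units_finprod:
  assumes "finite A" "\<And>i. i \<in> A \<Longrightarrow> f i \<in> Units R"
  shows "finprod R f A = finprod (units_of R) f A"
  using assms
proof (induction A)
  case (insert a A)
  then show ?case
    by (subst finprod_insert, (auto)[4], subst U.finprod_insert) (auto simp: units_of_carrier units_of_mult)
qed (simp add: units_of_one)

lemma nth_units_of: "set us \<subseteq> Units R \<Longrightarrow> i < length us \<Longrightarrow> us ! i \<in> carrier (units_of R)"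
  by (auto simp: units_of_carrier)

lemma power_product_units:
  assumes "set us \<subseteq> Units R"
  shows "power_product R us a = (\<Otimes>\<^bsub>units_of R\<^esub>i\<in>{..<length us}. (us ! i) [^]\<^bsub>units_of R\<^esub> a i)"
    and "power_product R us a \<in> Units R"
proof -
  note u = nth_units_of[OF assms, unfolded units_of_carrier]
  have pw: "us ! i [^]\<^bsub>R\<^esub> a i = us ! i [^]\<^bsub>units_of R\<^esub> a i" "us ! i [^]\<^bsub>units_of R\<^esub> a i \<in> Units R" if "i < length us" for i
    using Units_int_pow[OF u[OF that]] U.int_pow_closed[of "us ! i" "a i"] u[OF that] by (simp_all add: units_of_carrier)
  have "power_product R us a = (\<Otimes>\<^bsub>units_of R\<^esub>i\<in>{..<length us}. (us ! i) [^]\<^bsub>R\<^esub> a i)"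
    unfolding power_product_def by (rule Units_finprod) (use pw in auto)
  also have "\<dots> = (\<Otimes>\<^bsub>units_of R\<^esub>i\<in>{..<length us}. (us ! i) [^]\<^bsub>units_of R\<^esub> a i)"
    by (rule U.finprod_cong') (use pw in \<open>auto simp: units_of_carrier\<close>)
  finally show eq: "power_product R us a = (\<Otimes>\<^bsub>units_of R\<^esub>i\<in>{..<length us}. (us ! i) [^]\<^bsub>units_of R\<^esub> a i)" .
  show "power_product R us a \<in> Units R" unfolding eq
    using U.finprod_closed[of "\<lambda>i. (us ! i) [^]\<^bsub>units_of R\<^esub> a i" "{..<length us}"] pw
    by (auto simp: units_of_carrier)
qed

lemma power_product_cong:
  assumes "set us \<subseteq> Units R" "\<And>i. i < length us \<Longrightarrow> a i = b i"
  shows "power_product R us a = power_product R us b"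
proof -
  note u = nth_units_of[OF assms(1)]
  show ?thesis unfolding power_product_units(1)[OF assms(1)]
    by (rule U.finprod_cong') (use assms(2) u in auto)
qed

lemma power_product_add:
  assumes "set us \<subseteq> Units R"
  shows "power_product R us (\<lambda>i. a i + b i) = power_product R us a \<otimes> power_product R us b"
proof -
  note u = nth_units_of[OF assms(1)]
  have "(\<Otimes>\<^bsub>units_of R\<^esub>i\<in>{..<length us}. (us ! i) [^]\<^bsub>units_of R\<^esub> (a i + b i)) =
     (\<Otimes>\<^bsub>units_of R\<^esub>i\<in>{..<length us}. (us ! i) [^]\<^bsub>units_of R\<^esub> a i \<otimes>\<^bsub>units_of R\<^esub> (us ! i) [^]\<^bsub>units_of R\<^esub> b i)"
    by (rule U.finprod_cong') (use u in \<open>auto simp: U.int_pow_mult\<close>)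
  also have "\<dots> = (\<Otimes>\<^bsub>units_of R\<^esub>i\<in>{..<length us}. (us ! i) [^]\<^bsub>units_of R\<^esub> a i) \<otimes>\<^bsub>units_of R\<^esub>
     (\<Otimes>\<^bsub>units_of R\<^esub>i\<in>{..<length us}. (us ! i) [^]\<^bsub>units_of R\<^esub> b i)"
    by (rule U.finprod_multf) (use u in auto)
  finally show ?thesis unfolding power_product_units(1)[OF assms] by (simp add: units_of_mult)
qed

lemma power_product_zero:
  "power_product R us (\<lambda>_. 0) = \<one>"
  unfolding power_product_def by (simp add: int_pow_0)

lemma power_product_uminus:
  assumes "set us \<subseteq> Units R"
  shows "power_product R us (\<lambda>i. - a i) = inv (power_product R us a)"
proof -
  have "power_product R us (\<lambda>i. - a i) \<otimes> power_product R us a = \<one>"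
    using power_product_add[OF assms, of "\<lambda>i. - a i" a] power_product_zero by simp
  then show ?thesis using power_product_units(2)[OF assms] Units_closed
    by (metis inv_unique' m_comm)
qed

lemma power_product_single:
  assumes "set us \<subseteq> Units R" "i < length us"
  shows "power_product R us (\<lambda>j. if j = i then c else 0) = (us ! i) [^] c"
proof -
  note u = nth_units_of[OF assms(1)]
  have "(\<Otimes>\<^bsub>units_of R\<^esub>j\<in>{..<length us}. (us ! j) [^]\<^bsub>units_of R\<^esub> (if j = i then c else 0)) =
     (\<Otimes>\<^bsub>units_of R\<^esub>j\<in>{..<length us}. if i = j then (us ! j) [^]\<^bsub>units_of R\<^esub> c else \<one>\<^bsub>units_of R\<^esub>)"
    by (rule U.finprod_cong') (use u in auto)
  also have "\<dots> = (us ! i) [^]\<^bsub>units_of R\<^esub> c"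
    by (rule U.finprod_singleton) (use assms u in auto)
  finally show ?thesis using Units_int_pow[of "us ! i" c] u[OF assms(2)]
    by (simp add: power_product_units(1)[OF assms(1)] units_of_carrier)
qed

lemma power_product_append:
  assumes "set us \<subseteq> Units R" "set vs \<subseteq> Units R"
  shows "power_product R (us @ vs) a = power_product R us a \<otimes> power_product R vs (\<lambda>i. a (length us + i))"
proof -
  define g where "g i = ((us @ vs) ! i) [^]\<^bsub>units_of R\<^esub> a i" for i
  have all: "set (us @ vs) \<subseteq> Units R" using assms by auto
  have g: "g i \<in> carrier (units_of R)" if "i < length us + length vs" for i
    unfolding g_def using all nth_mem[of i "us @ vs"] that by (intro U.int_pow_closed) (auto simp: units_of_carrier)
  have gus: "(us ! i) [^]\<^bsub>units_of R\<^esub> a i \<in> carrier (units_of R)" if "i < length us" for i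
    using g[of i] that by (simp add: g_def nth_append)
  have gvs: "(vs ! i) [^]\<^bsub>units_of R\<^esub> a (length us + i) \<in> carrier (units_of R)" if "i < length vs" for i
    using g[of "length us + i"] that by (simp add: g_def nth_append)
  let ?A = "{..<length us}" and ?B = "(\<lambda>i. length us + i) ` {..<length vs}"
  have split: "{..<length (us @ vs)} = ?A \<union> ?B"
  proof -
    have "i \<in> ?B" if "i < length us + length vs" "\<not> i < length us" for i
      using that by (intro image_eqI[of _ _ "i - length us"]) auto
    then show ?thesis by auto
  qed
  have "power_product R (us @ vs) a = finprod (units_of R) g (?A \<union> ?B)"
    unfolding power_product_units(1)[OF all] g_def split ..
  also have "\<dots> = finprod (units_of R) g ?A \<otimes>\<^bsub>units_of R\<^esub> finprod (units_of R) g ?B"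
    by (rule U.finprod_Un_disjoint) (use g in auto)
  also have "finprod (units_of R) g ?A = power_product R us a"
    unfolding power_product_units(1)[OF assms(1)]
    by (rule U.finprod_cong') (use gus in \<open>auto simp: g_def nth_append\<close>)
  also have "finprod (units_of R) g ?B = finprod (units_of R) (\<lambda>i. g (length us + i)) {..<length vs}"
    by (rule U.finprod_reindex) (use g in auto)
  also have "\<dots> = power_product R vs (\<lambda>i. a (length us + i))"
    unfolding power_product_units(1)[OF assms(2)]
    by (rule U.finprod_cong') (use gvs in \<open>auto simp: g_def nth_append\<close>)
  finally show ?thesis by (simp add: units_of_mult)
qed

lemma generate_power_products:
  assumes "set us \<subseteq> Units R" "x \<in> generate (units_of R) (set us)"
  shows "\<exists>a. x = power_product R us a"
  using assms(2)
proof (induction rule: generate.induct)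
  case one
  show ?case using power_product_zero[of us] by (intro exI[of _ "\<lambda>_. 0"]) (simp add: units_of_one)
next
  case (incl h)
  then obtain i where i: "i < length us" "h = us ! i" by (auto simp: in_set_conv_nth)
  then have hU: "h \<in> Units R" using assms(1) by auto
  have "h = power_product R us (\<lambda>j. if j = i then 1 else 0)"
    using power_product_single[OF assms(1) i(1), of 1] i Units_closed[OF hU]
    by (simp add: int_pow_def2)
  then show ?case by blast
next
  case (inv h)
  then obtain i where i: "i < length us" "h = us ! i" by (auto simp: in_set_conv_nth)
  then have hU: "h \<in> Units R" using assms(1) by auto
  have "inv\<^bsub>units_of R\<^esub> h = power_product R us (\<lambda>j. - (if j = i then 1 else 0))"
    using power_product_single[OF assms(1) i(1), of 1] i(2) Units_closed[OF hU]
    unfolding units_of_inv[OF hU] power_product_uminus[OF assms(1)] by (simp add: int_pow_def2)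
  then show ?case by blast
next
  case (eng h1 h2)
  then show ?case using power_product_add[OF assms(1)] by (metis units_of_mult)
qed

end

lemma ring_hom_units:
  assumes "cring R" "cring S" "\<phi> \<in> ring_hom R S" "u \<in> Units R"
  shows "\<phi> u \<in> Units S" "\<phi> (inv\<^bsub>R\<^esub> u) = inv\<^bsub>S\<^esub> (\<phi> u)"
proof -
  interpret R: cring R by fact
  interpret S: cring S by fact
  have c: "\<phi> u \<in> carrier S" "\<phi> (inv\<^bsub>R\<^esub> u) \<in> carrier S"
    using ring_hom_closed[OF assms(3)] assms(4) by auto
  have "\<phi> u \<otimes>\<^bsub>S\<^esub> \<phi> (inv\<^bsub>R\<^esub> u) = \<phi> (u \<otimes>\<^bsub>R\<^esub> inv\<^bsub>R\<^esub> u)"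
    using ring_hom_mult[OF assms(3)] assms(4) by (metis R.Units_closed R.Units_inv_closed)
  then have e: "\<phi> u \<otimes>\<^bsub>S\<^esub> \<phi> (inv\<^bsub>R\<^esub> u) = \<one>\<^bsub>S\<^esub>"
    using ring_hom_one[OF assms(3)] R.Units_r_inv[OF assms(4)] by simp
  moreover from e have "\<phi> (inv\<^bsub>R\<^esub> u) \<otimes>\<^bsub>S\<^esub> \<phi> u = \<one>\<^bsub>S\<^esub>" using S.m_comm[OF c] by simp
  ultimately show "\<phi> u \<in> Units S" using c unfolding Units_def by blast
  show "\<phi> (inv\<^bsub>R\<^esub> u) = inv\<^bsub>S\<^esub> (\<phi> u)" using c e S.comm_inv_char by metis
qed

lemma ring_hom_power_product:
  assumes R: "cring R" and S: "cring S" and \<phi>: "\<phi> \<in> ring_hom R S" and us: "set us \<subseteq> Units R"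
  shows "\<phi> (power_product R us a) = power_product S (map \<phi> us) a"
proof -
  interpret R: cring R by fact
  interpret S: cring S by fact
  interpret UR: comm_group "units_of R" by (rule R.units_comm_group)
  interpret US: comm_group "units_of S" by (rule S.units_comm_group)
  have hom: "\<phi> \<in> hom (units_of R) (units_of S)"
    unfolding hom_def using ring_hom_units(1)[OF R S \<phi>] ring_hom_mult[OF \<phi>]
    by (auto simp: units_of_carrier units_of_mult)
  interpret h: group_hom "units_of R" "units_of S" \<phi>
    by unfold_locales (rule hom)
  have us': "set (map \<phi> us) \<subseteq> Units S" using ring_hom_units(1)[OF R S \<phi>] us by auto
  note u = R.nth_units_of[OF us]
  have "\<phi> (finprod (units_of R) (\<lambda>i. (us ! i) [^]\<^bsub>units_of R\<^esub> a i) A) =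
     finprod (units_of S) (\<lambda>i. (map \<phi> us ! i) [^]\<^bsub>units_of S\<^esub> a i) A" if "finite A" "A \<subseteq> {..<length us}" for A
    using that
  proof (induction A)
    case (insert i A)
    then have i: "i < length us" and A: "A \<subseteq> {..<length us}" by auto
    have c: "(\<lambda>i. (us ! i) [^]\<^bsub>units_of R\<^esub> a i) \<in> A \<rightarrow> carrier (units_of R)" using A u by auto
    have d: "(\<lambda>i. (map \<phi> us ! i) [^]\<^bsub>units_of S\<^esub> a i) \<in> A \<rightarrow> carrier (units_of S)"
      using A u h.hom_closed by (auto intro!: US.int_pow_closed)
    have "\<phi> ((us ! i) [^]\<^bsub>units_of R\<^esub> a i) = (map \<phi> us ! i) [^]\<^bsub>units_of S\<^esub> a i"
      using h.hom_int_pow[of "us ! i" "a i"] i u by simp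
    moreover have "(map \<phi> us ! i) [^]\<^bsub>units_of S\<^esub> a i \<in> carrier (units_of S)"
      using u[OF i] i h.hom_closed by (auto intro!: US.int_pow_closed)
    ultimately show ?case
      using UR.finprod_insert[OF insert(1,2) c] US.finprod_insert[OF insert(1,2) d] insert.IH[OF A]
        u[OF i] UR.finprod_closed[OF c] by simp
  qed simp
  from this[of "{..<length us}"] show ?thesis
    unfolding R.power_product_units(1)[OF us] S.power_product_units(1)[OF us'] by simp
qed

lemma power_product_inv:
  assumes R: "cring R" and us: "set us \<subseteq> Units R"
  shows "power_product R (map (\<lambda>u. inv\<^bsub>R\<^esub> u) us) a = inv\<^bsub>R\<^esub> (power_product R us a)"
proof -
  interpret R: cring R by fact
  interpret U: comm_group "units_of R" by (rule R.units_comm_group)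
  have us': "set (map (\<lambda>u. inv\<^bsub>R\<^esub> u) us) \<subseteq> Units R" using us by auto
  note u = R.nth_units_of[OF us]
  have "power_product R (map (\<lambda>u. inv\<^bsub>R\<^esub> u) us) a = power_product R us (\<lambda>i. - a i)"
    unfolding R.power_product_units(1)[OF us] R.power_product_units(1)[OF us'] length_map
  proof (rule U.finprod_cong')
    fix i assume "i \<in> {..<length us}"
    then have i: "i < length us" by simp
    have "inv\<^bsub>R\<^esub> (us ! i) = inv\<^bsub>units_of R\<^esub> (us ! i)"
      using R.units_of_inv[of "us ! i"] u[OF i] by (simp add: units_of_carrier)
    then show "map (\<lambda>u. inv\<^bsub>R\<^esub> u) us ! i [^]\<^bsub>units_of R\<^esub> a i = us ! i [^]\<^bsub>units_of R\<^esub> - a i"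
      using i u[OF i] by (simp add: U.int_pow_inv U.int_pow_neg)
  qed (use u in auto)
  then show ?thesis using R.power_product_uminus[OF us] by simp
qed

section \<open>Lattices of exponents\<close>

lemma int_vectors_simps:
  "carrier (int_vectors N) = (\<Pi>\<^sub>E i\<in>{..<N}. UNIV)"
  "a \<otimes>\<^bsub>int_vectors N\<^esub> b = (\<lambda>i\<in>{..<N}. a i + b i)"
  "\<one>\<^bsub>int_vectors N\<^esub> = (\<lambda>i\<in>{..<N}. 0)"
  by (simp_all add: int_vectors_def)

lemma int_vectors_comm_group: "comm_group (int_vectors N)"
proof -
  interpret group "int_vectors N" unfolding int_vectors_def by simp
  show ?thesis by (rule group_comm_groupI) (auto simp: int_vectors_simps add.commute)
qed

lemma int_vectors_inv:
  assumes "a \<in> carrier (int_vectors N)"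
  shows "inv\<^bsub>int_vectors N\<^esub> a = (\<lambda>i\<in>{..<N}. - a i)"
proof -
  interpret comm_group "int_vectors N" by (rule int_vectors_comm_group)
  show ?thesis
  proof (rule inv_equality)
    show "(\<lambda>i\<in>{..<N}. - a i) \<otimes>\<^bsub>int_vectors N\<^esub> a = \<one>\<^bsub>int_vectors N\<^esub>"
      by (rule ext) (simp add: int_vectors_simps restrict_def)
    show "(\<lambda>i\<in>{..<N}. - a i) \<in> carrier (int_vectors N)" by (simp add: int_vectors_simps)
  qed (rule assms)
qed

lemma int_vectors_generated:
  "\<exists>S. finite S \<and> S \<subseteq> carrier (int_vectors N) \<and> generate (int_vectors N) S = carrier (int_vectors N)"
proof -
  interpret G: comm_group "int_vectors N" by (rule int_vectors_comm_group)
  define e where "e k c = (\<lambda>i\<in>{..<N}. if i = k then c else (0::int))" for k c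
  define S where "S = (\<lambda>k. e k 1) ` {..<N}"
  have ec: "e k c \<in> carrier (int_vectors N)" for k c by (auto simp: e_def int_vectors_simps)
  then have S: "S \<subseteq> carrier (int_vectors N)" by (auto simp: S_def)
  interpret gen: subgroup "generate (int_vectors N) S" "int_vectors N" by (rule G.generate_is_subgroup[OF S])
  have e: "e k c \<in> generate (int_vectors N) S" if "k < N" for k c
  proof (induction c rule: int_induct[where k = 0])
    case base
    have "e k 0 = \<one>\<^bsub>int_vectors N\<^esub>" by (auto simp: e_def int_vectors_simps)
    then show ?case using gen.one_closed by simp
  next
    case (step1 c)
    have 1: "e k 1 \<in> generate (int_vectors N) S" using that by (auto simp: S_def intro: generate.incl)
    have "e k (c + 1) = e k c \<otimes>\<^bsub>int_vectors N\<^esub> e k 1" by (auto simp: e_def int_vectors_simps)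
    then show ?case using gen.m_closed[OF step1(2) 1] by simp
  next
    case (step2 c)
    have 1: "e k 1 \<in> generate (int_vectors N) S" using that by (auto simp: S_def intro: generate.incl)
    have "e k (c - 1) = e k c \<otimes>\<^bsub>int_vectors N\<^esub> inv\<^bsub>int_vectors N\<^esub> e k 1"
      by (subst int_vectors_inv[OF ec]) (auto simp: e_def int_vectors_simps)
    then show ?case using gen.m_closed[OF step2(2) gen.m_inv_closed[OF 1]] by simp
  qed
  have "(\<lambda>i\<in>{..<N}. if i < k then a i else 0) \<in> generate (int_vectors N) S" if "k \<le> N" for k and a :: "nat \<Rightarrow> int"
    using that
  proof (induction k)
    case 0
    have "(\<lambda>i\<in>{..<N}. if i < 0 then a i else 0) = \<one>\<^bsub>int_vectors N\<^esub>"
      by (rule ext) (simp add: int_vectors_simps restrict_def)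
    then show ?case using gen.one_closed by metis
  next
    case (Suc k)
    have "(\<lambda>i\<in>{..<N}. if i < Suc k then a i else 0) =
      (\<lambda>i\<in>{..<N}. if i < k then a i else 0) \<otimes>\<^bsub>int_vectors N\<^esub> e k (a k)"
      by (auto simp: e_def int_vectors_simps)
    moreover have "\<dots> \<in> generate (int_vectors N) S"
      by (rule gen.m_closed[OF Suc.IH e]) (use Suc.prems in simp_all)
    ultimately show ?case by metis
  qed
  from this[OF order_refl] have "a \<in> generate (int_vectors N) S" if "a \<in> carrier (int_vectors N)" for a
  proof -
    have "a = (\<lambda>i\<in>{..<N}. if i < N then a i else 0)"
      using that by (auto simp: int_vectors_simps PiE_def extensional_def)
    then show ?thesis using \<open>\<And>a. (\<lambda>i\<in>{..<N}. if i < N then a i else 0) \<in> generate (int_vectors N) S\<close>[of a] by simp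
  qed
  then have "generate (int_vectors N) S = carrier (int_vectors N)" using gen.subset by blast
  then show ?thesis using S by (intro exI[of _ S]) (auto simp: S_def)
qed

lemma (in cring) power_product_int_vectors:
  assumes us: "set us \<subseteq> Units R" and N: "d + length us \<le> N"
  shows "power_product R us (\<lambda>i. \<one>\<^bsub>int_vectors N\<^esub> (d + i)) = \<one>"
    and "power_product R us (\<lambda>i. (a \<otimes>\<^bsub>int_vectors N\<^esub> b) (d + i)) =
      power_product R us (\<lambda>i. a (d + i)) \<otimes> power_product R us (\<lambda>i. b (d + i))"
    and "a \<in> carrier (int_vectors N) \<Longrightarrow>
      power_product R us (\<lambda>i. (inv\<^bsub>int_vectors N\<^esub> a) (d + i)) = inv (power_product R us (\<lambda>i. a (d + i)))"
proof -
  show "power_product R us (\<lambda>i. \<one>\<^bsub>int_vectors N\<^esub> (d + i)) = \<one>"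
    unfolding power_product_zero[of us, symmetric]
    by (rule power_product_cong[OF us]) (use N in \<open>simp add: int_vectors_simps\<close>)
  show "power_product R us (\<lambda>i. (a \<otimes>\<^bsub>int_vectors N\<^esub> b) (d + i)) =
      power_product R us (\<lambda>i. a (d + i)) \<otimes> power_product R us (\<lambda>i. b (d + i))"
    unfolding power_product_add[OF us, symmetric]
    by (rule power_product_cong[OF us]) (use N in \<open>simp add: int_vectors_simps\<close>)
  assume a: "a \<in> carrier (int_vectors N)"
  show "power_product R us (\<lambda>i. (inv\<^bsub>int_vectors N\<^esub> a) (d + i)) = inv (power_product R us (\<lambda>i. a (d + i)))"
    unfolding power_product_uminus[OF us, symmetric] int_vectors_inv[OF a]
    by (rule power_product_cong[OF us]) (use N in simp)
qed

lemma exponent_lattice_subgroup: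
  assumes R: "cring R" and us: "set us \<subseteq> Units R"
  shows "subgroup (exponent_lattice R us) (int_vectors (length us))"
proof -
  interpret R: cring R by fact
  interpret G: comm_group "int_vectors (length us)" by (rule int_vectors_comm_group)
  note pp = R.power_product_int_vectors[OF us, of 0 "length us", simplified]
  show ?thesis
  proof (rule G.subgroupI)
    show "exponent_lattice R us \<subseteq> carrier (int_vectors (length us))" by (auto simp: exponent_lattice_def)
    show "exponent_lattice R us \<noteq> {}" using pp(1) G.one_closed by (auto simp: exponent_lattice_def)
    show "inv\<^bsub>int_vectors (length us)\<^esub> a \<in> exponent_lattice R us" if "a \<in> exponent_lattice R us" for a
      using that pp(3)[of a] G.inv_closed[of a] by (auto simp: exponent_lattice_def)
    show "a \<otimes>\<^bsub>int_vectors (length us)\<^esub> b \<in> exponent_lattice R us"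
      if "a \<in> exponent_lattice R us" "b \<in> exponent_lattice R us" for a b
      using that pp(2)[of a b] G.m_closed[of a b] by (auto simp: exponent_lattice_def)
  qed
qed

lemma exponent_lattice_fin_gen:
  assumes R: "cring R" and us: "set us \<subseteq> Units R"
  shows "fin_gen (int_vectors (length us)) (exponent_lattice R us)"
proof -
  obtain S where S: "finite S" "S \<subseteq> carrier (int_vectors (length us))"
    "generate (int_vectors (length us)) S = carrier (int_vectors (length us))"
    using int_vectors_generated by blast
  show ?thesis
    by (rule comm_group.subgroup_fin_gen[OF int_vectors_comm_group S(1,2) exponent_lattice_subgroup[OF assms]])
      (auto simp: S(3) exponent_lattice_def)
qed

section \<open>Units modulo an intersection of two ideals\<close>

lemma coset_unit_iff:
  assumes I: "ideal I (mpoly_ring n)" and f: "f \<in> polys n"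
  shows "coset n I f \<in> Units (mpoly_ring n Quot I) \<longleftrightarrow> (\<exists>g\<in>polys n. f * g - 1 \<in> I)"
proof
  interpret Q: cring "mpoly_ring n Quot I" by (rule quotient_cring[OF I])
  assume u: "coset n I f \<in> Units (mpoly_ring n Quot I)"
  obtain g where g: "g \<in> polys n"
    "inv\<^bsub>mpoly_ring n Quot I\<^esub> (coset n I f) = coset n I g"
    using coset_cases[OF Q.Units_inv_closed[OF u]] by blast
  have "coset n I (f * g) = coset n I 1"
    using Q.Units_r_inv[OF u] coset_mult[OF I f g(1)] by (simp add: g(2) coset_one)
  then show "\<exists>g\<in>polys n. f * g - 1 \<in> I"
    using coset_eq_iff[OF I polys_mult[OF f g(1)] polys_one] g(1) by blast
next
  interpret Q: cring "mpoly_ring n Quot I" by (rule quotient_cring[OF I])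
  assume "\<exists>g\<in>polys n. f * g - 1 \<in> I"
  then obtain g where g: "g \<in> polys n" "f * g - 1 \<in> I" by blast
  have "(coset n I f) \<otimes>\<^bsub>mpoly_ring n Quot I\<^esub> (coset n I g) = \<one>\<^bsub>mpoly_ring n Quot I\<^esub>"
    using coset_mult[OF I f g(1)] coset_eq_iff[OF I polys_mult[OF f g(1)] polys_one] g(2)
    by (simp add: coset_one)
  then show "coset n I f \<in> Units (mpoly_ring n Quot I)"
    using coset_carrier[OF I f f] coset_carrier[OF I g(1,1)] Q.m_comm unfolding Units_def by force
qed

lemma coset_unit_superset:
  assumes "ideal I (mpoly_ring n)" "ideal J (mpoly_ring n)" "I \<subseteq> J" "f \<in> polys n"
    and "coset n I f \<in> Units (mpoly_ring n Quot I)"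
  shows "coset n J f \<in> Units (mpoly_ring n Quot J)"
  using assms coset_unit_iff[OF assms(1,4)] coset_unit_iff[OF assms(2,4)] by blast

lemma coset_inv:
  assumes I: "ideal I (mpoly_ring n)" and f: "f \<in> polys n" and g: "g \<in> polys n"
    and "f * g - 1 \<in> I"
  shows "inv\<^bsub>mpoly_ring n Quot I\<^esub> (coset n I f) = coset n I g"
proof -
  interpret Q: cring "mpoly_ring n Quot I" by (rule quotient_cring[OF I])
  have "(coset n I f) \<otimes>\<^bsub>mpoly_ring n Quot I\<^esub> (coset n I g) = \<one>\<^bsub>mpoly_ring n Quot I\<^esub>"
    using coset_mult[OF I f g] coset_eq_iff[OF I polys_mult[OF f g] polys_one] assms(4)
    by (simp add: coset_one)
  then show ?thesis using coset_carrier[OF I f f] coset_carrier[OF I g g] Q.comm_inv_char by metis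
qed

text \<open>
  From \<open>f g = 1\<close> modulo \<open>I\<close> and \<open>f h = 1\<close> modulo \<open>J\<close> it follows that \<open>(1 - f g) (1 - f h)\<close> lies in \<open>I \<inter> J\<close>.
  Expanding it shows that \<open>g + h - f g h\<close> is an inverse of \<open>f\<close>.
\<close>

lemma coset_unit_Int:
  assumes I: "ideal I (mpoly_ring n)" and J: "ideal J (mpoly_ring n)" and K: "ideal (I \<inter> J) (mpoly_ring n)"
    and f: "f \<in> polys n"
    and u: "coset n I f \<in> Units (mpoly_ring n Quot I)"
    "coset n J f \<in> Units (mpoly_ring n Quot J)"
  shows "coset n (I \<inter> J) f \<in> Units (mpoly_ring n Quot (I \<inter> J))"
proof -
  obtain g where g: "g \<in> polys n" "f * g - 1 \<in> I"
    using u(1) coset_unit_iff[OF I f] by blast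
  obtain h where h: "h \<in> polys n" "f * h - 1 \<in> J"
    using u(2) coset_unit_iff[OF J f] by blast
  define k where "k = g + h - f * g * h"
  have kc: "k \<in> polys n" unfolding k_def by (intro polys_closed f g h)
  have "f * k - 1 = (1 - f * h) * (f * g - 1)" by (simp add: k_def algebra_simps)
  also have "\<dots> \<in> I" by (intro mpoly_ideal(6)[OF I g(2)] polys_closed f h)
  finally have 1: "f * k - 1 \<in> I" .
  have "f * k - 1 = (1 - f * g) * (f * h - 1)" by (simp add: k_def algebra_simps)
  also have "\<dots> \<in> J" by (intro mpoly_ideal(6)[OF J h(2)] polys_closed f g)
  finally have "f * k - 1 \<in> J" .
  then show ?thesis using 1 kc coset_unit_iff[OF K f] by blast
qed

text \<open>
  Power products are compatible with the projection from \<open>P/I\<close> to \<open>P/J\<close>, here the map \<open>\<phi>\<close>.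
\<close>

lemma coset_power_product_superset:
  assumes I: "ideal I (mpoly_ring n)" and J: "ideal J (mpoly_ring n)" and "I \<subseteq> J"
    and us: "set us \<subseteq> polys n" "coset n I ` set us \<subseteq> Units (mpoly_ring n Quot I)"
    and f: "f \<in> polys n"
    and e: "coset n I f = power_product (mpoly_ring n Quot I) (map (coset n I) us) a"
  shows "coset n J f = power_product (mpoly_ring n Quot J) (map (coset n J) us) a"
proof -
  let ?P = "mpoly_ring n :: 'a mpoly ring"
  define \<phi> where "\<phi> C = coset n J (SOME f. f \<in> carrier ?P \<and> C = coset n I f)" for C
  have \<phi>: "\<phi> (coset n I f) = coset n J f" if f: "f \<in> carrier ?P" for f
  proof -
    define g where "g = (SOME g. g \<in> carrier ?P \<and> coset n I f = coset n I g)"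
    have g: "g \<in> carrier ?P \<and> coset n I f = coset n I g"
      unfolding g_def by (rule someI[of _ f]) (use f in simp)
    then have "f - g \<in> J" using coset_eq_iff[OF I f, of g] assms(3) by auto
    then have "coset n J f = coset n J g" using coset_eq_iff[OF J f, of g] g by simp
    then show ?thesis unfolding \<phi>_def g_def[symmetric] by simp
  qed
  have "\<phi> \<in> ring_hom (?P Quot I) (?P Quot J)"
  proof (rule ring_hom_memI)
    fix C assume C: "C \<in> carrier (?P Quot I)"
    from coset_cases[OF C] obtain x where x: "x \<in> carrier ?P" "C = coset n I x" by blast
    show "\<phi> C \<in> carrier (?P Quot J)" using coset_carrier[OF J x(1,1)] \<phi> x by simp
    fix D assume D: "D \<in> carrier (?P Quot I)"
    from coset_cases[OF D] obtain y where y: "y \<in> carrier ?P" "D = coset n I y" by blast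
    show "\<phi> (C \<otimes>\<^bsub>?P Quot I\<^esub> D) = \<phi> C \<otimes>\<^bsub>?P Quot J\<^esub> \<phi> D"
      using x y by (simp add: coset_mult[OF I] coset_mult[OF J] \<phi> polys_mult)
    show "\<phi> (C \<oplus>\<^bsub>?P Quot I\<^esub> D) = \<phi> C \<oplus>\<^bsub>?P Quot J\<^esub> \<phi> D"
      using x y by (simp add: coset_add[OF I] coset_add[OF J] \<phi> polys_add)
  next
    show "\<phi> \<one>\<^bsub>?P Quot I\<^esub> = \<one>\<^bsub>?P Quot J\<^esub>" by (simp add: coset_one \<phi> polys_one)
  qed
  then have "\<phi> (power_product (?P Quot I) (map (coset n I) us) a) =
      power_product (?P Quot J) (map \<phi> (map (coset n I) us)) a"
    by (intro ring_hom_power_product quotient_cring I J) (use us in auto)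
  moreover have "map \<phi> (map (coset n I) us) = map (coset n J) us" using \<phi> us by auto
  ultimately show ?thesis using \<phi>[OF f] e by metis
qed

section \<open>The gluing step\<close>

lemma glue_ideal_iff:
  "f \<in> glue_ideal n ps j \<longleftrightarrow> (\<exists>a\<in>prefix_Inter n ps j. \<exists>b\<in>ps ! j. f = a + b)"
  unfolding glue_ideal_def set_add_def set_mult_def by (auto simp: polys_simps)

lemma polys_finsum:
  assumes "finite A" "\<And>i. i \<in> A \<Longrightarrow> f i \<in> polys n"
  shows "(\<Oplus>\<^bsub>mpoly_ring n\<^esub>i\<in>A. f i) = sum f A"
proof -
  interpret cring "mpoly_ring n" by (rule polys_cring)
  show ?thesis using assms
  proof (induction A)
    case (insert i A)
    then show ?case by (subst finsum_insert) (auto simp: polys_simps)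
  qed (simp add: polys_simps)
qed

locale prime_list =
  fixes n :: nat and ps :: "int mpoly set list"
  assumes prime: "\<And>p. p \<in> set ps \<Longrightarrow> integral_prime n p"
    and incomparable: "\<And>i j. i < length ps \<Longrightarrow> j < length ps \<Longrightarrow> i \<noteq> j \<Longrightarrow> \<not> ps ! i \<subseteq> ps ! j"
begin

lemma prime_nth: "i < length ps \<Longrightarrow> integral_prime n (ps ! i)"
  by (simp add: prime)

lemma ideal_nth: "i < length ps \<Longrightarrow> ideal (ps ! i) (ZX n)"
  by (rule integral_primeD(1)[OF prime_nth])

lemma prefix_Inter_Suc:
  assumes "j < length ps"
  shows "prefix_Inter n ps (Suc j) = prefix_Inter n ps j \<inter> ps ! j"
  using assms by (auto simp: prefix_Inter_def ideal_Inter_def take_Suc_conv_app_nth)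

lemma set_take_nth: "j \<le> length ps \<Longrightarrow> set (take j ps) = (!) ps ` {..<j}"
  by (simp add: nth_image lessThan_atLeast0)

lemma mem_prefix_Inter:
  assumes "j \<le> length ps"
  shows "f \<in> prefix_Inter n ps j \<longleftrightarrow> f \<in> polys n \<and> (\<forall>k<j. f \<in> ps ! k)"
  using set_take_nth[OF assms] by (auto simp: prefix_Inter_def ideal_Inter_def)

lemma prefix_Inter_ideal: "ideal (prefix_Inter n ps j) (ZX n)"
proof -
  have p: "ideal p (ZX n)" if "p \<in> set (take j ps)" for p
    using that integral_primeD(1)[OF prime] set_take_subset[of j ps] by auto
  show ?thesis unfolding prefix_Inter_def ideal_Inter_def
    by (rule mpoly_idealI)
      (auto simp: polys_closed mpoly_ideal_zero[OF p] mpoly_ideal_add[OF p] mpoly_ideal_mult[OF p])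
qed

lemma prefix_Inter_1: "ps \<noteq> [] \<Longrightarrow> prefix_Inter n ps 1 = ps ! 0"
  using mpoly_ideal(1)[OF ideal_nth[of 0]]
  by (auto simp: mem_prefix_Inter Suc_le_eq)

lemma glue_ideal_ideal:
  assumes "j < length ps"
  shows "ideal (glue_ideal n ps j) (ZX n)" "prefix_Inter n ps j \<subseteq> glue_ideal n ps j" "ps ! j \<subseteq> glue_ideal n ps j"
proof -
  note p = ideal_nth[OF assms]
  show "ideal (glue_ideal n ps j) (ZX n)"
    unfolding glue_ideal_def by (rule ring.add_ideals[OF polys_ring prefix_Inter_ideal p])
  show "prefix_Inter n ps j \<subseteq> glue_ideal n ps j" "ps ! j \<subseteq> glue_ideal n ps j"
    using mpoly_ideal_zero[OF p] mpoly_ideal_zero[OF prefix_Inter_ideal, of j]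
    by (force simp: glue_ideal_iff)+
qed

text \<open>
  Choose elements of the other primes outside \<open>\<pp>\<^sub>i\<close>. Their product divides a nonzero integer \<open>N\<close> modulo \<open>\<pp>\<^sub>i\<close>,
  so a multiple of it divided by \<open>N\<close> is \<open>1\<close> modulo \<open>\<pp>\<^sub>i\<close> and \<open>0\<close> modulo the other primes.
\<close>

lemma splitting_exists: "\<exists>q p. splitting n ps q p"
proof -
  have "\<exists>q. q \<in> ideal_Inter (QX n) {rat_extension n (ps ! j) | j. j < length ps \<and> j \<noteq> i} \<and>
      1 - q \<in> rat_extension n (ps ! i)" if i: "i < length ps" for i
  proof -
    note pi = integral_primeD[OF prime_nth[OF i]]
    define K where "K = {..<length ps} - {i}"
    have "\<forall>j\<in>K. \<exists>f. f \<in> ps ! j \<and> f \<notin> ps ! i"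
    proof
      fix j assume "j \<in> K"
      then show "\<exists>f. f \<in> ps ! j \<and> f \<notin> ps ! i" using incomparable[of j i] i by (auto simp: K_def)
    qed
    then obtain f where f: "\<And>j. j \<in> K \<Longrightarrow> f j \<in> ps ! j" "\<And>j. j \<in> K \<Longrightarrow> f j \<notin> ps ! i" by metis
    have fc: "f j \<in> polys n" if "j \<in> K" for j
      using mpoly_ideal(1)[OF ideal_nth f(1)] that by (auto simp: K_def)
    have "prod f A \<notin> ps ! i" if "finite A" "A \<subseteq> K" for A
      using that
    proof (induction A)
      case (insert a A)
      have "prod f A \<in> polys n" using insert fc by (intro polys_prod) auto
      then show ?case using insert pi(4)[of "f a" "prod f A"] f(2) fc by auto
    qed (simp add: pi(3))
    then have nin: "prod f K \<notin> ps ! i" by (simp add: K_def)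
    have Kc: "prod f K \<in> polys n" using fc by (intro polys_prod) auto
    obtain g and N :: int where g: "g \<in> polys n" "N \<noteq> 0" "prod f K * g - of_int N \<in> ps ! i"
      using integral_prime_inverse[OF prime_nth[OF i] Kc nin] by blast
    define q where "q = const (inverse (of_int N)) * rat_mpoly (g * prod f K)"
    have NN: "of_int N * const (inverse (of_int N)) = (1 :: rat mpoly)"
      using g(2) by (simp add: mult_single flip: single_of_int)
    have Nq: "of_int N * q = rat_mpoly (g * prod f K)"
      unfolding q_def mult.assoc[symmetric] NN by simp
    have gc: "g * prod f K \<in> polys n" by (intro polys_closed g Kc)
    have qc: "q \<in> carrier (QX n)" unfolding q_def
      using gc by (intro polys_mult polys_const) (simp add: rat_mpoly_carrier)
    have "q \<in> rat_extension n (ps ! j)" if "j < length ps" "j \<noteq> i" for j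
    proof -
      note pj = ideal_nth[OF that(1)]
      have jK: "j \<in> K" "finite K" using that by (auto simp: K_def)
      have "prod f K = prod f (K - {j}) * f j" using prod.remove[OF jK(2,1), of f] by (simp add: mult.commute)
      then have "g * prod f K = (g * prod f (K - {j})) * f j" by (simp add: mult.assoc)
      moreover have "g * prod f (K - {j}) \<in> polys n"
        using fc by (intro polys_mult g polys_prod) auto
      ultimately have "g * prod f K \<in> ps ! j" using mpoly_ideal(6)[OF pj f(1)[OF jK(1)]] by metis
      then show ?thesis unfolding mem_rat_extension[OF pj] has_multiple_in_def using Nq qc g(2) by blast
    qed
    moreover have "1 - q \<in> rat_extension n (ps ! i)"
    proof -
      have "of_int N * (1 - q) = rat_mpoly (- (prod f K * g - of_int N))"
        using Nq by (simp add: right_diff_distrib rat_mpoly.diff rat_mpoly.uminus rat_mpoly.of_int mult.commute)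
      moreover have "- (prod f K * g - of_int N) \<in> ps ! i" by (rule mpoly_ideal(4)[OF pi(1) g(3)])
      moreover have "1 - q \<in> carrier (QX n)" by (intro polys_closed qc)
      ultimately show ?thesis unfolding mem_rat_extension[OF pi(1)] has_multiple_in_def using g(2) by blast
    qed
    ultimately show ?thesis using qc by (intro exI[of _ q]) (auto simp: ideal_Inter_def)
  qed
  then have "\<forall>i. \<exists>q. i < length ps \<longrightarrow> q \<in> ideal_Inter (QX n) {rat_extension n (ps ! j) | j. j < length ps \<and> j \<noteq> i} \<and>
      1 - q \<in> rat_extension n (ps ! i)" by blast
  from choice[OF this] obtain q where q: "\<And>i. i < length ps \<Longrightarrow> q i \<in> ideal_Inter (QX n) {rat_extension n (ps ! j) | j. j < length ps \<and> j \<noteq> i} \<and>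
      1 - q i \<in> rat_extension n (ps ! i)" by blast
  have "splitting n ps q (\<lambda>i. 1 - q i)"
    unfolding splitting_def using q by (auto simp: polys_simps)
  then show ?thesis by blast
qed

lemma splittingD:
  assumes s: "splitting n ps q p" and i: "i < length ps"
  shows "q i \<in> carrier (QX n)" "k < length ps \<Longrightarrow> k \<noteq> i \<Longrightarrow> q i \<in> rat_extension n (ps ! k)"
    "q i - 1 \<in> rat_extension n (ps ! i)"
proof -
  have 1: "q i \<in> ideal_Inter (QX n) {rat_extension n (ps ! j) | j. j < length ps \<and> j \<noteq> i}"
    and 2: "p i \<in> rat_extension n (ps ! i)" "q i + p i = 1"
    using s i by (auto simp: splitting_def polys_simps)
  show "q i \<in> carrier (QX n)" "k < length ps \<Longrightarrow> k \<noteq> i \<Longrightarrow> q i \<in> rat_extension n (ps ! k)"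
    using 1 by (auto simp: ideal_Inter_def)
  have "q i - 1 = - p i" using 2(2) by (simp add: eq_neg_iff_add_eq_0 diff_add_eq flip: 2(2))
  then show "q i - 1 \<in> rat_extension n (ps ! i)"
    using mpoly_ideal(4)[OF rat_extension_ideal[OF ideal_nth[OF i]] 2(1)] by simp
qed

text \<open>
  Modulo \<open>\<pp>\<^sub>k\<close> with \<open>k < j\<close> the sum \<open>f = q\<^sub>0 + \<dots> + q\<^sub>j\<^sub>-\<^sub>1\<close> is \<open>1\<close> and \<open>q\<^sub>j\<close> is \<open>0\<close>; modulo \<open>\<pp>\<^sub>j\<close> it is the other
  way round. So \<open>f G + q\<^sub>j H\<close> is \<open>G\<close> modulo the former primes and \<open>H\<close> modulo the latter.
\<close>

lemma glues_iff:
  assumes s: "splitting n ps q p" and j: "j < length ps"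
    and G: "G \<in> polys n" and H: "H \<in> polys n"
  shows "glues n ps q j G H w \<longleftrightarrow> w \<in> polys n \<and> w - G \<in> prefix_Inter n ps j \<and> w - H \<in> ps ! j"
proof (cases "w \<in> polys n")
  case w: True
  note sp = splittingD[OF s]
  have qc: "q i \<in> carrier (QX n)" if "i \<le> j" for i using sp(1) that j by auto
  define f where "f = (\<Sum>i<j. q i)"
  define e where "e = f * rat_mpoly G + q j * rat_mpoly H"
  have fs: "(\<Oplus>\<^bsub>QX n\<^esub>i\<in>{..<j}. q i) = f" unfolding f_def by (rule polys_finsum) (auto simp: qc)
  have fc: "f \<in> carrier (QX n)" unfolding f_def by (rule polys_sum) (auto simp: qc)
  have Gc: "rat_mpoly G \<in> carrier (QX n)" "rat_mpoly H \<in> carrier (QX n)" "rat_mpoly w \<in> carrier (QX n)"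
    using G H w by (simp_all add: rat_mpoly_carrier)
  have ec: "e \<in> carrier (QX n)" unfolding e_def by (intro polys_closed fc Gc qc order_refl)
  have id: "ideal (rat_extension n (ps ! k)) (QX n)" if "k < length ps" for k
    by (rule rat_extension_ideal[OF ideal_nth[OF that]])
  note R = mpoly_ideal[OF id]
  have "glues n ps q j G H w \<longleftrightarrow> rat_mpoly w - e \<in> rat_extension n (prefix_Inter n ps (Suc j))"
    unfolding glues_def Let_def fs polys_simps e_def[symmetric]
    using w coset_eq_iff[OF rat_extension_ideal[OF prefix_Inter_ideal] Gc(3) ec] by simp
  also have "\<dots> \<longleftrightarrow> (\<forall>P\<in>set (take (Suc j) ps). rat_mpoly w - e \<in> rat_extension n P)"
    by (subst rat_extension_Inter[of "set (take (Suc j) ps)"])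
      (use prime set_take_subset[of "Suc j" ps] prefix_Inter_ideal polys_diff[OF Gc(3) ec] in
        \<open>auto simp: prefix_Inter_def ideal_Inter_def\<close>)
  also have "\<dots> \<longleftrightarrow> (\<forall>k<Suc j. rat_mpoly w - e \<in> rat_extension n (ps ! k))"
    using set_take_nth[of "Suc j"] j by auto
  also have "\<dots> \<longleftrightarrow> (\<forall>k<j. w - G \<in> ps ! k) \<and> w - H \<in> ps ! j"
  proof -
    have contract: "rat_mpoly w - e \<in> rat_extension n (ps ! k) \<longleftrightarrow> w - K \<in> ps ! k"
      if k: "k < length ps" and K: "K \<in> polys n" and eK: "e - rat_mpoly K \<in> rat_extension n (ps ! k)" for k K
    proof -
      have "rat_mpoly w - e \<in> rat_extension n (ps ! k) \<longleftrightarrow> rat_mpoly (w - K) \<in> rat_extension n (ps ! k)"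
        using R(3)[OF k _ eK, of "rat_mpoly w - e"] R(5)[OF k _ eK, of "rat_mpoly (w - K)"]
        by (auto simp: rat_mpoly.diff)
      then show ?thesis using integral_prime_contraction[OF prime_nth[OF k] polys_diff[OF w K]] by simp
    qed
    have others: "(\<Sum>i\<in>A. q i) \<in> rat_extension n (ps ! k)"
      if "finite A" "A \<subseteq> {..<j} - {k}" "k < length ps" for A k
      using that
    proof (induction A)
      case (insert i A)
      then show ?case using R(3)[OF _ sp(2)[of i k]] j by auto
    qed (simp add: R(2))
    have "e - rat_mpoly G \<in> rat_extension n (ps ! k)" if k: "k < j" for k
    proof -
      have kl: "k < length ps" using k j by simp
      have f1: "f - 1 = (q k - 1) + (\<Sum>i\<in>{..<j} - {k}. q i)"
        unfolding f_def using k by (subst sum.remove[of _ k]) auto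
      have "f - 1 \<in> rat_extension n (ps ! k)"
        unfolding f1 by (intro R(3)[OF kl sp(3)[OF kl]] others kl) auto
      moreover have "q j \<in> rat_extension n (ps ! k)" using sp(2)[OF j kl] k by simp
      moreover have "e - rat_mpoly G = rat_mpoly G * (f - 1) + rat_mpoly H * q j"
        by (simp add: e_def algebra_simps)
      ultimately show ?thesis using R(3)[OF kl R(6)[OF kl] R(6)[OF kl]] Gc by metis
    qed
    moreover have "e - rat_mpoly H \<in> rat_extension n (ps ! j)"
    proof -
      have "f \<in> rat_extension n (ps ! j)" unfolding f_def by (rule others) (use j in auto)
      moreover have "e - rat_mpoly H = rat_mpoly G * f + rat_mpoly H * (q j - 1)"
        by (simp add: e_def algebra_simps)
      ultimately show ?thesis using R(3)[OF j R(6)[OF j] R(6)[OF j]] sp(3)[OF j] Gc by metis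
    qed
    ultimately show ?thesis using contract[OF _ G] contract[OF j H] j by (auto simp: less_Suc_eq)
  qed
  finally show ?thesis using polys_diff[OF w G] j w by (simp add: mem_prefix_Inter)
qed (simp add: glues_def)

lemma unit_generatorsD:
  assumes "unit_generators (ZX n) K U"
  shows "finite U" "U \<subseteq> polys n" "coset n K ` U \<subseteq> Units (ZX n Quot K)"
    "generate (units_of (ZX n Quot K)) (coset n K ` U) = Units (ZX n Quot K)"
  using assms by (auto simp: unit_generators_def)

text \<open>
  The lattice of the \<open>g\<close> and the inverses of the \<open>h\<close> describes which power products \<open>G\<close> and \<open>H\<close> agree in
  \<open>P/J\<close>: their quotient is the power product of the combined list.
\<close>

lemma glue_units:
  assumes j: "j < length ps" and gs: "set gs \<subseteq> polys n" and hs: "set hs \<subseteq> polys n"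
    and gsU: "coset n (prefix_Inter n ps j) ` set gs \<subseteq> Units (ZX n Quot (prefix_Inter n ps j))"
    and hsU: "coset n (ps ! j) ` set hs \<subseteq> Units (ZX n Quot (ps ! j))"
    and J: "J = glue_ideal n ps j"
    and us: "us = map (\<lambda>g. coset n J g) gs @ map (\<lambda>h. inv\<^bsub>ZX n Quot J\<^esub> (coset n J h)) hs"
  shows "set us \<subseteq> Units (ZX n Quot J)"
    and "represents_product n (prefix_Inter n ps j) gs a G \<Longrightarrow>
      represents_product n (ps ! j) hs (\<lambda>i. a (length gs + i)) H \<Longrightarrow>
      power_product (ZX n Quot J) us a = \<one>\<^bsub>ZX n Quot J\<^esub> \<longleftrightarrow> G - H \<in> J"
proof -
  note A = prefix_Inter_ideal[of j]
  note P = ideal_nth[OF j]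
  note JI = glue_ideal_ideal[OF j, folded J]
  define Q where "Q = ZX n Quot J"
  interpret Q: cring Q unfolding Q_def by (rule quotient_cring[OF JI(1)])
  define gs' where "gs' = map (\<lambda>g. coset n J g) gs"
  define hs' where "hs' = map (\<lambda>h. coset n J h) hs"
  have g: "set gs' \<subseteq> Units Q"
    using coset_unit_superset[OF A JI(1,2)] gs gsU by (auto simp: gs'_def Q_def)
  have h: "set hs' \<subseteq> Units Q"
    using coset_unit_superset[OF P JI(1,3)] hs hsU by (auto simp: hs'_def Q_def)
  have us': "us = gs' @ map (\<lambda>u. inv\<^bsub>Q\<^esub> u) hs'" by (simp add: us gs'_def hs'_def Q_def)
  have hi: "set (map (\<lambda>u. inv\<^bsub>Q\<^esub> u) hs') \<subseteq> Units Q" using h by auto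
  show "set us \<subseteq> Units (ZX n Quot J)" using g hi by (auto simp: us' simp flip: Q_def)
  assume G: "represents_product n (prefix_Inter n ps j) gs a G"
    and H: "represents_product n (ps ! j) hs (\<lambda>i. a (length gs + i)) H"
  have Gc: "G \<in> polys n" "H \<in> polys n" using G H by (simp_all add: represents_product_def)
  have 1: "coset n J G = power_product Q gs' a"
    unfolding Q_def gs'_def by (rule coset_power_product_superset[OF A JI(1,2) gs gsU Gc(1)])
      (use G in \<open>simp add: represents_product_def\<close>)
  have 2: "coset n J H = power_product Q hs' (\<lambda>i. a (length gs + i))"
    unfolding Q_def hs'_def by (rule coset_power_product_superset[OF P JI(1,3) hs hsU Gc(2)])
      (use H in \<open>simp add: represents_product_def\<close>)
  have uG: "coset n J G \<in> Units Q" "coset n J H \<in> Units Q"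
    unfolding 1 2 using Q.power_product_units(2) g h by auto
  have len: "length gs' = length gs" by (simp add: gs'_def)
  have "power_product Q us a = (coset n J G) \<otimes>\<^bsub>Q\<^esub> inv\<^bsub>Q\<^esub> (coset n J H)"
    unfolding us' Q.power_product_append[OF g hi] power_product_inv[OF Q.is_cring h] len 1 2 ..
  moreover have "(coset n J G) \<otimes>\<^bsub>Q\<^esub> inv\<^bsub>Q\<^esub> (coset n J H) = \<one>\<^bsub>Q\<^esub> \<longleftrightarrow> coset n J G = coset n J H"
  proof -
    interpret U: comm_group "units_of Q" by (rule Q.units_comm_group)
    have "x \<otimes>\<^bsub>Q\<^esub> inv\<^bsub>Q\<^esub> y = \<one>\<^bsub>Q\<^esub> \<longleftrightarrow> x = y" if "x \<in> Units Q" "y \<in> Units Q" for x y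
      using U.inv_solve_right[of "\<one>\<^bsub>Q\<^esub>" x y] that Q.units_of_inv[OF that(2)] Q.Units_closed
      by (auto simp: units_of_carrier units_of_mult)
    then show ?thesis using uG by blast
  qed
  ultimately show "power_product (ZX n Quot J) us a = \<one>\<^bsub>ZX n Quot J\<^esub> \<longleftrightarrow> G - H \<in> J"
    using coset_eq_iff[OF JI(1) Gc] by (simp add: Q_def)
qed

lemma represents_product_exists:
  assumes I: "ideal I (ZX n)" and us: "coset n I ` set us \<subseteq> Units (ZX n Quot I)"
  shows "\<exists>x. represents_product n I us a x"
proof -
  interpret Q: cring "ZX n Quot I" by (rule quotient_cring[OF I])
  have "power_product (ZX n Quot I) (map (coset n I) us) a \<in> carrier (ZX n Quot I)"
    by (rule Q.Units_closed[OF Q.power_product_units(2)]) (use us in auto)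
  from coset_cases[OF this] show ?thesis unfolding represents_product_def by fastforce
qed

text \<open>
  The expression to be represented has an integral representative: if \<open>G - H = a + d\<close> with \<open>a\<close> in the
  intersection of the earlier primes and \<open>d \<in> \<pp>\<^sub>j\<close>, then \<open>G - a = H + d\<close> is one by \<open>glues_iff\<close>.
\<close>

lemma iteration_is_possible:
  assumes s: "splitting n ps q p" and j: "j < length ps"
    and U: "unit_generators (ZX n) (prefix_Inter n ps j) U"
  shows "iteration_possible n ps q j U"
proof -
  define A where "A = prefix_Inter n ps j"
  define J where "J = glue_ideal n ps j"
  note AI = prefix_Inter_ideal[of j, folded A_def]
  note JI = glue_ideal_ideal[OF j, folded J_def A_def]
  note P = ideal_nth[OF j]
  note U' = unit_generatorsD[OF U, folded A_def]
  have ex_hs: "\<exists>hs. unit_generators (ZX n) (ps ! j) (set hs)"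
  proof -
    obtain V where V: "unit_generators (ZX n) (ps ! j) V" using unit_generators_exist[OF prime_nth[OF j]] by blast
    then obtain hs where "set hs = V" using finite_list[OF unit_generatorsD(1)[OF V]] by blast
    then show ?thesis using V by blast
  qed
  have main: "(\<forall>h \<in> set hs. coset n J h \<in> Units (ZX n Quot J)) \<and>
         (\<exists>B. lattice_generators n J gs hs B) \<and>
         (\<forall>B b. lattice_generators n J gs hs B \<and> b \<in> B \<longrightarrow>
            (\<exists>G. represents_product n A gs b G) \<and>
            (\<exists>H. represents_product n (ps ! j) hs (\<lambda>i. b (length gs + i)) H) \<and>
            (\<forall>G H. represents_product n A gs b G \<and>
                   represents_product n (ps ! j) hs (\<lambda>i. b (length gs + i)) H \<longrightarrow>
               (\<exists>w. glues n ps q j G H w)))"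
    if gs: "set gs = U" and hs: "unit_generators (ZX n) (ps ! j) (set hs)" for gs hs
  proof (intro conjI ballI allI impI)
    note hs' = unit_generatorsD[OF hs]
    define us where "us = map (\<lambda>g. coset n J g) gs @ map (\<lambda>h. inv\<^bsub>ZX n Quot J\<^esub> (coset n J h)) hs"
    have gsc: "set gs \<subseteq> polys n" "coset n A ` set gs \<subseteq> Units (ZX n Quot A)"
      using U' gs by auto
    note glue = glue_units[OF j gsc(1) hs'(2) gsc(2)[unfolded A_def] hs'(3) J_def us_def, folded A_def]
    show "coset n J h \<in> Units (ZX n Quot J)" if "h \<in> set hs" for h
      using coset_unit_superset[OF P JI(1,3)] hs' that by auto
    have len: "length us = length gs + length hs" by (simp add: us_def)
    show "\<exists>B. lattice_generators n J gs hs B"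
      using exponent_lattice_fin_gen[OF quotient_cring[OF JI(1)] glue(1)]
      unfolding lattice_generators_def fin_gen_def len us_def[symmetric]
      by (auto simp: exponent_lattice_def len)
    fix B b assume Bb: "lattice_generators n J gs hs B \<and> b \<in> B"
    show "\<exists>G. represents_product n A gs b G" by (rule represents_product_exists[OF AI gsc(2)])
    show "\<exists>H. represents_product n (ps ! j) hs (\<lambda>i. b (length gs + i)) H"
      by (rule represents_product_exists[OF P hs'(3)])
    fix G H assume GH: "represents_product n A gs b G \<and>
                   represents_product n (ps ! j) hs (\<lambda>i. b (length gs + i)) H"
    then have c: "G \<in> polys n" "H \<in> polys n" by (auto simp: represents_product_def)
    have "b \<in> exponent_lattice (ZX n Quot J) us"
      using Bb generate.incl[of b B "int_vectors (length gs + length hs)"]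
      by (auto simp: lattice_generators_def us_def)
    then have "G - H \<in> J" using glue(2) GH by (auto simp: exponent_lattice_def)
    then obtain a d where ad: "a \<in> A" "d \<in> ps ! j" "G - H = a + d"
      unfolding J_def glue_ideal_iff A_def by blast
    have "glues n ps q j G H (G - a)"
      unfolding glues_iff[OF s j c]
    proof (intro conjI)
      show "G - a \<in> polys n" using c mpoly_ideal(1)[OF AI ad(1)] by (intro polys_diff)
      show "G - a - G \<in> prefix_Inter n ps j" using mpoly_ideal(4)[OF AI ad(1)] by (simp add: A_def)
      have "G - a - H = d" using ad(3) by (simp add: algebra_simps)
      then show "G - a - H \<in> ps ! j" using ad(2) by simp
    qed
    then show "\<exists>w. glues n ps q j G H w" by blast
  qed
  have "\<forall>g\<in>U. coset n A g \<in> Units (ZX n Quot A) \<and> coset n J g \<in> Units (ZX n Quot J)"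
    using coset_unit_superset[OF AI JI(1,2)] U' by blast
  then show ?thesis
    unfolding iteration_possible_def Let_def A_def[symmetric] J_def[symmetric]
    using U'(1,2) ex_hs main by blast
qed

text \<open>
  By \<open>lift\<close> in the proof, every exponent vector in the lattice, being a combination of \<open>B\<close>, belongs to an
  element generated by the \<open>w b\<close>. Conversely, a unit modulo \<open>A \<inter> \<pp>\<^sub>j\<close> is a power product of the \<open>g\<close> modulo \<open>A\<close>
  and one of the \<open>h\<close> modulo \<open>\<pp>\<^sub>j\<close>; the combined exponents lie in the lattice because both come from
  the same element.
\<close>

lemma glued_unit_generators:
  assumes s: "splitting n ps q p" and j: "j < length ps"
    and U: "unit_generators (ZX n) (prefix_Inter n ps j) U"
    and hs: "unit_generators (ZX n) (ps ! j) (set hs)" and gs: "set gs = U"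
    and B: "lattice_generators n (glue_ideal n ps j) gs hs B"
    and G: "\<And>b. b \<in> B \<Longrightarrow> represents_product n (prefix_Inter n ps j) gs b (G b)"
    and H: "\<And>b. b \<in> B \<Longrightarrow> represents_product n (ps ! j) hs (\<lambda>i. b (length gs + i)) (H b)"
    and w: "\<And>b. b \<in> B \<Longrightarrow> glues n ps q j (G b) (H b) (w b)"
  shows "unit_generators (ZX n) (prefix_Inter n ps (Suc j)) (w ` B)"
proof -
  define A where "A = prefix_Inter n ps j"
  define P where "P = ps ! j"
  define C where "C = A \<inter> P"
  define J where "J = glue_ideal n ps j"
  have C: "prefix_Inter n ps (Suc j) = C" using prefix_Inter_Suc[OF j] by (simp add: C_def A_def P_def)
  note AI = prefix_Inter_ideal[of j, folded A_def]
  note PI = integral_primeD(1)[OF prime_nth[OF j], folded P_def]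
  note CI = prefix_Inter_ideal[of "Suc j", unfolded C]
  note JI = glue_ideal_ideal[OF j, folded J_def A_def P_def]
  note U' = unit_generatorsD[OF U, folded A_def]
  note hs' = unit_generatorsD[OF hs, folded P_def]
  interpret QA: cring "ZX n Quot A" by (rule quotient_cring[OF AI])
  interpret QP: cring "ZX n Quot P" by (rule quotient_cring[OF PI])
  interpret QC: cring "ZX n Quot C" by (rule quotient_cring[OF CI])
  define us where "us = map (\<lambda>g. coset n J g) gs @ map (\<lambda>h. inv\<^bsub>ZX n Quot J\<^esub> (coset n J h)) hs"
  have gsc: "set gs \<subseteq> polys n" "coset n A ` set gs \<subseteq> Units (ZX n Quot A)"
    using U' gs by auto
  note glue = glue_units[OF j gsc(1) hs'(2) gsc(2)[unfolded A_def] hs'(3)[unfolded P_def] J_def us_def, folded A_def P_def]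
  define N where "N = length gs + length hs"
  have len: "length us = N" by (simp add: us_def N_def)
  have B': "finite B" "B \<subseteq> carrier (int_vectors N)"
    "generate (int_vectors N) B = exponent_lattice (ZX n Quot J) us"
    using B by (simp_all add: lattice_generators_def us_def N_def J_def)
  define gA where "gA = map (coset n A) gs"
  define hP where "hP = map (coset n P) hs"
  have gA: "set gA \<subseteq> Units (ZX n Quot A)" using gsc by (auto simp: gA_def)
  have hP: "set hP \<subseteq> Units (ZX n Quot P)" using hs' by (auto simp: hP_def)
  define PA where "PA a = power_product (ZX n Quot A) gA a" for a
  define PP where "PP a = power_product (ZX n Quot P) hP (\<lambda>i. a (length gs + i))" for a
  have rA: "represents_product n A gs a x \<longleftrightarrow> x \<in> polys n \<and> coset n A x = PA a" for a x
    by (simp add: represents_product_def PA_def gA_def)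
  have rP: "represents_product n P hs (\<lambda>i. a (length gs + i)) x \<longleftrightarrow> x \<in> polys n \<and> coset n P x = PP a" for a x
    by (simp add: represents_product_def PP_def hP_def)
  note PA_hom = QA.power_product_int_vectors[OF gA, of 0 N, simplified, folded PA_def]
  have PA_N: "length gA \<le> N" and PP_N: "length gs + length hP \<le> N" by (simp_all add: gA_def hP_def N_def)
  note PP_hom = QP.power_product_int_vectors[OF hP PP_N, folded PP_def]
  have wb: "w b \<in> polys n" "coset n A (w b) = PA b" "coset n P (w b) = PP b" if b: "b \<in> B" for b
  proof -
    have c: "G b \<in> polys n" "H b \<in> polys n"
      using G[OF b] H[OF b] by (simp_all add: represents_product_def)
    have g: "w b \<in> polys n" "w b - G b \<in> A" "w b - H b \<in> P"
      using w[OF b] glues_iff[OF s j c] by (simp_all add: A_def P_def)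
    show "w b \<in> polys n" by (rule g)
    show "coset n A (w b) = PA b" using coset_eq_iff[OF AI g(1) c(1)] g(2) G[OF b, folded A_def] rA by metis
    show "coset n P (w b) = PP b" using coset_eq_iff[OF PI g(1) c(2)] g(3) H[OF b, folded P_def] rP by metis
  qed
  have PAU: "PA a \<in> Units (ZX n Quot A)" and PPU: "PP a \<in> Units (ZX n Quot P)" for a
    unfolding PA_def PP_def by (rule QA.power_product_units(2)[OF gA], rule QP.power_product_units(2)[OF hP])
  have wU: "coset n C (w b) \<in> Units (ZX n Quot C)" if b: "b \<in> B" for b
    unfolding C_def by (rule coset_unit_Int[OF AI PI CI[unfolded C_def]]) (use wb[OF b] PAU PPU in auto)
  have sub: "coset n C ` w ` B \<subseteq> Units (ZX n Quot C)" using wU by auto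
  define Gen where "Gen = generate (units_of (ZX n Quot C)) (coset n C ` w ` B)"
  interpret UC: comm_group "units_of (ZX n Quot C)" by (rule QC.units_comm_group)
  have GenU: "Gen \<subseteq> Units (ZX n Quot C)"
    unfolding Gen_def using UC.generate_incl[of "coset n C ` w ` B"] sub by (simp add: units_of_carrier)
  have CA: "C \<subseteq> A" "C \<subseteq> P" by (auto simp: C_def)
  have lift: "\<exists>z\<in>polys n. coset n C z \<in> Gen \<and> coset n A z = PA a \<and> coset n P z = PP a"
    if "a \<in> generate (int_vectors N) B" for a
    using that
  proof (induction rule: generate.induct)
    case one
    have "coset n C 1 \<in> Gen" unfolding Gen_def
      using generate.one[of "units_of (ZX n Quot C)"] by (simp add: units_of_one coset_one)
    then show ?case using PA_hom(1)[OF PA_N] PP_hom(1) polys_one by (metis coset_one)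
  next
    case (incl b)
    then have "coset n C (w b) \<in> Gen" unfolding Gen_def by (intro generate.incl) auto
    then show ?case using wb[OF incl] by blast
  next
    case (inv b)
    have bc: "b \<in> carrier (int_vectors N)" using inv B' by auto
    obtain z where z: "z \<in> polys n" "w b * z - 1 \<in> C"
      using wU[OF inv] coset_unit_iff[OF CI wb(1)[OF inv]] by blast
    note zi = coset_inv[OF _ wb(1)[OF inv] z(1)]
    have "inv\<^bsub>units_of (ZX n Quot C)\<^esub> (coset n C (w b)) \<in> Gen"
      unfolding Gen_def using inv by (intro generate.inv) auto
    then have "coset n C z \<in> Gen" using QC.units_of_inv[OF wU[OF inv]] zi[OF CI z(2)] by simp
    moreover have "coset n A z = PA (inv\<^bsub>int_vectors N\<^esub> b)"
      unfolding PA_hom(3)[OF PA_N bc] wb(2)[OF inv, symmetric] using zi[OF AI] z(2) CA by auto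
    moreover have "coset n P z = PP (inv\<^bsub>int_vectors N\<^esub> b)"
      unfolding PP_hom(3)[OF bc] wb(3)[OF inv, symmetric] using zi[OF PI] z(2) CA by auto
    ultimately show ?case using z(1) by blast
  next
    case (eng a b)
    then obtain y z where y: "y \<in> polys n" "coset n C y \<in> Gen" "coset n A y = PA a" "coset n P y = PP a"
      and z: "z \<in> polys n" "coset n C z \<in> Gen" "coset n A z = PA b" "coset n P z = PP b" by blast
    have "coset n C (y * z) \<in> Gen"
      using generate.eng[OF y(2)[unfolded Gen_def] z(2)[unfolded Gen_def]] coset_mult[OF CI y(1) z(1)]
      by (simp add: Gen_def units_of_mult)
    moreover have "coset n A (y * z) = PA (a \<otimes>\<^bsub>int_vectors N\<^esub> b)"
      unfolding PA_hom(2)[OF PA_N] y(3)[symmetric] z(3)[symmetric] by (rule coset_mult[OF AI y(1) z(1), symmetric])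
    moreover have "coset n P (y * z) = PP (a \<otimes>\<^bsub>int_vectors N\<^esub> b)"
      unfolding PP_hom(2) y(4)[symmetric] z(4)[symmetric] by (rule coset_mult[OF PI y(1) z(1), symmetric])
    ultimately show ?case using polys_mult[OF y(1) z(1)] by blast
  qed
  have "Units (ZX n Quot C) \<subseteq> Gen"
  proof
    fix u assume u: "u \<in> Units (ZX n Quot C)"
    obtain f where f: "f \<in> polys n" "u = coset n C f"
      using coset_cases[OF QC.Units_closed[OF u]] by blast
    have "coset n A f \<in> generate (units_of (ZX n Quot A)) (set gA)"
      using coset_unit_superset[OF CI AI CA(1) f(1)] u f(2) U'(4) gs by (simp add: gA_def)
    then obtain a1 where a1: "coset n A f = power_product (ZX n Quot A) gA a1"
      using QA.generate_power_products[OF gA] by blast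
    have "coset n P f \<in> generate (units_of (ZX n Quot P)) (set hP)"
      using coset_unit_superset[OF CI PI CA(2) f(1)] u f(2) hs'(4) by (simp add: hP_def)
    then obtain a2 where a2: "coset n P f = power_product (ZX n Quot P) hP a2"
      using QP.generate_power_products[OF hP] by blast
    define a where "a = (\<lambda>i\<in>{..<N}. if i < length gs then a1 i else a2 (i - length gs))"
    have aA: "coset n A f = PA a"
      unfolding a1 PA_def by (rule QA.power_product_cong[OF gA]) (auto simp: a_def gA_def N_def)
    have aP: "coset n P f = PP a"
      unfolding a2 PP_def by (rule QP.power_product_cong[OF hP]) (auto simp: a_def hP_def N_def)
    have "f - f \<in> J" using mpoly_ideal(2)[OF JI(1)] by simp
    then have "power_product (ZX n Quot J) us a = \<one>\<^bsub>ZX n Quot J\<^esub>"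
      using glue(2)[of a f f] rA[of a f] rP[of a f] aA aP f(1) by simp
    then have "a \<in> exponent_lattice (ZX n Quot J) us"
      by (simp add: exponent_lattice_def len int_vectors_simps a_def)
    then obtain z where z: "z \<in> polys n" "coset n C z \<in> Gen" "coset n A z = PA a" "coset n P z = PP a"
      using lift[of a] B'(3) by blast
    have "z - f \<in> A" using coset_eq_iff[OF AI z(1) f(1)] z(3) aA by simp
    moreover have "z - f \<in> P" using coset_eq_iff[OF PI z(1) f(1)] z(4) aP by simp
    ultimately have "coset n C z = coset n C f" using coset_eq_iff[OF CI z(1) f(1)] by (simp add: C_def)
    then show "u \<in> Gen" using z(2) f(2) by simp
  qed
  then have "Gen = Units (ZX n Quot C)" using GenU by blast
  then show ?thesis unfolding C unit_generators_def
    using B'(1) wb(1) sub by (auto simp: Gen_def)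
qed

lemma reachable_unit_generators:
  assumes s: "splitting n ps q p" and "ps \<noteq> []" and "reachable n ps q j U"
  shows "1 \<le> j \<and> j \<le> length ps \<and> unit_generators (ZX n) (prefix_Inter n ps j) U"
  using assms(3)
proof (induction rule: reachable.induct)
  case (start U)
  then show ?case using assms(2) prefix_Inter_1 by (simp add: Suc_le_eq)
next
  case (step j U hs gs B G H w)
  then show ?case using glued_unit_generators[OF s step.hyps(2) _ step.hyps(3-8)] by simp
qed

end

section \<open>Correctness of the algorithm\<close>

lemma torsion_free_saturated:
  assumes I: "ideal I (ZX n)" and tf: "torsion_free_ring (ZX n Quot I)"
  shows "saturated n I"
  unfolding saturated_def
proof (intro allI ballI impI)
  interpret Q: cring "ZX n Quot I" by (rule quotient_cring[OF I])
  fix N :: int and f assume f: "f \<in> polys n" and N: "N \<noteq> 0" "of_int N * f \<in> I"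
  have nat: "[m] \<cdot>\<^bsub>ZX n Quot I\<^esub> (coset n I f) = coset n I (of_nat m * f)" for m :: nat
  proof (induction m)
    case 0
    then show ?case by (simp add: coset_zero[OF I])
  next
    case (Suc m)
    have "of_nat m * f \<in> polys n" using polys_mult[OF polys_of_int[of "int m"] f] by simp
    then show ?case using Suc coset_add[OF I _ f, of "of_nat m * f"] by (simp add: algebra_simps)
  qed
  have "of_int \<bar>N\<bar> * f \<in> I" using N(2) mpoly_ideal(4)[OF I N(2)] by (cases "N \<ge> 0") auto
  then have "of_nat (nat \<bar>N\<bar>) * f \<in> I" by simp
  then have "[\<bar>N\<bar>] \<cdot>\<^bsub>ZX n Quot I\<^esub> (coset n I f) = \<zero>\<^bsub>ZX n Quot I\<^esub>"
    using nat[of "nat \<bar>N\<bar>"] coset_eq_iff[OF I mpoly_ideal(1)[OF I] polys_zero, of "of_nat (nat \<bar>N\<bar>) * f"]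
    by (simp add: add_pow_int_ge coset_zero[OF I])
  then have "coset n I f = coset n I 0"
    using tf coset_carrier[OF I f f] N(1) unfolding torsion_free_ring_def coset_zero[OF I]
    by (metis abs_eq_0)
  then show "f \<in> I" using coset_eq_iff[OF I f polys_zero] by simp
qed

lemma reduced_radical:
  assumes I: "ideal I (ZX n)" and red: "reduced_ring (ZX n Quot I)"
    and f: "f \<in> polys n" "f ^ k \<in> I"
  shows "f \<in> I"
proof -
  interpret Q: cring "ZX n Quot I" by (rule quotient_cring[OF I])
  have "(coset n I f) [^]\<^bsub>ZX n Quot I\<^esub> m = coset n I (f ^ m)" for m :: nat
  proof (induction m)
    case 0
    then show ?case by (simp add: coset_one)
  next
    case (Suc m)
    then show ?case using coset_mult[OF I polys_power[OF f(1)] f(1), of m] by (simp add: mult.commute)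
  qed
  then have "(coset n I f) [^]\<^bsub>ZX n Quot I\<^esub> k = \<zero>\<^bsub>ZX n Quot I\<^esub>"
    using coset_eq_iff[OF I polys_power[OF f(1)] polys_zero] f(2) by (simp add: coset_zero[OF I])
  then have "coset n I f = coset n I 0"
    using red coset_carrier[OF I f(1) f(1)] unfolding reduced_ring_def coset_zero[OF I] by blast
  then show "f \<in> I" using coset_eq_iff[OF I f(1) polys_zero] by simp
qed

theorem corollary4p7:
  fixes n :: nat and I :: "int mpoly set"
  assumes "ideal I (ZX n)"
    and "I \<noteq> carrier (ZX n)"
    and "\<exists>S. finite S \<and> S \<subseteq> carrier (ZX n) \<and> I = Idl\<^bsub>ZX n\<^esub> S"
    and "finite_int_algebra (ZX n Quot I)"
    and "torsion_free_ring (ZX n Quot I)"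
    and "reduced_ring (ZX n Quot I)"
  shows "(\<exists>ps. minimal_prime_list n I ps) \<and>
    (\<forall>ps. minimal_prime_list n I ps \<longrightarrow>
       ps \<noteq> [] \<and>
       (\<exists>q p. splitting n ps q p) \<and>
       (\<exists>U. unit_generators (ZX n) (ps ! 0) U) \<and>
       (\<forall>q p. splitting n ps q p \<longrightarrow>
          (\<forall>j U. reachable n ps q j U \<and> j < length ps \<longrightarrow> iteration_possible n ps q j U) \<and>
          (\<forall>U. reachable n ps q (length ps) U \<longrightarrow> unit_generators (ZX n) I U)))"
proof -
  have I: "integral_ideal n I"
    using assms(1) finite_int_algebra_integral[OF assms(1,4)] by (simp add: integral_ideal_def)
  have sat: "saturated n I" by (rule torsion_free_saturated[OF assms(1,5)])
  note minimal = minimal_primes_conv[OF I sat]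
  have "finite (minimal_primes (ZX n) I)" unfolding minimal by (rule finite_imageI[OF finite_points[OF I]])
  then have ex: "\<exists>ps. minimal_prime_list n I ps"
    unfolding minimal_prime_list_def using finite_distinct_list by blast
  have "1 \<notin> I"
    using ideal.one_imp_carrier[OF assms(1)] assms(2) by (auto simp: polys_simps)
  then have "of_int N * 1 \<notin> I" if "N \<noteq> 0" for N :: int
    using sat that polys_one unfolding saturated_def by blast
  then have "\<exists>\<chi>\<in>points n I. \<forall>s\<in>{1}. \<chi> s \<noteq> 0"
    by (intro integral_ideal_point[OF I]) (auto intro: polys_one)
  then have nonempty: "minimal_primes (ZX n) I \<noteq> {}" unfolding minimal by auto
  have Inter: "polys n \<inter> \<Inter>(minimal_primes (ZX n) I) = I"
    by (rule Inter_minimal_primes[OF I sat reduced_radical[OF assms(1,6)]])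
  have "ps \<noteq> [] \<and> (\<exists>q p. splitting n ps q p) \<and> (\<exists>U. unit_generators (ZX n) (ps ! 0) U) \<and>
       (\<forall>q p. splitting n ps q p \<longrightarrow>
          (\<forall>j U. reachable n ps q j U \<and> j < length ps \<longrightarrow> iteration_possible n ps q j U) \<and>
          (\<forall>U. reachable n ps q (length ps) U \<longrightarrow> unit_generators (ZX n) I U))"
    if ps: "minimal_prime_list n I ps" for ps
  proof -
    have ps': "distinct ps" "set ps = minimal_primes (ZX n) I" using ps by (auto simp: minimal_prime_list_def)
    have prime: "integral_prime n p" if "p \<in> set ps" for p
      using that point_kernel_integral_prime(1)[OF I] unfolding ps' minimal by auto
    interpret prime_list n ps
    proof
      show "integral_prime n p" if "p \<in> set ps" for p by (rule prime[OF that])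
      fix i j assume ij: "i < length ps" "j < length ps" "i \<noteq> j"
      show "\<not> ps ! i \<subseteq> ps ! j"
      proof
        assume sub: "ps ! i \<subseteq> ps ! j"
        note pj = integral_primeD[OF prime[OF nth_mem[OF ij(2)]]]
        have "ps ! j = ps ! i"
          by (rule integral_primes_incomparable[OF prime[OF nth_mem[OF ij(1)]] pj(1) sub pj(5)])
        then show False using ij ps'(1) by (simp add: nth_eq_iff_index_eq)
      qed
    qed
    have ne: "ps \<noteq> []" using nonempty ps'(2) by auto
    then have "\<exists>U. unit_generators (ZX n) (ps ! 0) U" by (intro unit_generators_exist prime_nth) simp
    moreover have "prefix_Inter n ps (length ps) = I"
      using Inter by (simp add: prefix_Inter_def ideal_Inter_def ps'(2))
    ultimately show ?thesis
      using ne splitting_exists reachable_unit_generators iteration_is_possible by metis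
  qed
  then show ?thesis using ex by blast
qed

end
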